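(* Let $\Lambda$ be a strongly connected finite $k$-graph with $\{0,1\}$ vertex matrices $A_1,\dots,A_k$, such that $A_1 \cdots A_k$ is also a $\{0,1\}$ matrix. Let $X=\Psi(\Lambda^\infty)$ be the Cantor-type fractal subspace of $[0,1]$ with the probability measure $\mu=\frac{1}{H^s(X)}H^s$, where $H^s$ is the Hausdorff measure on $X$ associated to its Hausdorff dimension $s$. Define the dynamics $\alpha'$ on $C^*(\Lambda)$ by $$\alpha'_t=\gamma_{\rho(\Lambda)^{it/s}},\qquad t\in\mathbb R,$$ where $\gamma$ is the gauge action on $C^*(\Lambda)$. Then the measure $\mu$ on $X$ defines a KMS state $\phi$ of the system $(C^*(\Lambda),\alpha')$ at the inverse temperature $\beta=s$, via $\phi(s_\lambda s_\nu^* )=\delta_{\lambda,\nu}\,\mu(\Psi(Z(\lambda)))$.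
   Context: Notation: $\mathbb N=\{0,1,2,\dots\}$, $k\ge 1$, and $e_1,\dots,e_k$ are the generators of $\mathbb N^k$. $k$-graphs: A $k$-graph is a countable category $\Lambda$ with a functor $d:\Lambda\to\mathbb N^k$ satisfying the factorization property: whenever $d(\lambda)=m+n$ there are unique $\mu,\nu\in\Lambda$ with $\lambda=\mu\nu$, $d(\mu)=m$, $d(\nu)=n$. $\Lambda^0$ is the set of identity morphisms (vertices), $r,s:\Lambda\to\Lambda^0$ are the range and source maps, $\Lambda^n=\{\lambda: d(\lambda)=n\}$, $v\Lambda w=\{\lambda: r(\lambda)=v, s(\lambda)=w\}$, $v\Lambda^n=\{\lambda\in\Lambda^n:r(\lambda)=v\}$. $\Lambda$ is finite if every $\Lambda^n$ is finite; strongly connected if $v\Lambda w\neq\emptyset$ for all $v,w\in\Lambda^0$ (this implies $\Lambda$ has no sources, i.e. $v\Lambda^n\ne\emptyset$ for all $v,n$). The vertex matrices are $A_i\in M_{\Lambda^0}(\mathbb N)$, $A_i(v,w)=|v\Lambda^{e_i}w|$; $\rho(A_i)$ is the spectral radius, $\rho(\Lambda)=(\rho(A_1),\dots,\rho(A_k))$, and $\rho(\Lambda)^{it/s}=(\rho(A_1)^{it/s},\dots,\rho(A_k)^{it/s})\in\mathbb T^k$. Infinite paths: $\Omega_k=\{(p,q)\in\mathbb N^k\times\mathbb N^k: p\le q\}$ is the $k$-graph with $r(p,q)=p$, $s(p,q)=q$, $(p,q)(q,m)=(p,m)$, $d(p,q)=q-p$. An infinite path is a $k$-graph morphism (degree-preserving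 functor) $x:\Omega_k\to\Lambda$; $\Lambda^\infty$ is the set of them, with topology having as basis the cylinder sets $Z(\lambda)=\{x\in\Lambda^\infty: x(0,d(\lambda))=\lambda\}$. Perron-Frobenius measure: $x^\Lambda$ denotes the unique vector with positive entries and $\ell^1$-norm one such that $A_ix^\Lambda=\rho(A_i)x^\Lambda$ for all $i$; $M$ is the Borel probability measure on $\Lambda^\infty$ with $M(Z(\lambda))=\rho(\Lambda)^{-d(\lambda)}x^\Lambda_{s(\lambda)}$ for all $\lambda\in\Lambda$, where $\rho(\Lambda)^n=\prod_i\rho(A_i)^{n_i}$. The map $\Psi$: Label $\Lambda^0$ by the integers $0,1,\dots,N-1$, where $N=|\Lambda^0|$, and identify vertices with labels. Each $x\in\Lambda^\infty$ has a unique decomposition $x=f^x_{11}f^x_{21}\cdots f^x_{k1}f^x_{12}\cdots f^x_{k2}f^x_{13}\cdots$ with $d(f^x_{ij})=e_i$ for all $1\le i\le k$, $j\ge1$. Let $v^x_{ij}=r(f^x_{ij})$. Then $\Psi:\Lambda^\infty\to[0,1]$ is given in $N$-adic expansion by $\Psi(x)=0.v^x_{11}v^x_{21}\ldots v^x_{k1}v^x_{12}\ldots=\sum_{1\le i\le k,\,j\ge1}\frac{v^x_{ij}}{N^{i+k(j-1)}}$. Hausdorff measure and dimension: For $E\subset\mathbb R^n$, $H^s_\delta(E)=\inf\sum_j\mathrm{diam}(A_j)^s$ over countable covers of $E$ by sets $A_j$ of diameter $<\delta$, and $H^s(E)=\lim_{\delta\to0^+}H^s_\delta(E)$. $E$ has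 Hausdorff dimension $s_0$ if $E$ is $H^{s_0}$-measurable and $0<H^{s_0}(E)<\infty$; the restriction of $H^{s_0}$ to measurable subsets of $E$ is the Hausdorff measure on $E$. The paper identifies the measure $\mu=\frac1{H^s(X)}H^s$ on $X$ with the push-forward $E\mapsto M(\Psi^{-1}(E))$. $C^*(\Lambda)$: A Cuntz-Krieger $\Lambda$-family is a collection $\{t_\lambda:\lambda\in\Lambda\}$ of partial isometries in a $C^*$-algebra with (CK1) $\{t_v:v\in\Lambda^0\}$ mutually orthogonal projections; (CK2) $t_\mu t_\lambda=t_{\mu\lambda}$ whenever $s(\mu)=r(\lambda)$; (CK3) $t_\mu^*t_\mu=t_{s(\mu)}$ for all $\mu$; (CK4) $t_v=\sum_{\lambda\in v\Lambda^n}t_\lambda t_\lambda^*$ for all $v\in\Lambda^0$, $n\in\mathbb N^k$. $C^*(\Lambda)$ is generated by a universal Cuntz-Krieger $\Lambda$-family $\{s_\lambda\}$. The gauge action $\gamma$ of $\mathbb T^k$ satisfies $\gamma_z(s_\lambda)=z^{d(\lambda)}s_\lambda$, $z^n=\prod z_i^{n_i}$. KMS states: Given an action $\alpha$ of $\mathbb R$ on a $C^*$-algebra $A$, $a\in A$ is analytic if $t\mapsto\alpha_t(a)$ extends to an analytic function $z\mapsto\alpha_z(a)$ on $\mathbb C$. A state $\phi$ is a KMS state at inverse temperature $\beta$ of $(A,\alpha)$ if $\phi(ab)=\phi(b\,\alpha_{i\beta}(a))$ for all analytic $a,b$.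
   Formalization: The paper's identification of μ with the push-forward of the Perron-Frobenius measure M under Ψ (on Borel subsets of X) is assumed, since the claim can fail without it when A_1⋯A_k is reducible; also s>0 is assumed, as the dynamics divides by s. *)

theory Defs
  imports
    "HOL-Probability.Probability_Measure"
    "HOL-Library.Function_Algebras"
    "HOL-Algebra.Ring"
    "Jordan_Normal_Form.Spectral_Radius"
begin

section \<open>Higher-rank graphs\<close>

text \<open>
  The monoid $N^k$ consists of the functions on the natural numbers that vanish outside the
  index set \<open>{1..k}\<close>; sum, difference and order are the pointwise ones.
\<close>

definition Nk :: "nat \<Rightarrow> (nat \<Rightarrow> nat) set" where
  "Nk k = {n. \<forall>i. i \<notin> {1..k} \<longrightarrow> n i = 0}"

definition unit_deg :: "nat \<Rightarrow> nat \<Rightarrow> nat" where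
  "unit_deg i = (\<lambda>l. if l = i then 1 else 0)"

text \<open>
  A category is given by its morphisms alone: objects are identified with their identity
  morphisms, so \<open>rng\<close> and \<open>src\<close> take values in the morphisms. The composite
  \<open>composite \<Lambda> \<mu> \<nu>\<close> (written $\mu\nu$) is meaningful when \<open>src \<Lambda> \<mu> = rng \<Lambda> \<nu>\<close>.
\<close>

record 'g kgraph =
  mor :: "'g set"
  rng :: "'g \<Rightarrow> 'g"
  src :: "'g \<Rightarrow> 'g"
  composite :: "'g \<Rightarrow> 'g \<Rightarrow> 'g"
  deg :: "'g \<Rightarrow> nat \<Rightarrow> nat"

definition vertices :: "'g kgraph \<Rightarrow> 'g set" where
  "vertices \<Lambda> = {v \<in> mor \<Lambda>. rng \<Lambda> v = v \<and> src \<Lambda> v = v}"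

locale kgraph =
  fixes k :: nat and \<Lambda> :: "'g kgraph"
  assumes k_pos: "1 \<le> k"
    and countable_mor: "countable (mor \<Lambda>)"
    and rng_vertex: "\<kappa> \<in> mor \<Lambda> \<Longrightarrow> rng \<Lambda> \<kappa> \<in> vertices \<Lambda>"
    and src_vertex: "\<kappa> \<in> mor \<Lambda> \<Longrightarrow> src \<Lambda> \<kappa> \<in> vertices \<Lambda>"
    and comp_closed: "\<lbrakk>\<mu> \<in> mor \<Lambda>; \<nu> \<in> mor \<Lambda>; src \<Lambda> \<mu> = rng \<Lambda> \<nu>\<rbrakk>
      \<Longrightarrow> composite \<Lambda> \<mu> \<nu> \<in> mor \<Lambda>"
    and rng_comp: "\<lbrakk>\<mu> \<in> mor \<Lambda>; \<nu> \<in> mor \<Lambda>; src \<Lambda> \<mu> = rng \<Lambda> \<nu>\<rbrakk>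
      \<Longrightarrow> rng \<Lambda> (composite \<Lambda> \<mu> \<nu>) = rng \<Lambda> \<mu>"
    and src_comp: "\<lbrakk>\<mu> \<in> mor \<Lambda>; \<nu> \<in> mor \<Lambda>; src \<Lambda> \<mu> = rng \<Lambda> \<nu>\<rbrakk>
      \<Longrightarrow> src \<Lambda> (composite \<Lambda> \<mu> \<nu>) = src \<Lambda> \<nu>"
    and comp_assoc: "\<lbrakk>\<mu> \<in> mor \<Lambda>; \<nu> \<in> mor \<Lambda>; \<eta> \<in> mor \<Lambda>;
      src \<Lambda> \<mu> = rng \<Lambda> \<nu>; src \<Lambda> \<nu> = rng \<Lambda> \<eta>\<rbrakk>
      \<Longrightarrow> composite \<Lambda> (composite \<Lambda> \<mu> \<nu>) \<eta> = composite \<Lambda> \<mu> (composite \<Lambda> \<nu> \<eta>)"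
    and comp_id_left: "\<kappa> \<in> mor \<Lambda> \<Longrightarrow> composite \<Lambda> (rng \<Lambda> \<kappa>) \<kappa> = \<kappa>"
    and comp_id_right: "\<kappa> \<in> mor \<Lambda> \<Longrightarrow> composite \<Lambda> \<kappa> (src \<Lambda> \<kappa>) = \<kappa>"
    and deg_Nk: "\<kappa> \<in> mor \<Lambda> \<Longrightarrow> deg \<Lambda> \<kappa> \<in> Nk k"
    and deg_id: "v \<in> vertices \<Lambda> \<Longrightarrow> deg \<Lambda> v = 0"
    and deg_comp: "\<lbrakk>\<mu> \<in> mor \<Lambda>; \<nu> \<in> mor \<Lambda>; src \<Lambda> \<mu> = rng \<Lambda> \<nu>\<rbrakk>
      \<Longrightarrow> deg \<Lambda> (composite \<Lambda> \<mu> \<nu>) = deg \<Lambda> \<mu> + deg \<Lambda> \<nu>"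
    and factorization: "\<lbrakk>\<kappa> \<in> mor \<Lambda>; m \<in> Nk k; n \<in> Nk k; deg \<Lambda> \<kappa> = m + n\<rbrakk>
      \<Longrightarrow> \<exists>!(\<mu>, \<nu>). \<mu> \<in> mor \<Lambda> \<and> \<nu> \<in> mor \<Lambda> \<and> src \<Lambda> \<mu> = rng \<Lambda> \<nu> \<and>
            composite \<Lambda> \<mu> \<nu> = \<kappa> \<and> deg \<Lambda> \<mu> = m \<and> deg \<Lambda> \<nu> = n"

definition paths_deg :: "'g kgraph \<Rightarrow> (nat \<Rightarrow> nat) \<Rightarrow> 'g set" where
  "paths_deg \<Lambda> n = {\<kappa> \<in> mor \<Lambda>. deg \<Lambda> \<kappa> = n}"

definition finite_kgraph :: "nat \<Rightarrow> 'g kgraph \<Rightarrow> bool" where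
  "finite_kgraph k \<Lambda> \<longleftrightarrow> (\<forall>n \<in> Nk k. finite (paths_deg \<Lambda> n))"

definition strongly_connected :: "'g kgraph \<Rightarrow> bool" where
  "strongly_connected \<Lambda> \<longleftrightarrow> (\<forall>v \<in> vertices \<Lambda>. \<forall>w \<in> vertices \<Lambda>.
     \<exists>\<kappa> \<in> mor \<Lambda>. rng \<Lambda> \<kappa> = v \<and> src \<Lambda> \<kappa> = w)"

definition vertex_matrix :: "'g kgraph \<Rightarrow> nat \<Rightarrow> 'g \<Rightarrow> 'g \<Rightarrow> nat" where
  "vertex_matrix \<Lambda> i v w = card {\<kappa> \<in> paths_deg \<Lambda> (unit_deg i). rng \<Lambda> \<kappa> = v \<and> src \<Lambda> \<kappa> = w}"

definition vertex_labelling :: "'g kgraph \<Rightarrow> ('g \<Rightarrow> nat) \<Rightarrow> bool" where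
  "vertex_labelling \<Lambda> lab \<longleftrightarrow> bij_betw lab (vertices \<Lambda>) {..<card (vertices \<Lambda>)}"

definition vertex_mat :: "'g kgraph \<Rightarrow> ('g \<Rightarrow> nat) \<Rightarrow> nat \<Rightarrow> nat mat" where
  "vertex_mat \<Lambda> lab i = mat (card (vertices \<Lambda>)) (card (vertices \<Lambda>))
     (\<lambda>(a, b). vertex_matrix \<Lambda> i (the_inv_into (vertices \<Lambda>) lab a) (the_inv_into (vertices \<Lambda>) lab b))"

definition vertex_mat_prod :: "nat \<Rightarrow> 'g kgraph \<Rightarrow> ('g \<Rightarrow> nat) \<Rightarrow> nat mat" where
  "vertex_mat_prod k \<Lambda> lab =
     foldr (\<lambda>i B. vertex_mat \<Lambda> lab i * B) [1..<Suc k] (1\<^sub>m (card (vertices \<Lambda>)))"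

definition zero_one_mat :: "nat mat \<Rightarrow> bool" where
  "zero_one_mat B \<longleftrightarrow> (\<forall>a < dim_row B. \<forall>b < dim_col B. B $$ (a, b) \<in> {0, 1})"

text \<open>The spectral radius does not depend on the labelling \<open>lab\<close>.\<close>

definition rho :: "'g kgraph \<Rightarrow> ('g \<Rightarrow> nat) \<Rightarrow> nat \<Rightarrow> real" where
  "rho \<Lambda> lab i = spectral_radius (map_mat of_nat (vertex_mat \<Lambda> lab i))"


section \<open>Infinite paths\<close>

text \<open>The object \<open>p\<close> of $\Omega_k$ is the morphism \<open>(p, p)\<close>.\<close>

definition Omega :: "nat \<Rightarrow> ((nat \<Rightarrow> nat) \<times> (nat \<Rightarrow> nat)) kgraph" where
  "Omega k = \<lparr>mor = {(p, q). p \<in> Nk k \<and> q \<in> Nk k \<and> p \<le> q},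
     rng = (\<lambda>(p, q). (p, p)),
     src = (\<lambda>(p, q). (q, q)),
     composite = (\<lambda>(p, q) (q', m). (p, m)),
     deg = (\<lambda>(p, q). q - p)\<rparr>"

definition kgraph_morphism :: "'h kgraph \<Rightarrow> 'g kgraph \<Rightarrow> ('h \<Rightarrow> 'g) \<Rightarrow> bool" where
  "kgraph_morphism \<Gamma> \<Lambda> x \<longleftrightarrow>
     (\<forall>\<mu> \<in> mor \<Gamma>. x \<mu> \<in> mor \<Lambda> \<and> rng \<Lambda> (x \<mu>) = x (rng \<Gamma> \<mu>) \<and>
        src \<Lambda> (x \<mu>) = x (src \<Gamma> \<mu>) \<and> deg \<Lambda> (x \<mu>) = deg \<Gamma> \<mu>) \<and>
     (\<forall>\<mu> \<in> mor \<Gamma>. \<forall>\<nu> \<in> mor \<Gamma>. src \<Gamma> \<mu> = rng \<Gamma> \<nu> \<longrightarrow>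
        x (composite \<Gamma> \<mu> \<nu>) = composite \<Lambda> (x \<mu>) (x \<nu>))"

type_synonym 'g ipath = "(nat \<Rightarrow> nat) \<times> (nat \<Rightarrow> nat) \<Rightarrow> 'g"

definition infinite_paths :: "nat \<Rightarrow> 'g kgraph \<Rightarrow> 'g ipath set" where
  "infinite_paths k \<Lambda> = {x \<in> extensional (mor (Omega k)). kgraph_morphism (Omega k) \<Lambda> x}"

definition cylinder :: "nat \<Rightarrow> 'g kgraph \<Rightarrow> 'g \<Rightarrow> 'g ipath set" where
  "cylinder k \<Lambda> \<kappa> = {x \<in> infinite_paths k \<Lambda>. x (0, deg \<Lambda> \<kappa>) = \<kappa>}"

definition path_topology :: "nat \<Rightarrow> 'g kgraph \<Rightarrow> 'g ipath topology" where
  "path_topology k \<Lambda> = topology_generated_by (cylinder k \<Lambda> ` mor \<Lambda>)"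

definition path_borel :: "nat \<Rightarrow> 'g kgraph \<Rightarrow> 'g ipath measure" where
  "path_borel k \<Lambda> = sigma (infinite_paths k \<Lambda>) {U. openin (path_topology k \<Lambda>) U}"


section \<open>The Perron-Frobenius measure\<close>

definition perron_frobenius_vector ::
  "nat \<Rightarrow> 'g kgraph \<Rightarrow> ('g \<Rightarrow> nat) \<Rightarrow> ('g \<Rightarrow> real) \<Rightarrow> bool" where
  "perron_frobenius_vector k \<Lambda> lab x \<longleftrightarrow>
     (\<forall>v \<in> vertices \<Lambda>. 0 < x v) \<and> (\<Sum>v \<in> vertices \<Lambda>. x v) = 1 \<and>
     (\<forall>i \<in> {1..k}. \<forall>v \<in> vertices \<Lambda>.
        (\<Sum>w \<in> vertices \<Lambda>. real (vertex_matrix \<Lambda> i v w) * x w) = rho \<Lambda> lab i * x v)"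

definition perron_frobenius_measure ::
  "nat \<Rightarrow> 'g kgraph \<Rightarrow> ('g \<Rightarrow> nat) \<Rightarrow> ('g \<Rightarrow> real) \<Rightarrow> 'g ipath measure \<Rightarrow> bool" where
  "perron_frobenius_measure k \<Lambda> lab x M \<longleftrightarrow>
     prob_space M \<and> sets M = sets (path_borel k \<Lambda>) \<and>
     (\<forall>\<kappa> \<in> mor \<Lambda>. measure M (cylinder k \<Lambda> \<kappa>) =
        inverse (\<Prod>i = 1..k. rho \<Lambda> lab i ^ deg \<Lambda> \<kappa> i) * x (src \<Lambda> \<kappa>))"


section \<open>The map from infinite paths to the unit interval\<close>

text \<open>
  In the decomposition $x = f_{11} f_{21} \cdots f_{k1} f_{12} \cdots$ the edge $f_{ij}$ is
  preceded by edges of total degree $(j-1)(e_1+\cdots+e_k) + e_1+\cdots+e_{i-1}$.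
\<close>

definition edge_start :: "nat \<Rightarrow> nat \<Rightarrow> nat \<Rightarrow> nat \<Rightarrow> nat" where
  "edge_start k i j = (\<lambda>l. if l \<in> {1..k} then (j - 1) + (if l < i then 1 else 0) else 0)"

definition path_edge :: "nat \<Rightarrow> 'g ipath \<Rightarrow> nat \<Rightarrow> nat \<Rightarrow> 'g" where
  "path_edge k x i j = x (edge_start k i j, edge_start k i j + unit_deg i)"

definition Psi :: "nat \<Rightarrow> 'g kgraph \<Rightarrow> ('g \<Rightarrow> nat) \<Rightarrow> 'g ipath \<Rightarrow> real" where
  "Psi k \<Lambda> lab x = (\<Sum>\<^sub>\<infinity>(i, j) \<in> {1..k} \<times> {1..}.
     real (lab (rng \<Lambda> (path_edge k x i j))) / real (card (vertices \<Lambda>)) ^ (i + k * (j - 1)))"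


section \<open>Hausdorff measure and dimension\<close>

text \<open>
  Conventions for \<open>diam(A)\<^sup>s\<close>: the empty set contributes 0, and nonempty sets contribute 1
  when \<open>s = 0\<close> (whereas \<open>0 powr 0 = 0\<close> in the library).
\<close>

definition diam_pow :: "real \<Rightarrow> 'a::metric_space set \<Rightarrow> ennreal" where
  "diam_pow s A = (if A = {} then 0 else if s = 0 then 1 else ennreal (diameter A powr s))"

definition hausdorff_content :: "real \<Rightarrow> real \<Rightarrow> 'a::metric_space set \<Rightarrow> ennreal" where
  "hausdorff_content s \<delta> E =
     (INF A \<in> {A :: nat \<Rightarrow> 'a set. E \<subseteq> (\<Union>j. A j) \<and> (\<forall>j. bounded (A j) \<and> diameter (A j) < \<delta>)}.
        \<Sum>j. diam_pow s (A j))"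

definition hausdorff_outer :: "real \<Rightarrow> 'a::metric_space set \<Rightarrow> ennreal" where
  "hausdorff_outer s E = Lim (at_right 0) (\<lambda>\<delta>. hausdorff_content s \<delta> E)"

text \<open>Measurability with respect to the outer measure is meant in the sense of Caratheodory.\<close>

definition hausdorff_sets :: "real \<Rightarrow> 'a::metric_space set set" where
  "hausdorff_sets s = lambda_system UNIV UNIV (hausdorff_outer s)"

definition hausdorff_measure :: "real \<Rightarrow> 'a::metric_space measure" where
  "hausdorff_measure s = measure_of UNIV (hausdorff_sets s) (hausdorff_outer s)"

definition has_hausdorff_dimension :: "'a::metric_space set \<Rightarrow> real \<Rightarrow> bool" where
  "has_hausdorff_dimension E s \<longleftrightarrow>
     0 \<le> s \<and> E \<in> hausdorff_sets s \<and> 0 < hausdorff_outer s E \<and> hausdorff_outer s E < \<infinity>"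

definition normalized_hausdorff :: "real \<Rightarrow> 'a::metric_space set \<Rightarrow> 'a measure" where
  "normalized_hausdorff s X =
     scale_measure (1 / emeasure (hausdorff_measure s) X) (restrict_space (hausdorff_measure s) X)"


section \<open>C*-algebras\<close>

text \<open>
  C*-algebras are not assumed to be unital; the field \<open>one\<close> of the ring record plays no role.
\<close>

record 'a cstar = "'a ring" +
  cscale :: "complex \<Rightarrow> 'a \<Rightarrow> 'a"
  cadj :: "'a \<Rightarrow> 'a"
  cnorm :: "'a \<Rightarrow> real"

locale cstar_algebra = abelian_group A for A :: "'a cstar" (structure) +
  assumes mult_closed: "\<lbrakk>a \<in> carrier A; b \<in> carrier A\<rbrakk> \<Longrightarrow> a \<otimes> b \<in> carrier A"
    and mult_assoc: "\<lbrakk>a \<in> carrier A; b \<in> carrier A; c \<in> carrier A\<rbrakk>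
      \<Longrightarrow> (a \<otimes> b) \<otimes> c = a \<otimes> (b \<otimes> c)"
    and distr_left: "\<lbrakk>a \<in> carrier A; b \<in> carrier A; c \<in> carrier A\<rbrakk>
      \<Longrightarrow> (a \<oplus> b) \<otimes> c = a \<otimes> c \<oplus> b \<otimes> c"
    and distr_right: "\<lbrakk>a \<in> carrier A; b \<in> carrier A; c \<in> carrier A\<rbrakk>
      \<Longrightarrow> a \<otimes> (b \<oplus> c) = a \<otimes> b \<oplus> a \<otimes> c"
    and scale_closed: "a \<in> carrier A \<Longrightarrow> cscale A z a \<in> carrier A"
    and scale_add_right: "\<lbrakk>a \<in> carrier A; b \<in> carrier A\<rbrakk>
      \<Longrightarrow> cscale A z (a \<oplus> b) = cscale A z a \<oplus> cscale A z b"
    and scale_add_left: "a \<in> carrier A \<Longrightarrow> cscale A (z + w) a = cscale A z a \<oplus> cscale A w a"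
    and scale_scale: "a \<in> carrier A \<Longrightarrow> cscale A (z * w) a = cscale A z (cscale A w a)"
    and scale_one: "a \<in> carrier A \<Longrightarrow> cscale A 1 a = a"
    and mult_scale_left: "\<lbrakk>a \<in> carrier A; b \<in> carrier A\<rbrakk>
      \<Longrightarrow> cscale A z a \<otimes> b = cscale A z (a \<otimes> b)"
    and mult_scale_right: "\<lbrakk>a \<in> carrier A; b \<in> carrier A\<rbrakk>
      \<Longrightarrow> a \<otimes> cscale A z b = cscale A z (a \<otimes> b)"
    and adj_closed: "a \<in> carrier A \<Longrightarrow> cadj A a \<in> carrier A"
    and adj_adj: "a \<in> carrier A \<Longrightarrow> cadj A (cadj A a) = a"
    and adj_add: "\<lbrakk>a \<in> carrier A; b \<in> carrier A\<rbrakk> \<Longrightarrow> cadj A (a \<oplus> b) = cadj A a \<oplus> cadj A b"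
    and adj_mult: "\<lbrakk>a \<in> carrier A; b \<in> carrier A\<rbrakk> \<Longrightarrow> cadj A (a \<otimes> b) = cadj A b \<otimes> cadj A a"
    and adj_scale: "a \<in> carrier A \<Longrightarrow> cadj A (cscale A z a) = cscale A (cnj z) (cadj A a)"
    and norm_nonneg: "a \<in> carrier A \<Longrightarrow> 0 \<le> cnorm A a"
    and norm_eq_0: "a \<in> carrier A \<Longrightarrow> cnorm A a = 0 \<longleftrightarrow> a = \<zero>"
    and norm_add: "\<lbrakk>a \<in> carrier A; b \<in> carrier A\<rbrakk> \<Longrightarrow> cnorm A (a \<oplus> b) \<le> cnorm A a + cnorm A b"
    and norm_scale: "a \<in> carrier A \<Longrightarrow> cnorm A (cscale A z a) = cmod z * cnorm A a"
    and norm_mult: "\<lbrakk>a \<in> carrier A; b \<in> carrier A\<rbrakk> \<Longrightarrow> cnorm A (a \<otimes> b) \<le> cnorm A a * cnorm A b"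
    and norm_cstar: "a \<in> carrier A \<Longrightarrow> cnorm A (cadj A a \<otimes> a) = (cnorm A a)\<^sup>2"
    and complete: "\<lbrakk>range f \<subseteq> carrier A;
      \<And>e. 0 < e \<Longrightarrow> \<exists>n0. \<forall>m \<ge> n0. \<forall>n \<ge> n0. cnorm A (f m \<ominus> f n) < e\<rbrakk>
      \<Longrightarrow> \<exists>a \<in> carrier A. (\<lambda>n::nat. cnorm A (f n \<ominus> a)) \<longlonglongrightarrow> 0"

definition star_hom :: "'a cstar \<Rightarrow> 'b cstar \<Rightarrow> ('a \<Rightarrow> 'b) \<Rightarrow> bool" where
  "star_hom A B \<pi> \<longleftrightarrow>
     (\<forall>a \<in> carrier A. \<pi> a \<in> carrier B \<and> \<pi> (cadj A a) = cadj B (\<pi> a) \<and>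
        (\<forall>z. \<pi> (cscale A z a) = cscale B z (\<pi> a))) \<and>
     (\<forall>a \<in> carrier A. \<forall>b \<in> carrier A.
        \<pi> (a \<oplus>\<^bsub>A\<^esub> b) = \<pi> a \<oplus>\<^bsub>B\<^esub> \<pi> b \<and> \<pi> (a \<otimes>\<^bsub>A\<^esub> b) = \<pi> a \<otimes>\<^bsub>B\<^esub> \<pi> b)"

definition closed_star_subalgebra :: "'a cstar \<Rightarrow> 'a set \<Rightarrow> bool" where
  "closed_star_subalgebra A C \<longleftrightarrow>
     C \<subseteq> carrier A \<and> \<zero>\<^bsub>A\<^esub> \<in> C \<and>
     (\<forall>a \<in> C. cadj A a \<in> C \<and> (\<forall>z. cscale A z a \<in> C)) \<and>
     (\<forall>a \<in> C. \<forall>b \<in> C. a \<oplus>\<^bsub>A\<^esub> b \<in> C \<and> a \<otimes>\<^bsub>A\<^esub> b \<in> C) \<and>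
     (\<forall>f a. range f \<subseteq> C \<and> a \<in> carrier A \<and> (\<lambda>n::nat. cnorm A (f n \<ominus>\<^bsub>A\<^esub> a)) \<longlonglongrightarrow> 0 \<longrightarrow> a \<in> C)"

definition cstar_generated_by :: "'a cstar \<Rightarrow> 'a set \<Rightarrow> bool" where
  "cstar_generated_by A G \<longleftrightarrow>
     G \<subseteq> carrier A \<and> (\<forall>C. closed_star_subalgebra A C \<and> G \<subseteq> C \<longrightarrow> C = carrier A)"


section \<open>The C*-algebra of a higher-rank graph\<close>

definition is_projection :: "'a cstar \<Rightarrow> 'a \<Rightarrow> bool" where
  "is_projection A p \<longleftrightarrow> p \<in> carrier A \<and> cadj A p = p \<and> p \<otimes>\<^bsub>A\<^esub> p = p"

definition is_partial_isometry :: "'a cstar \<Rightarrow> 'a \<Rightarrow> bool" where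
  "is_partial_isometry A t \<longleftrightarrow> t \<in> carrier A \<and> t \<otimes>\<^bsub>A\<^esub> cadj A t \<otimes>\<^bsub>A\<^esub> t = t"

definition cuntz_krieger_family :: "nat \<Rightarrow> 'g kgraph \<Rightarrow> 'a cstar \<Rightarrow> ('g \<Rightarrow> 'a) \<Rightarrow> bool" where
  "cuntz_krieger_family k \<Lambda> A t \<longleftrightarrow>
     (\<forall>\<kappa> \<in> mor \<Lambda>. is_partial_isometry A (t \<kappa>)) \<and>
     (\<forall>v \<in> vertices \<Lambda>. is_projection A (t v)) \<and>
     (\<forall>v \<in> vertices \<Lambda>. \<forall>w \<in> vertices \<Lambda>. v \<noteq> w \<longrightarrow> t v \<otimes>\<^bsub>A\<^esub> t w = \<zero>\<^bsub>A\<^esub>) \<and>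
     (\<forall>\<mu> \<in> mor \<Lambda>. \<forall>\<kappa> \<in> mor \<Lambda>. src \<Lambda> \<mu> = rng \<Lambda> \<kappa> \<longrightarrow>
        t \<mu> \<otimes>\<^bsub>A\<^esub> t \<kappa> = t (composite \<Lambda> \<mu> \<kappa>)) \<and>
     (\<forall>\<mu> \<in> mor \<Lambda>. cadj A (t \<mu>) \<otimes>\<^bsub>A\<^esub> t \<mu> = t (src \<Lambda> \<mu>)) \<and>
     (\<forall>v \<in> vertices \<Lambda>. \<forall>n \<in> Nk k.
        t v = (\<Oplus>\<^bsub>A\<^esub>\<kappa> \<in> {\<kappa> \<in> paths_deg \<Lambda> n. rng \<Lambda> \<kappa> = v}. t \<kappa> \<otimes>\<^bsub>A\<^esub> cadj A (t \<kappa>)))"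

text \<open>
  \<open>A\<close> together with \<open>S\<close> is a model of $C^*(\Lambda)$. The formula cannot quantify over all types,
  so the target \<open>B\<close> ranges over the C*-algebras whose elements are complex sequences. This is
  no restriction: $\Lambda$ is countable, hence every C*-algebra generated by a Cuntz-Krieger
  $\Lambda$-family has at most the cardinality of the continuum and is isomorphic to such a \<open>B\<close>.
\<close>

definition is_kgraph_cstar_algebra :: "nat \<Rightarrow> 'g kgraph \<Rightarrow> 'a cstar \<Rightarrow> ('g \<Rightarrow> 'a) \<Rightarrow> bool" where
  "is_kgraph_cstar_algebra k \<Lambda> A S \<longleftrightarrow>
     cstar_algebra A \<and> cuntz_krieger_family k \<Lambda> A S \<and> cstar_generated_by A (S ` mor \<Lambda>) \<and>
     (\<forall>(B :: (nat \<Rightarrow> complex) cstar) t. cstar_algebra B \<and> cuntz_krieger_family k \<Lambda> B t \<longrightarrow>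
        (\<exists>\<pi>. star_hom A B \<pi> \<and> (\<forall>\<kappa> \<in> mor \<Lambda>. \<pi> (S \<kappa>) = t \<kappa>)))"

definition torus :: "nat \<Rightarrow> (nat \<Rightarrow> complex) set" where
  "torus k = ({1..k} \<rightarrow>\<^sub>E {z. cmod z = 1})"

text \<open>Strong continuity of the gauge action follows from the formula on the generators.\<close>

definition is_gauge_action ::
  "nat \<Rightarrow> 'g kgraph \<Rightarrow> 'a cstar \<Rightarrow> ('g \<Rightarrow> 'a) \<Rightarrow> ((nat \<Rightarrow> complex) \<Rightarrow> 'a \<Rightarrow> 'a) \<Rightarrow> bool" where
  "is_gauge_action k \<Lambda> A S \<gamma> \<longleftrightarrow>
     (\<forall>z \<in> torus k. star_hom A A (\<gamma> z) \<and> bij_betw (\<gamma> z) (carrier A) (carrier A) \<and>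
        (\<forall>\<kappa> \<in> mor \<Lambda>. \<gamma> z (S \<kappa>) = cscale A (\<Prod>i = 1..k. z i ^ deg \<Lambda> \<kappa> i) (S \<kappa>))) \<and>
     (\<forall>z \<in> torus k. \<forall>w \<in> torus k. \<forall>a \<in> carrier A.
        \<gamma> (\<lambda>i \<in> {1..k}. z i * w i) a = \<gamma> z (\<gamma> w a))"

definition rho_dynamics ::
  "nat \<Rightarrow> 'g kgraph \<Rightarrow> ('g \<Rightarrow> nat) \<Rightarrow> ((nat \<Rightarrow> complex) \<Rightarrow> 'a \<Rightarrow> 'a) \<Rightarrow> real \<Rightarrow> real \<Rightarrow> 'a \<Rightarrow> 'a" where
  "rho_dynamics k \<Lambda> lab \<gamma> s t =
     \<gamma> (\<lambda>i \<in> {1..k}. complex_of_real (rho \<Lambda> lab i) powr (\<i> * complex_of_real (t / s)))"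


section \<open>KMS states\<close>

definition is_state :: "'a cstar \<Rightarrow> ('a \<Rightarrow> complex) \<Rightarrow> bool" where
  "is_state A \<phi> \<longleftrightarrow>
     (\<forall>a \<in> carrier A. \<forall>b \<in> carrier A. \<phi> (a \<oplus>\<^bsub>A\<^esub> b) = \<phi> a + \<phi> b) \<and>
     (\<forall>a \<in> carrier A. \<forall>z. \<phi> (cscale A z a) = z * \<phi> a) \<and>
     (\<forall>a \<in> carrier A. \<phi> (cadj A a \<otimes>\<^bsub>A\<^esub> a) \<in> \<real> \<and> 0 \<le> Re (\<phi> (cadj A a \<otimes>\<^bsub>A\<^esub> a))) \<and>
     bdd_above {cmod (\<phi> a) | a. a \<in> carrier A \<and> cnorm A a \<le> 1} \<and>
     Sup {cmod (\<phi> a) | a. a \<in> carrier A \<and> cnorm A a \<le> 1} = 1"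

definition analytic_fun :: "'a cstar \<Rightarrow> (complex \<Rightarrow> 'a) \<Rightarrow> bool" where
  "analytic_fun A F \<longleftrightarrow> range F \<subseteq> carrier A \<and>
     (\<forall>z. \<exists>D \<in> carrier A.
        ((\<lambda>w. cnorm A (cscale A (1 / (w - z)) (F w \<ominus>\<^bsub>A\<^esub> F z) \<ominus>\<^bsub>A\<^esub> D)) \<longlongrightarrow> 0) (at z))"

text \<open>\<open>F\<close> is the (unique) analytic extension $z \mapsto \alpha_z(a)$ of the orbit of \<open>a\<close>.\<close>

definition analytic_extension :: "'a cstar \<Rightarrow> (real \<Rightarrow> 'a \<Rightarrow> 'a) \<Rightarrow> 'a \<Rightarrow> (complex \<Rightarrow> 'a) \<Rightarrow> bool" where
  "analytic_extension A \<alpha> a F \<longleftrightarrow> analytic_fun A F \<and> (\<forall>t. F (complex_of_real t) = \<alpha> t a)"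

definition is_KMS_state ::
  "'a cstar \<Rightarrow> (real \<Rightarrow> 'a \<Rightarrow> 'a) \<Rightarrow> real \<Rightarrow> ('a \<Rightarrow> complex) \<Rightarrow> bool" where
  "is_KMS_state A \<alpha> \<beta> \<phi> \<longleftrightarrow> is_state A \<phi> \<and>
     (\<forall>a \<in> carrier A. \<forall>b \<in> carrier A. \<forall>F G.
        analytic_extension A \<alpha> a F \<and> analytic_extension A \<alpha> b G \<longrightarrow>
        \<phi> (a \<otimes>\<^bsub>A\<^esub> b) = \<phi> (b \<otimes>\<^bsub>A\<^esub> F (\<i> * complex_of_real \<beta>)))"

end

theory Submission
  imports Defs "HOL-Complex_Analysis.Conformal_Mappings" "HOL-Library.Diagonal_Subsequence"
begin

text \<open>
  For an infinite path $y$, $C^*(\Lambda)$ acts on $\ell^2$ of the set of paths that share a tail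
  with $y$, each taken together with its lag. The vector state of the base point $y$ sends
  $s_\kappa s_\nu^*$ to 1 if $\kappa = \nu$ and $y \in Z(\kappa)$, and to 0 otherwise; averaging these
  states over $y$ with respect to $M$ gives $\phi$. A positive functional is automatically
  continuous, so only its values on the span of the $s_\kappa s_\nu^*$ matter, which yields uniqueness.

  The scaling property of $M$ gives $\phi(s_\kappa b) = \rho(\Lambda)^{-d(\kappa)} \phi(b s_\kappa)$,
  and the identity theorem for entire functions extends the KMS condition from the span to all
  analytic elements.

  Points have measure zero for $H^s$ with $s > 0$, hence so have the fibres of $\Psi$ for $M$. Since the
  vertex matrices are zero-one matrices, a path is determined by its digits, so that $\Psi$ is
  injective up to countably many paths and $\mu(\Psi(Z(\lambda))) = M(Z(\lambda))$.
\<close>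

section \<open>Square roots in C*-algebras\<close>

text \<open>The order structure of a C*-algebra is replaced by one tool: for self-adjoint
  \<open>h\<close> of norm below 1, the element \<open>1 - h\<close> is the square of a self-adjoint
  element, found by iteration. It serves twice. It bounds a positive functional by its value at the
  unit, and it shows that projections whose sum dominates each of them are mutually orthogonal. The
  second use is forced by the Cuntz-Krieger relations, which give only the sum of the range
  projections; their orthogonality is what reduces a product of monomials to a sum of monomials.

  The lag in the representation is there for periodic paths: a path may have the form
  \<open>\<kappa> z = \<nu> z\<close> with \<kappa> and \<nu> different, and only the lag keeps the
  two basis vectors apart, so that off-diagonal monomials get the value 0.

  No integral over the path space is formed. Finite weighted averages of vector states take the
  right value at each monomial from some degree on, and their uniform bound carries the convergence
  to the whole algebra.\<close>

context cstar_algebra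
begin

declare mult_closed [simp, intro] scale_closed [simp, intro] adj_closed [simp, intro]
  adj_adj [simp] scale_one [simp]

lemma scale_zero_left [simp]:
  assumes "a \<in> carrier A"
  shows "cscale A 0 a = \<zero>"
proof -
  have "cscale A 0 a \<oplus> cscale A 0 a = cscale A 0 a"
    using scale_add_left[OF assms, of 0 0] by simp
  then show ?thesis
    using assms by (metis add.r_cancel_one scale_closed)
qed

lemma scale_zero_right [simp]: "cscale A z \<zero> = \<zero>"
  by (metis mult_zero_right scale_scale scale_zero_left zero_closed)

lemma a_inv_scale: "a \<in> carrier A \<Longrightarrow> \<ominus> a = cscale A (-1) a"
  by (rule minus_equality) (use scale_add_left[of a "-1" 1] in auto)

lemma mult_zero_alg [simp]:
  assumes "a \<in> carrier A"
  shows "\<zero> \<otimes> a = \<zero>" "a \<otimes> \<zero> = \<zero>"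
  using mult_scale_left[of \<zero> a 0] mult_scale_right[of a \<zero> 0] assms by auto

lemma adj_zero [simp]: "cadj A \<zero> = \<zero>"
  using adj_scale[of \<zero> 0] by simp

lemma minus_scale: "\<lbrakk>a \<in> carrier A; b \<in> carrier A\<rbrakk> \<Longrightarrow> a \<ominus> b = a \<oplus> cscale A (-1) b"
  by (simp add: minus_eq a_inv_scale)

lemma scale_minus:
  "\<lbrakk>a \<in> carrier A; b \<in> carrier A\<rbrakk> \<Longrightarrow> cscale A z (a \<ominus> b) = cscale A z a \<ominus> cscale A z b"
  by (simp add: minus_scale scale_add_right flip: scale_scale)

lemma adj_minus:
  "\<lbrakk>a \<in> carrier A; b \<in> carrier A\<rbrakk> \<Longrightarrow> cadj A (a \<ominus> b) = cadj A a \<ominus> cadj A b"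
  by (simp add: minus_scale adj_add adj_scale)

lemma mult_minus_left:
  "\<lbrakk>a \<in> carrier A; b \<in> carrier A; c \<in> carrier A\<rbrakk> \<Longrightarrow> (a \<ominus> b) \<otimes> c = a \<otimes> c \<ominus> b \<otimes> c"
  by (simp add: minus_scale distr_left mult_scale_left)

lemma mult_minus_right:
  "\<lbrakk>a \<in> carrier A; b \<in> carrier A; c \<in> carrier A\<rbrakk> \<Longrightarrow> c \<otimes> (a \<ominus> b) = c \<otimes> a \<ominus> c \<otimes> b"
  by (simp add: minus_scale distr_right mult_scale_right)

lemma minus_self [simp]: "a \<in> carrier A \<Longrightarrow> a \<ominus> a = \<zero>"
  by (simp add: minus_eq r_neg)

lemma minus_zero_right [simp]: "a \<in> carrier A \<Longrightarrow> a \<ominus> \<zero> = a"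
  by (simp add: minus_eq)

lemma minus_add_minus:
  "\<lbrakk>a \<in> carrier A; b \<in> carrier A; c \<in> carrier A\<rbrakk> \<Longrightarrow> (a \<ominus> b) \<oplus> (b \<ominus> c) = a \<ominus> c"
  by (simp add: minus_eq a_assoc r_neg1)

lemma add_minus_add:
  "\<lbrakk>a \<in> carrier A; b \<in> carrier A; c \<in> carrier A; d \<in> carrier A\<rbrakk> \<Longrightarrow>
    (a \<oplus> b) \<ominus> (c \<oplus> d) = (a \<ominus> c) \<oplus> (b \<ominus> d)"
  by (simp add: minus_scale scale_add_right a_ac)

lemma norm_zero [simp]: "cnorm A \<zero> = 0"
  by (simp add: norm_eq_0)

lemma norm_minus_commute:
  assumes "a \<in> carrier A" "b \<in> carrier A"
  shows "cnorm A (a \<ominus> b) = cnorm A (b \<ominus> a)"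
proof -
  have "a \<ominus> b = cscale A (-1) (b \<ominus> a)"
    using assms by (simp add: minus_scale scale_add_right a_comm flip: scale_scale)
  then show ?thesis using assms by (simp add: norm_scale)
qed

lemma norm_triangle_minus:
  "\<lbrakk>a \<in> carrier A; b \<in> carrier A; c \<in> carrier A\<rbrakk> \<Longrightarrow>
    cnorm A (a \<ominus> c) \<le> cnorm A (a \<ominus> b) + cnorm A (b \<ominus> c)"
  by (metis minus_add_minus minus_closed norm_add)

lemma norm_le_minus_add:
  assumes "a \<in> carrier A" "b \<in> carrier A"
  shows "cnorm A a \<le> cnorm A (a \<ominus> b) + cnorm A b"
  using norm_triangle_minus[of a b \<zero>] assms by simp

text \<open>The C*-identity bounds the square of \<open>cnorm A b\<close> by
  \<open>cnorm A (cadj A b) * cnorm A b\<close>. Cancelling a factor gives one inequality, and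
  replacing \<open>b\<close> by its adjoint the other.\<close>

lemma norm_adj [simp]:
  assumes "a \<in> carrier A"
  shows "cnorm A (cadj A a) = cnorm A a"
proof -
  have le: "cnorm A b \<le> cnorm A (cadj A b)" if "b \<in> carrier A" for b
  proof (cases "cnorm A b = 0")
    case True
    then show ?thesis using that norm_nonneg by simp
  next
    case False
    then have "0 < cnorm A b" using norm_nonneg[OF that] by simp
    moreover have "cnorm A b * cnorm A b \<le> cnorm A (cadj A b) * cnorm A b"
      using norm_mult[of "cadj A b" b] norm_cstar[OF that] that by (simp add: power2_eq_square)
    ultimately show ?thesis by simp
  qed
  show ?thesis using le[OF assms] le[of "cadj A a"] assms by simp
qed

section \<open>Norm convergence of sequences\<close>

definition tends_to :: "(nat \<Rightarrow> 'a) \<Rightarrow> 'a \<Rightarrow> bool" where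
  "tends_to f a \<longleftrightarrow> (\<lambda>n. cnorm A (f n \<ominus> a)) \<longlonglongrightarrow> 0"

lemma tends_toI:
  assumes "\<And>n. cnorm A (f n \<ominus> a) \<le> g n" "g \<longlonglongrightarrow> 0" "range f \<subseteq> carrier A" "a \<in> carrier A"
  shows "tends_to f a"
  unfolding tends_to_def
  by (rule Lim_null_comparison[OF _ assms(2)])
    (use assms in \<open>auto intro!: always_eventually simp: norm_nonneg range_subsetD\<close>)

lemma tends_to_unique:
  assumes "tends_to f a" "tends_to f b" and f: "range f \<subseteq> carrier A" and "a \<in> carrier A" "b \<in> carrier A"
  shows "a = b"
proof -
  have "cnorm A (a \<ominus> b) \<le> cnorm A (f n \<ominus> a) + cnorm A (f n \<ominus> b)" for n
    using norm_triangle_minus[of a "f n" b] norm_minus_commute[of a "f n"] f assms(4,5)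
    by (simp add: range_subsetD)
  moreover have "(\<lambda>n. cnorm A (f n \<ominus> a) + cnorm A (f n \<ominus> b)) \<longlonglongrightarrow> 0 + 0"
    by (intro tendsto_add assms(1,2)[unfolded tends_to_def])
  ultimately have "cnorm A (a \<ominus> b) \<le> 0"
    by (intro LIMSEQ_le_const) auto
  then have "cnorm A (a \<ominus> b) = 0"
    using norm_nonneg[of "a \<ominus> b"] assms(4,5) by simp
  then show ?thesis
    using assms(4,5) by (simp add: norm_eq_0)
qed

lemma tends_to_add:
  assumes "tends_to f a" "tends_to g b" "range f \<subseteq> carrier A" "range g \<subseteq> carrier A"
    "a \<in> carrier A" "b \<in> carrier A"
  shows "tends_to (\<lambda>n. f n \<oplus> g n) (a \<oplus> b)"
proof (rule tends_toI)
  show "cnorm A (f n \<oplus> g n \<ominus> (a \<oplus> b)) \<le> cnorm A (f n \<ominus> a) + cnorm A (g n \<ominus> b)" for n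
    using assms(3-) by (simp add: add_minus_add norm_add range_subsetD)
  show "(\<lambda>n. cnorm A (f n \<ominus> a) + cnorm A (g n \<ominus> b)) \<longlonglongrightarrow> 0"
    using tendsto_add[OF assms(1,2)[unfolded tends_to_def]] by simp
qed (use assms(3-) in \<open>auto simp: range_subsetD\<close>)

lemma tends_to_scale:
  assumes "tends_to f a" "range f \<subseteq> carrier A" "a \<in> carrier A"
  shows "tends_to (\<lambda>n. cscale A z (f n)) (cscale A z a)"
proof (rule tends_toI)
  show "cnorm A (cscale A z (f n) \<ominus> cscale A z a) \<le> cmod z * cnorm A (f n \<ominus> a)" for n
    using assms(2-) by (simp add: norm_scale range_subsetD flip: scale_minus)
  show "(\<lambda>n. cmod z * cnorm A (f n \<ominus> a)) \<longlonglongrightarrow> 0"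
    using tendsto_mult_left[OF assms(1)[unfolded tends_to_def], of "cmod z"] by simp
qed (use assms(2-) in \<open>auto simp: range_subsetD\<close>)

lemma tends_to_adj:
  assumes "tends_to f a" "range f \<subseteq> carrier A" "a \<in> carrier A"
  shows "tends_to (\<lambda>n. cadj A (f n)) (cadj A a)"
  using assms by (simp add: tends_to_def range_subsetD flip: adj_minus)

lemma tends_to_mult:
  assumes "tends_to f a" "tends_to g b" "range f \<subseteq> carrier A" "range g \<subseteq> carrier A"
    "a \<in> carrier A" "b \<in> carrier A"
  shows "tends_to (\<lambda>n. f n \<otimes> g n) (a \<otimes> b)"
proof (rule tends_toI)
  fix n
  have fg: "f n \<in> carrier A" "g n \<in> carrier A" using assms by auto
  have "f n \<otimes> g n \<ominus> a \<otimes> b = (f n \<ominus> a) \<otimes> g n \<oplus> a \<otimes> (g n \<ominus> b)"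
    using fg assms(5,6) by (simp add: mult_minus_left mult_minus_right minus_add_minus)
  moreover have "cnorm A ((f n \<ominus> a) \<otimes> g n) \<le> cnorm A (f n \<ominus> a) * (cnorm A (g n \<ominus> b) + cnorm A b)"
    using norm_mult[of "f n \<ominus> a" "g n"] norm_le_minus_add[of "g n" b] fg assms(5,6)
    by (smt (verit) minus_closed mult_left_mono norm_nonneg)
  moreover have "cnorm A (a \<otimes> (g n \<ominus> b)) \<le> cnorm A a * cnorm A (g n \<ominus> b)"
    using norm_mult[of a "g n \<ominus> b"] fg assms(5,6) by simp
  ultimately show "cnorm A (f n \<otimes> g n \<ominus> a \<otimes> b) \<le>
      cnorm A (f n \<ominus> a) * (cnorm A (g n \<ominus> b) + cnorm A b) + cnorm A a * cnorm A (g n \<ominus> b)"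
    using norm_add[of "(f n \<ominus> a) \<otimes> g n" "a \<otimes> (g n \<ominus> b)"] fg assms(5,6) by simp
next
  have "(\<lambda>n. cnorm A (f n \<ominus> a) * (cnorm A (g n \<ominus> b) + cnorm A b) + cnorm A a * cnorm A (g n \<ominus> b))
     \<longlonglongrightarrow> 0 * (0 + cnorm A b) + cnorm A a * 0"
    by (intro tendsto_intros assms(1,2)[unfolded tends_to_def])
  then show "(\<lambda>n. cnorm A (f n \<ominus> a) * (cnorm A (g n \<ominus> b) + cnorm A b) + cnorm A a * cnorm A (g n \<ominus> b))
     \<longlonglongrightarrow> 0" by simp
qed (use assms(3-) in \<open>auto simp: range_subsetD\<close>)

lemma tends_to_const [simp]: "a \<in> carrier A \<Longrightarrow> tends_to (\<lambda>n. a) a"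
  by (simp add: tends_to_def)

text \<open>Properties of the square roots below are proved for every iterate and then carried to
  the limit; this is the closure that such an induction needs.\<close>

definition limit_closed :: "'a set \<Rightarrow> bool" where
  "limit_closed C \<longleftrightarrow> C \<subseteq> carrier A \<and>
    (\<forall>f a. range f \<subseteq> C \<and> a \<in> carrier A \<and> tends_to f a \<longrightarrow> a \<in> C)"

lemma limit_closedD:
  "\<lbrakk>limit_closed C; range f \<subseteq> C; a \<in> carrier A; tends_to f a\<rbrakk> \<Longrightarrow> a \<in> C"
  unfolding limit_closed_def by blast

definition seq_continuous :: "('a \<Rightarrow> 'a) \<Rightarrow> bool" where
  "seq_continuous F \<longleftrightarrow> F \<in> carrier A \<rightarrow> carrier A \<and>
    (\<forall>f a. range f \<subseteq> carrier A \<and> a \<in> carrier A \<and> tends_to f a \<longrightarrow> tends_to (\<lambda>n. F (f n)) (F a))"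

lemma seq_continuous_intros:
  "seq_continuous (\<lambda>y. y)" "seq_continuous (cadj A)"
  "p \<in> carrier A \<Longrightarrow> seq_continuous (\<lambda>y. p \<otimes> y)"
  "p \<in> carrier A \<Longrightarrow> seq_continuous (\<lambda>y. y \<otimes> p)"
  by (auto simp: seq_continuous_def intro: tends_to_adj tends_to_mult)

lemma limit_closed_eq:
  assumes "seq_continuous F" "seq_continuous G"
  shows "limit_closed {y \<in> carrier A. F y = G y}"
  unfolding limit_closed_def
proof (intro conjI allI impI CollectI; (elim conjE)?)
  fix f a assume fa: "range f \<subseteq> {y \<in> carrier A. F y = G y}" "a \<in> carrier A" "tends_to f a"
  then have f: "range f \<subseteq> carrier A" and eq: "F (f n) = G (f n)" for n by auto
  have "tends_to (\<lambda>n. F (f n)) (F a)" "tends_to (\<lambda>n. G (f n)) (G a)"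
    using assms fa(2,3) f by (auto simp: seq_continuous_def)
  then show "F a = G a"
    using assms fa(2) f by (intro tends_to_unique[of "\<lambda>n. F (f n)"]) (auto simp: seq_continuous_def eq)
qed auto

text \<open>
  The fixed point \<open>b\<close> below is $1 - \sqrt{1 - h}$, reached by iterating
  $y \mapsto (h + y^2)/2$ from zero; on the ball of radius $1 - \sqrt{1 - \|h\|}$ this is a contraction.
\<close>

lemma sqrt_fixed_point:
  assumes h: "h \<in> carrier A" and h1: "cnorm A h < 1"
  obtains b where "b \<in> carrier A" "b \<oplus> b = h \<oplus> b \<otimes> b"
    "\<And>C. \<lbrakk>limit_closed C; \<zero> \<in> C; \<And>y. y \<in> C \<Longrightarrow> cscale A (1/2) (h \<oplus> y \<otimes> y) \<in> C\<rbrakk> \<Longrightarrow> b \<in> C"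
proof -
  define T where "T y = cscale A (1/2) (h \<oplus> y \<otimes> y)" for y
  define f where "f n = (T ^^ n) \<zero>" for n
  define \<beta> where "\<beta> = 1 - sqrt (1 - cnorm A h)"
  have h0: "0 \<le> cnorm A h" using h norm_nonneg by simp
  have \<beta>: "0 \<le> \<beta>" "\<beta> < 1" using h0 h1 by (auto simp: \<beta>_def)
  \<comment> \<open>\<beta> is the smaller root of \<open>t = (cnorm A h + t * t) / 2\<close>, so
    the iteration maps the ball of radius \<beta> into itself.\<close>
  have \<beta>_eq: "(cnorm A h + \<beta> * \<beta>) / 2 = \<beta>"
    using h1 by (simp add: \<beta>_def algebra_simps diff_divide_distrib)
  have f0: "f 0 = \<zero>" and fS: "f (Suc n) = T (f n)" for n
    by (auto simp: f_def)
  have fc: "f n \<in> carrier A" for n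
    by (induction n) (auto simp: f0 fS T_def h)
  have fb: "cnorm A (f n) \<le> \<beta>" for n
  proof (induction n)
    case (Suc n)
    have "cnorm A (f (Suc n)) = cnorm A (h \<oplus> f n \<otimes> f n) / 2"
      using h fc by (simp add: fS T_def norm_scale)
    also have "\<dots> \<le> (cnorm A h + cnorm A (f n) * cnorm A (f n)) / 2"
      using norm_add[OF h, of "f n \<otimes> f n"] norm_mult[OF fc fc, of n n] fc by simp
    also have "\<dots> \<le> (cnorm A h + \<beta> * \<beta>) / 2"
      using mult_mono[OF Suc Suc] norm_nonneg[OF fc] \<beta> by simp
    finally show ?case using \<beta>_eq by simp
  qed (use \<beta> f0 in simp)
  have T_diff: "cnorm A (T y \<ominus> T z) \<le> \<beta> * cnorm A (y \<ominus> z)"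
    if "y \<in> carrier A" "z \<in> carrier A" "cnorm A y \<le> \<beta>" "cnorm A z \<le> \<beta>" for y z
  proof -
    have "T y \<ominus> T z = cscale A (1/2) (y \<otimes> y \<ominus> z \<otimes> z)"
      using that h by (simp add: T_def add_minus_add flip: scale_minus)
    \<comment> \<open>Both products have norm at most \<beta> times the norm of
      \<open>y - z\<close>; with the factor 1/2 in \<open>T\<close> this makes \<beta> a Lipschitz
      constant.\<close>
    also have "y \<otimes> y \<ominus> z \<otimes> z = (y \<ominus> z) \<otimes> y \<oplus> z \<otimes> (y \<ominus> z)"
      using that by (simp add: mult_minus_left mult_minus_right minus_add_minus)
    finally have "cnorm A (T y \<ominus> T z) \<le> (cnorm A ((y \<ominus> z) \<otimes> y) + cnorm A (z \<otimes> (y \<ominus> z))) / 2"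
      using that norm_add by (simp add: norm_scale)
    also have "\<dots> \<le> (cnorm A (y \<ominus> z) * cnorm A y + cnorm A z * cnorm A (y \<ominus> z)) / 2"
      using that norm_mult by (smt (verit) divide_right_mono minus_closed)
    also have "\<dots> \<le> (cnorm A (y \<ominus> z) * \<beta> + \<beta> * cnorm A (y \<ominus> z)) / 2"
      using that norm_nonneg[of "y \<ominus> z"]
      by (intro divide_right_mono add_mono mult_left_mono mult_right_mono) auto
    finally show ?thesis by simp
  qed
  have step: "cnorm A (f n \<ominus> f (Suc n)) \<le> \<beta> ^ n" for n
  proof (induction n)
    case 0
    have "cnorm A (f 0 \<ominus> f (Suc 0)) = cnorm A (f (Suc 0))"
      using norm_minus_commute[OF fc fc, of 0 "Suc 0"] fc by (simp add: f0)
    also have "\<dots> \<le> \<beta>" by (rule fb)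
    finally show ?case using \<beta> by simp
  next
    case (Suc n)
    have "cnorm A (f (Suc n) \<ominus> f (Suc (Suc n))) \<le> \<beta> * cnorm A (f n \<ominus> f (Suc n))"
      unfolding fS[of n] fS[of "Suc n"] by (intro T_diff fc fb) (metis fS fc fb)+
    also have "\<dots> \<le> \<beta> ^ Suc n" using Suc \<beta> by (simp add: mult_left_mono)
    finally show ?case .
  qed
  have far: "cnorm A (f n \<ominus> f (n + p)) \<le> (\<Sum>i<p. \<beta> ^ (n + i))" for n p
  proof (induction p)
    case 0
    then show ?case using fc by simp
  next
    case (Suc p)
    then show ?case
      using norm_triangle_minus[of "f n" "f (n + p)" "f (n + Suc p)"] step[of "n + p"] fc by simp
  qed
  have geo: "(\<Sum>i<p. \<beta> ^ (n + i)) \<le> \<beta> ^ n / (1 - \<beta>)" for n p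
  proof -
    have "(\<Sum>i<p. \<beta> ^ i) \<le> 1 / (1 - \<beta>)"
      using \<beta> sum_le_suminf[OF summable_geometric[of \<beta>], of "{..<p}"] suminf_geometric[of \<beta>] by simp
    then have "\<beta> ^ n * (\<Sum>i<p. \<beta> ^ i) \<le> \<beta> ^ n * (1 / (1 - \<beta>))"
      using \<beta> by (intro mult_left_mono) auto
    then show ?thesis by (simp add: power_add sum_distrib_left)
  qed
  have cau: "cnorm A (f n \<ominus> f m) \<le> \<beta> ^ n / (1 - \<beta>)" if "n \<le> m" for n m
    using far[of n "m - n"] geo[of n "m - n"] that by simp
  have tail: "(\<lambda>n. \<beta> ^ n / (1 - \<beta>)) \<longlonglongrightarrow> 0"
    using \<beta> LIMSEQ_realpow_zero[of \<beta>] tendsto_divide[of "\<lambda>n. \<beta> ^ n" 0 sequentially "\<lambda>_. 1 - \<beta>" "1 - \<beta>"]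
    by simp
  have "\<exists>b\<in>carrier A. (\<lambda>n. cnorm A (f n \<ominus> b)) \<longlonglongrightarrow> 0"
  proof (rule complete)
    fix e :: real assume "0 < e"
    then have "\<forall>\<^sub>F n in sequentially. \<beta> ^ n / (1 - \<beta>) < e"
      using tail by (rule order_tendstoD(2)[rotated])
    then obtain n0 where n0: "\<And>n. n \<ge> n0 \<Longrightarrow> \<beta> ^ n / (1 - \<beta>) < e"
      by (auto simp: eventually_sequentially)
    show "\<exists>n0. \<forall>m\<ge>n0. \<forall>n\<ge>n0. cnorm A (f m \<ominus> f n) < e"
    proof (intro exI[of _ n0] allI impI)
      fix m n assume mn: "n0 \<le> m" "n0 \<le> n"
      show "cnorm A (f m \<ominus> f n) < e"
        using cau[of m n] cau[of n m] n0[OF mn(1)] n0[OF mn(2)] norm_minus_commute[OF fc fc, of m n]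
        by (cases "m \<le> n") auto
    qed
  qed (use fc in auto)
  then obtain b where b: "b \<in> carrier A" "tends_to f b" by (auto simp: tends_to_def)
  have "tends_to (\<lambda>n. T (f n)) (T b)"
    unfolding T_def using b fc h
    by (intro tends_to_scale tends_to_add tends_to_mult tends_to_const) auto
  moreover have "tends_to (\<lambda>n. T (f n)) b"
    using LIMSEQ_Suc[OF b(2)[unfolded tends_to_def]] by (simp add: tends_to_def fS)
  ultimately have Tb: "T b = b"
    using b h fc by (intro tends_to_unique[of "\<lambda>n. T (f n)"]) (auto simp: T_def)
  have "b \<oplus> b = cscale A (1/2 + 1/2) (h \<oplus> b \<otimes> b)"
    unfolding scale_add_left[OF a_closed[OF h mult_closed[OF b(1) b(1)]]]
    using Tb by (simp add: T_def)
  then have eq: "b \<oplus> b = h \<oplus> b \<otimes> b" using b h by simp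
  \<comment> \<open>The last claim is an induction principle: what holds at zero, survives one
    iteration and is closed under limits holds at \<open>b\<close>. Self-adjointness and commutation
    of square roots are obtained from it.\<close>
  show ?thesis
  proof (rule that[OF b(1) eq])
    fix C assume C: "limit_closed C" "\<zero> \<in> C" "\<And>y. y \<in> C \<Longrightarrow> cscale A (1/2) (h \<oplus> y \<otimes> y) \<in> C"
    have "f n \<in> C" for n
      by (induction n) (auto simp: f0 fS T_def C)
    then show "b \<in> C" using C(1) b unfolding limit_closed_def by blast
  qed
qed


section \<open>Positivity expressed through norms\<close>

lemma norm_self_adjoint:
  assumes "a \<in> carrier A" "cadj A a = a"
  shows "cnorm A (a \<otimes> a) = (cnorm A a)\<^sup>2"
  using norm_cstar[OF assms(1)] assms(2) by simp

lemma norm_projection_le_one: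
  assumes "p \<in> carrier A" "cadj A p = p" "p \<otimes> p = p"
  shows "cnorm A p \<le> 1"
proof -
  have "cnorm A p * cnorm A p = cnorm A p"
    using norm_self_adjoint[OF assms(1,2)] assms(3) by (simp add: power2_eq_square)
  then show ?thesis by auto
qed

text \<open>The induction step for showing that the fixed point \<open>b\<close> commutes with
  whatever commutes with \<open>h\<close>.\<close>

lemma commute_iteration:
  assumes "q \<in> carrier A" "h \<in> carrier A" "y \<in> carrier A" "q \<otimes> h = h \<otimes> q" "q \<otimes> y = y \<otimes> q"
  shows "q \<otimes> cscale A z (h \<oplus> y \<otimes> y) = cscale A z (h \<oplus> y \<otimes> y) \<otimes> q"
proof -
  have "q \<otimes> (y \<otimes> y) = (y \<otimes> y) \<otimes> q"
    using assms(1,3,5) by (metis mult_assoc)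
  then show ?thesis
    using assms(1-4) by (simp add: mult_scale_left mult_scale_right distr_left distr_right)
qed

lemma scale_cancel:
  "a \<in> carrier A \<Longrightarrow> cscale A z a \<oplus> cscale A (- z) a = \<zero>"
  using scale_add_left[of a z "- z"] by simp

text \<open>
  Norm conditions \<open>\<parallel>e - c\<parallel> \<le> 1\<close> and \<open>\<parallel>e + c\<parallel> \<le> 1\<close> replace positivity of \<open>c\<close> and \<open>-c\<close>.
  For \<open>0 < r < 1\<close> both \<open>e - r(e - c)\<close> and \<open>e - r(e + c)\<close> are squares of commuting
  self-adjoint elements \<open>g\<close>, \<open>g'\<close>, and \<open>(g + ig')\<^sup>*(g + ig') = 2(1 - r)e\<close> is small.
\<close>

lemma zero_if_both_signs_positive:
  assumes e: "e \<in> carrier A" "cadj A e = e" "e \<otimes> e = e"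
    and c: "c \<in> carrier A" "cadj A c = c" "e \<otimes> c = c" "c \<otimes> e = c"
    and small: "cnorm A (e \<ominus> c) \<le> 1" "cnorm A (e \<oplus> c) \<le> 1"
  shows "c = \<zero>"
proof -
  have ne: "cnorm A e \<le> 1" using norm_projection_le_one e by simp
  \<comment> \<open>The factor \<open>r < 1\<close> brings the norms strictly below 1, where the
    fixed points exist; afterwards \<open>r\<close> is taken close to 1.\<close>
  have bound: "r * cnorm A c \<le> 3 * (1 - r)" if r: "0 < r" "r < 1" for r :: real
  proof -
    define h where "h = cscale A (of_real r) (e \<ominus> c)"
    define h' where "h' = cscale A (of_real r) (e \<oplus> c)"
    have hc: "h \<in> carrier A" "h' \<in> carrier A" using e c by (auto simp: h_def h'_def)
    have hadj: "cadj A h = h" "cadj A h' = h'"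
      using e c by (simp_all add: h_def h'_def adj_scale adj_minus adj_add)
    have eh: "e \<otimes> h = h" "h \<otimes> e = h" "e \<otimes> h' = h'" "h' \<otimes> e = h'"
      using e c by (simp_all add: h_def h'_def mult_scale_left mult_scale_right mult_minus_left
          mult_minus_right distr_left distr_right)
    have "(e \<ominus> c) \<otimes> (e \<oplus> c) = (e \<oplus> c) \<otimes> (e \<ominus> c)"
      using e c by (simp add: mult_scale_left mult_scale_right minus_scale distr_left distr_right
          scale_add_right a_ac)
    then have hh: "h \<otimes> h' = h' \<otimes> h"
      using e c by (simp add: h_def h'_def mult_scale_left mult_scale_right)
    have "r * t < 1" if "t \<le> 1" for t
      using mult_left_mono[OF that, of r] r by linarith
    then have nh: "cnorm A h < 1" "cnorm A h' < 1"
      using small r e c by (simp_all add: h_def h'_def norm_scale)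
    have hsum: "h \<oplus> h' = cscale A (of_real (2 * r)) e"
    proof -
      have "(e \<ominus> c) \<oplus> (e \<oplus> c) = (e \<oplus> e) \<oplus> (c \<oplus> cscale A (-1) c)"
        using e c by (simp add: minus_scale a_ac)
      then have "h \<oplus> h' = cscale A (of_real r) (e \<oplus> e)"
        using e c scale_cancel[of c 1] by (simp add: h_def h'_def flip: scale_add_right)
      then show ?thesis
        using e scale_add_left[OF e(1), of "of_real r" "of_real r"] by (simp add: scale_add_right)
    qed
    obtain b where b: "b \<in> carrier A" "b \<oplus> b = h \<oplus> b \<otimes> b" and bC:
      "\<And>C. \<lbrakk>limit_closed C; \<zero> \<in> C; \<And>y. y \<in> C \<Longrightarrow> cscale A (1/2) (h \<oplus> y \<otimes> y) \<in> C\<rbrakk> \<Longrightarrow> b \<in> C"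
      using sqrt_fixed_point[OF hc(1) nh(1)] by metis
    obtain b' where b': "b' \<in> carrier A" "b' \<oplus> b' = h' \<oplus> b' \<otimes> b'" and b'C:
      "\<And>C. \<lbrakk>limit_closed C; \<zero> \<in> C; \<And>y. y \<in> C \<Longrightarrow> cscale A (1/2) (h' \<oplus> y \<otimes> y) \<in> C\<rbrakk> \<Longrightarrow> b' \<in> C"
      using sqrt_fixed_point[OF hc(2) nh(2)] by metis
    have "b \<in> {y \<in> carrier A. cadj A y = y}" "b' \<in> {y \<in> carrier A. cadj A y = y}"
      by (intro bC b'C limit_closed_eq seq_continuous_intros;
          auto simp: hc hadj adj_scale adj_add adj_mult)+
    then have badj: "cadj A b = b" "cadj A b' = b'" by auto
    have "b \<in> {y \<in> carrier A. e \<otimes> y = y}" "b' \<in> {y \<in> carrier A. e \<otimes> y = y}"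
      by (intro bC b'C limit_closed_eq seq_continuous_intros e;
          auto simp: hc e eh mult_scale_right distr_right simp flip: mult_assoc)+
    then have eb: "e \<otimes> b = b" "e \<otimes> b' = b'" by auto
    then have be: "b \<otimes> e = b" "b' \<otimes> e = b'"
      using adj_mult[of e b] adj_mult[of e b'] b(1) b'(1) e badj by auto
    \<comment> \<open>Commutation is inherited twice: \<open>b\<close> commutes with
      \<open>h'\<close> because \<open>h\<close> does, and then \<open>b'\<close> commutes with
      \<open>b\<close> because \<open>h'\<close> does.\<close>
    have "b \<in> {y \<in> carrier A. h' \<otimes> y = y \<otimes> h'}"
      by (intro bC limit_closed_eq seq_continuous_intros hc)
        (auto simp: hc intro!: commute_iteration hh[symmetric])
    then have h'b: "b \<otimes> h' = h' \<otimes> b" by auto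
    have "b' \<in> {y \<in> carrier A. b \<otimes> y = y \<otimes> b}"
      by (intro b'C limit_closed_eq seq_continuous_intros b)
        (auto simp: hc b intro!: commute_iteration h'b)
    then have bb': "b \<otimes> b' = b' \<otimes> b" by auto
    \<comment> \<open>Completing the square with \<open>e\<close> as local unit:
      \<open>e - 2 y + y y = e - k\<close>.\<close>
    have square: "(e \<ominus> y) \<otimes> (e \<ominus> y) = e \<ominus> k"
      if "y \<in> carrier A" "k \<in> carrier A" "y \<oplus> y = k \<oplus> y \<otimes> y" "e \<otimes> y = y" "y \<otimes> e = y" for y k
    proof -
      have "(e \<ominus> y) \<otimes> (e \<ominus> y) = e \<oplus> (cscale A (-1) (y \<oplus> y) \<oplus> y \<otimes> y)"
        using that(1,2,4,5) e by (simp add: minus_scale distr_left distr_right mult_scale_left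
            mult_scale_right scale_add_right a_ac flip: scale_scale)
      also have "\<dots> = e \<oplus> (cscale A (-1) k \<oplus> (cscale A (-1) (y \<otimes> y) \<oplus> y \<otimes> y))"
        using that(1,2) by (simp add: that(3) scale_add_right a_ac)
      also have "cscale A (-1) (y \<otimes> y) \<oplus> y \<otimes> y = \<zero>"
        using that(1) scale_cancel[of "y \<otimes> y" "-1"] by simp
      finally show ?thesis using that(1,2) e by (simp add: minus_scale)
    qed
    define g where "g = e \<ominus> b"
    define g' where "g' = e \<ominus> b'"
    have g: "g \<in> carrier A" "g' \<in> carrier A" "cadj A g = g" "cadj A g' = g'"
      using e b b' badj by (auto simp: g_def g'_def adj_minus)
    have gg: "g \<otimes> g = e \<ominus> h" "g' \<otimes> g' = e \<ominus> h'"
      using square[OF b(1) hc(1) b(2) eb(1) be(1)] square[OF b'(1) hc(2) b'(2) eb(2) be(2)]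
      by (auto simp: g_def g'_def)
    have gcom: "g \<otimes> g' = g' \<otimes> g"
      using e b b' eb be bb' by (simp add: g_def g'_def minus_scale distr_left distr_right
          mult_scale_left mult_scale_right scale_add_right a_ac)
    define z where "z = g \<oplus> cscale A \<i> g'"
    have z: "z \<in> carrier A" "cadj A z = g \<oplus> cscale A (-\<i>) g'"
      using g by (auto simp: z_def adj_add adj_scale)
    have "cadj A z \<otimes> z = (g \<otimes> g \<oplus> g' \<otimes> g') \<oplus> (cscale A \<i> (g \<otimes> g') \<oplus> cscale A (-\<i>) (g \<otimes> g'))"
      unfolding z(2) using g by (simp add: z_def distr_left distr_right mult_scale_left
          mult_scale_right scale_add_right a_ac gcom flip: scale_scale)
    also have "\<dots> = g \<otimes> g \<oplus> g' \<otimes> g'" using g by (simp add: scale_cancel)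
    also have "\<dots> = (e \<oplus> e) \<ominus> (h \<oplus> h')" using e hc by (simp add: gg add_minus_add)
    also have "\<dots> = cscale A (of_real (2 - 2 * r)) e"
      using e scale_add_left[of e 1 1] scale_add_left[of e 2 "- of_real (2 * r)"]
      by (simp add: hsum minus_scale flip: scale_scale)
    finally have "(cnorm A z)\<^sup>2 \<le> 2 - 2 * r"
      using norm_cstar[OF z(1)] ne r e mult_left_mono[of "cnorm A e" 1 "2 - 2 * r"]
      by (simp add: norm_scale flip: of_real_diff)
    \<comment> \<open>\<open>g\<close> is the self-adjoint part of \<open>z\<close>, hence not
      larger in norm.\<close>
    moreover have "g = cscale A (1/2) (z \<oplus> cadj A z)"
    proof -
      have "z \<oplus> cadj A z = (g \<oplus> g) \<oplus> (cscale A \<i> g' \<oplus> cscale A (-\<i>) g')"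
        unfolding z(2) using g by (simp add: z_def a_ac)
      moreover have "cscale A (1/2) (g \<oplus> g) = g"
        using g scale_add_left[of g "1/2" "1/2"] by (simp add: scale_add_right)
      ultimately show ?thesis using g by (simp add: scale_cancel)
    qed
    then have "cnorm A g \<le> cnorm A z"
      using norm_add[of z "cadj A z"] z(1) by (simp add: norm_scale)
    then have "(cnorm A g)\<^sup>2 \<le> (cnorm A z)\<^sup>2" using norm_nonneg g by (simp add: power_mono)
    ultimately have eh_small: "cnorm A (e \<ominus> h) \<le> 2 - 2 * r"
      using norm_self_adjoint[of g] g gg by simp
    \<comment> \<open>Since \<open>h = r (e - c)\<close>, the element \<open>r c\<close> is the sum
      of \<open>r e - e\<close> and \<open>e - h\<close>. Their norms are at most
      \<open>1 - r\<close> and \<open>2 - 2 r\<close>, whence the constant 3.\<close>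
    have "cscale A (of_real r) e \<ominus> h =
        (cscale A (of_real r) e \<oplus> cscale A (- of_real r) e) \<oplus> cscale A (of_real r) c"
      using e c by (simp add: h_def minus_scale scale_add_right a_assoc flip: scale_scale)
    then have "cscale A (of_real r) c = (cscale A (of_real r) e \<ominus> e) \<oplus> (e \<ominus> h)"
      using e c hc by (simp add: scale_cancel minus_add_minus)
    then have "r * cnorm A c \<le> cnorm A (cscale A (of_real r) e \<ominus> e) + cnorm A (e \<ominus> h)"
      using norm_scale[OF c(1), of "of_real r"] r e c hc
        norm_add[of "cscale A (of_real r) e \<ominus> e" "e \<ominus> h"] by simp
    also have "cscale A (of_real r) e \<ominus> e = cscale A (of_real r - 1) e"
      using e scale_add_left[of e "of_real r" "-1"] by (simp add: minus_scale)
    finally have "r * cnorm A c \<le> cmod (of_real r - 1) * cnorm A e + (2 - 2 * r)"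
      using eh_small e by (simp add: norm_scale)
    also have "cmod (of_real r - 1) = 1 - r"
      using r by (metis abs_minus_commute abs_of_pos diff_gt_0_iff_gt norm_of_real of_real_1 of_real_diff)
    finally have "r * cnorm A c \<le> (1 - r) * cnorm A e + (2 - 2 * r)" .
    moreover have "(1 - r) * cnorm A e \<le> 1 - r" by (rule mult_left_le) (use ne r in auto)
    ultimately show ?thesis by (simp add: algebra_simps)
  qed
  have "cnorm A c \<le> 0"
  proof (rule ccontr)
    define n where "n = cnorm A c"
    assume "\<not> cnorm A c \<le> 0"
    then have n: "0 < n" by (simp add: n_def)
    \<comment> \<open>With this choice \<open>r (3 + n)\<close> equals \<open>3 + n / 2\<close>,
      whereas \<open>bound\<close> allows at most 3.\<close>
    define r where "r = (3 + n / 2) / (3 + n)"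
    have r: "0 < r" "r < 1" using n by (auto simp: r_def)
    have "r * (3 + n) \<le> 3" using bound[OF r] by (simp add: n_def algebra_simps)
    moreover have "r * (3 + n) = 3 + n / 2" using n by (simp add: r_def)
    ultimately show False using n by simp
  qed
  then show ?thesis using c norm_nonneg[of c] norm_eq_0[of c] by simp
qed


lemma finsum_mult_left:
  assumes "finite I" "f \<in> I \<rightarrow> carrier A" "a \<in> carrier A"
  shows "a \<otimes> finsum A f I = finsum A (\<lambda>i. a \<otimes> f i) I"
  using assms by (induction I rule: finite_induct) (auto simp: distr_right Pi_def)

lemma finsum_mult_right:
  assumes "finite I" "f \<in> I \<rightarrow> carrier A" "a \<in> carrier A"
  shows "finsum A f I \<otimes> a = finsum A (\<lambda>i. f i \<otimes> a) I"
  using assms by (induction I rule: finite_induct) (auto simp: distr_left Pi_def)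

lemma finsum_scale:
  assumes "finite I" "f \<in> I \<rightarrow> carrier A"
  shows "cscale A z (finsum A f I) = finsum A (\<lambda>i. cscale A z (f i)) I"
  using assms by (induction I rule: finite_induct) (auto simp: scale_add_right Pi_def)

lemma adj_finsum:
  assumes "finite I" "f \<in> I \<rightarrow> carrier A"
  shows "cadj A (finsum A f I) = finsum A (\<lambda>i. cadj A (f i)) I"
  using assms by (induction I rule: finite_induct) (auto simp: adj_add Pi_def)

lemma finsum_single:
  assumes "finite I" "i \<in> I" "a \<in> carrier A"
  shows "finsum A (\<lambda>j. if j = i then a else \<zero>) I = a"
  using add.finprod_singleton_swap[of i I "\<lambda>_. a"] assms by simp

lemma finsum_const:
  assumes "finite I" "a \<in> carrier A"
  shows "finsum A (\<lambda>i. a) I = cscale A (of_nat (card I)) a"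
  using assms by (induction I rule: finite_induct) (auto simp: scale_add_left)

lemma norm_finsum_le:
  assumes "finite I" "f \<in> I \<rightarrow> carrier A" "\<And>i. i \<in> I \<Longrightarrow> cnorm A (f i) \<le> 1"
  shows "cnorm A (finsum A f I) \<le> real (card I)"
  using assms
proof (induction I rule: finite_induct)
  case (insert i I)
  then have "cnorm A (f i \<oplus> finsum A f I) \<le> 1 + real (card I)"
    by (intro order_trans[OF norm_add] add_mono) (auto simp: Pi_def)
  then show ?case using insert by (simp add: Pi_def)
qed auto

subsection \<open>Positive functionals\<close>

definition positive_functional :: "('a \<Rightarrow> complex) \<Rightarrow> bool" where
  "positive_functional \<phi> \<longleftrightarrow>
     (\<forall>a \<in> carrier A. \<forall>b \<in> carrier A. \<phi> (a \<oplus> b) = \<phi> a + \<phi> b) \<and>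
     (\<forall>a \<in> carrier A. \<forall>z. \<phi> (cscale A z a) = z * \<phi> a) \<and>
     (\<forall>a \<in> carrier A. \<phi> (cadj A a \<otimes> a) \<in> \<real> \<and> 0 \<le> Re (\<phi> (cadj A a \<otimes> a)))"

context
  fixes \<phi> assumes \<phi>: "positive_functional \<phi>"
begin

lemma functional_add: "\<lbrakk>a \<in> carrier A; b \<in> carrier A\<rbrakk> \<Longrightarrow> \<phi> (a \<oplus> b) = \<phi> a + \<phi> b"
  using \<phi> by (simp add: positive_functional_def)

lemma functional_scale: "a \<in> carrier A \<Longrightarrow> \<phi> (cscale A z a) = z * \<phi> a"
  using \<phi> by (simp add: positive_functional_def)

lemma functional_zero: "\<phi> \<zero> = 0"
  using functional_scale[of \<zero> 0] by simp

lemma functional_minus: "\<lbrakk>a \<in> carrier A; b \<in> carrier A\<rbrakk> \<Longrightarrow> \<phi> (a \<ominus> b) = \<phi> a - \<phi> b"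
  by (simp add: minus_scale functional_add functional_scale)

lemma functional_finsum:
  assumes "finite I" "f \<in> I \<rightarrow> carrier A"
  shows "\<phi> (finsum A f I) = (\<Sum>i\<in>I. \<phi> (f i))"
  using assms by (induction I rule: finite_induct) (auto simp: functional_add functional_zero Pi_def)

lemma functional_square_real:
  assumes "a \<in> carrier A"
  shows "\<phi> (cadj A a \<otimes> a) = of_real (Re (\<phi> (cadj A a \<otimes> a)))" "0 \<le> Re (\<phi> (cadj A a \<otimes> a))"
  using \<phi> assms by (auto simp: positive_functional_def complex_is_Real_iff complex_eq_iff)

lemma functional_square_expand:
  assumes "a \<in> carrier A" "b \<in> carrier A"
  shows "\<phi> (cadj A (a \<oplus> cscale A z b) \<otimes> (a \<oplus> cscale A z b)) =
    \<phi> (cadj A a \<otimes> a) + z * \<phi> (cadj A a \<otimes> b) + cnj z * \<phi> (cadj A b \<otimes> a) + cnj z * z * \<phi> (cadj A b \<otimes> b)"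
  using assms by (simp add: adj_add adj_scale distr_left distr_right mult_scale_left mult_scale_right
      functional_add functional_scale algebra_simps)

text \<open>Polarization: the value at the square of \<open>a + z b\<close> is real for every
  \<open>z\<close>. Taking \<open>z = 1\<close> compares the imaginary parts of the two mixed terms,
  taking \<open>z = \<i>\<close> their real parts.\<close>

lemma functional_cnj:
  assumes "a \<in> carrier A" "b \<in> carrier A"
  shows "\<phi> (cadj A b \<otimes> a) = cnj (\<phi> (cadj A a \<otimes> b))"
proof -
  have Im0: "Im (\<phi> (cadj A c \<otimes> c)) = 0" if "c \<in> carrier A" for c
    using functional_square_real(1)[OF that] by (metis Im_complex_of_real)
  have "Im (z * \<phi> (cadj A a \<otimes> b) + cnj z * \<phi> (cadj A b \<otimes> a)) = 0" for z
  proof -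
    show ?thesis
      using Im0[OF assms(2)] Im0[of "a \<oplus> cscale A z b"] Im0[OF assms(1)] assms
      unfolding functional_square_expand[OF assms] by simp
  qed
  from this[of 1] this[of \<i>] show ?thesis by (simp add: complex_eq_iff)
qed

lemma functional_Cauchy_Schwarz:
  assumes "a \<in> carrier A" "b \<in> carrier A"
  shows "(cmod (\<phi> (cadj A b \<otimes> a)))\<^sup>2 \<le> Re (\<phi> (cadj A b \<otimes> b)) * Re (\<phi> (cadj A a \<otimes> a))"
proof -
  define w where "w = \<phi> (cadj A b \<otimes> a)"
  define P where "P = Re (\<phi> (cadj A a \<otimes> a))"
  define Q where "Q = Re (\<phi> (cadj A b \<otimes> b))"
  have PQ: "0 \<le> P" "0 \<le> Q" using functional_square_real(2) assms by (auto simp: P_def Q_def)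
  have key: "0 \<le> P - 2 * t * (cmod w)\<^sup>2 + t\<^sup>2 * (cmod w)\<^sup>2 * Q" for t :: real
  proof -
    \<comment> \<open>This direction makes both mixed terms real, which leaves a real polynomial of
      degree at most 2 in \<open>t\<close>.\<close>
    define z where "z = - of_real t * w"
    have "0 \<le> Re (P + z * cnj w + cnj z * w + cnj z * z * Q)"
      using functional_square_real(2)[of "a \<oplus> cscale A z b"] functional_square_real(1)[OF assms(1)]
        functional_square_real(1)[OF assms(2)] functional_cnj[of b a] assms
      unfolding functional_square_expand[OF assms] w_def P_def Q_def by simp
    moreover have "P + z * cnj w + cnj z * w + cnj z * z * Q =
       P - 2 * of_real t * (w * cnj w) + of_real t * of_real t * (w * cnj w) * Q"
      by (simp add: z_def algebra_simps)
    ultimately show ?thesis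
      by (simp add: complex_norm_square[symmetric] power2_eq_square cmod_power2 flip: of_real_mult)
  qed
  show ?thesis
  proof (cases "Q = 0")
    case True
    have "(cmod w)\<^sup>2 \<le> 0"
    proof (rule ccontr)
      assume "\<not> (cmod w)\<^sup>2 \<le> 0"
      then have "0 < (cmod w)\<^sup>2" by simp
      \<comment> \<open>For \<open>Q = 0\<close> the expression is affine in \<open>t\<close>; the
        chosen \<open>t\<close> gives it the value -1.\<close>
      then show False
        using key[of "(P + 1) / (2 * (cmod w)\<^sup>2)"] True by (simp add: field_simps)
    qed
    then show ?thesis using True by (simp add: w_def Q_def)
  next
    case False
    \<comment> \<open>\<open>t = 1 / Q\<close> minimizes the quadratic polynomial.\<close>
    then have "0 \<le> P - (cmod w)\<^sup>2 / Q"
      using key[of "1 / Q"] PQ by (simp add: field_simps power2_eq_square)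
    then show ?thesis using False PQ by (simp add: w_def P_def Q_def field_simps)
  qed
qed

end

end

text \<open>A \<open>cstar_algebra\<close> need not have a unit, so the unit is an extra datum. For
  a graph algebra it will be the sum of the vertex projections.\<close>

locale unital_cstar_algebra = cstar_algebra +
  fixes u
  assumes unit_closed [simp, intro]: "u \<in> carrier A"
    and unit_left [simp]: "a \<in> carrier A \<Longrightarrow> u \<otimes> a = a"
    and unit_right [simp]: "a \<in> carrier A \<Longrightarrow> a \<otimes> u = a"
begin

lemma adj_unit [simp]: "cadj A u = u"
  by (metis adj_adj adj_closed adj_mult unit_closed unit_right)

text \<open>\<open>u - h\<close> is the square of the self-adjoint element \<open>u - b\<close>,
  where \<open>b\<close> is the fixed point belonging to \<open>h\<close>, so \<phi> is nonnegative
  on it.\<close>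

lemma functional_le_unit:
  assumes "positive_functional \<phi>" "h \<in> carrier A" "cadj A h = h" "cnorm A h < 1"
  shows "Re (\<phi> h) \<le> Re (\<phi> u)"
proof -
  obtain b where b: "b \<in> carrier A" "b \<oplus> b = h \<oplus> b \<otimes> b" and bC:
    "\<And>C. \<lbrakk>limit_closed C; \<zero> \<in> C; \<And>y. y \<in> C \<Longrightarrow> cscale A (1/2) (h \<oplus> y \<otimes> y) \<in> C\<rbrakk> \<Longrightarrow> b \<in> C"
    using sqrt_fixed_point[OF assms(2,4)] by metis
  have "b \<in> {y \<in> carrier A. cadj A y = y}"
    by (intro bC limit_closed_eq seq_continuous_intros)
      (auto simp: assms adj_scale adj_add adj_mult)
  then have "cadj A (u \<ominus> b) = u \<ominus> b" using b by (simp add: adj_minus)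
  then have "0 \<le> Re (\<phi> ((u \<ominus> b) \<otimes> (u \<ominus> b)))"
    using functional_square_real(2)[OF assms(1), of "u \<ominus> b"] b by simp
  also have "\<phi> ((u \<ominus> b) \<otimes> (u \<ominus> b)) = \<phi> u - \<phi> b - (\<phi> b - \<phi> (b \<otimes> b))"
    using assms(1) b(1) by (simp add: mult_minus_left mult_minus_right functional_minus)
  also have "\<dots> = \<phi> u - \<phi> h"
    using arg_cong[OF b(2), of \<phi>] b(1) assms(1,2) by (simp add: functional_add algebra_simps)
  finally show ?thesis by simp
qed

text \<open>For norm below 1, Cauchy-Schwarz against the unit followed by
  \<open>functional_le_unit\<close> at \<open>cadj A b \<otimes> b\<close> gives the bound. Scaling
  does the rest, with an \<epsilon> because the norm must be strictly below 1.\<close>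

lemma functional_bound:
  assumes "positive_functional \<phi>" "a \<in> carrier A"
  shows "cmod (\<phi> a) \<le> Re (\<phi> u) * cnorm A a"
proof -
  have u0: "0 \<le> Re (\<phi> u)"
    using functional_square_real(2)[OF assms(1), of u] by simp
  have small: "cmod (\<phi> b) \<le> Re (\<phi> u)" if b: "b \<in> carrier A" "cnorm A b < 1" for b
  proof -
    have "(cnorm A b)\<^sup>2 < 1"
      using b norm_nonneg[OF b(1)] by (simp add: power_less_one_iff)
    then have "Re (\<phi> (cadj A b \<otimes> b)) \<le> Re (\<phi> u)"
      using b by (intro functional_le_unit assms) (auto simp: adj_mult norm_cstar)
    then have "Re (\<phi> u) * Re (\<phi> (cadj A b \<otimes> b)) \<le> Re (\<phi> u) * Re (\<phi> u)"
      using u0 by (intro mult_left_mono)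
    then have "(cmod (\<phi> b))\<^sup>2 \<le> (Re (\<phi> u))\<^sup>2"
      using functional_Cauchy_Schwarz[OF assms(1) b(1) unit_closed] b(1) by (simp add: power2_eq_square)
    then show ?thesis using u0 by (simp add: power2_le_iff_abs_le)
  qed
  show ?thesis
  proof (rule field_le_epsilon)
    fix \<epsilon> :: real assume \<epsilon>: "0 < \<epsilon>"
    \<comment> \<open>The 1 in the denominator covers the case that \<phi> vanishes at the
      unit.\<close>
    define r where "r = cnorm A a + \<epsilon> / (Re (\<phi> u) + 1)"
    have r: "0 < r" "cnorm A a < r"
      using \<epsilon> u0 norm_nonneg[OF assms(2)] by (auto simp: r_def add_nonneg_pos)
    have "cmod (\<phi> (cscale A (of_real (1 / r)) a)) \<le> Re (\<phi> u)"
      using r assms(2) by (intro small) (auto simp: norm_scale norm_divide)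
    then have "cmod (\<phi> a) \<le> Re (\<phi> u) * r"
      using r assms by (simp add: functional_scale norm_mult norm_divide field_simps)
    also have "Re (\<phi> u) * r \<le> Re (\<phi> u) * cnorm A a + \<epsilon>"
      using u0 \<epsilon> by (simp add: r_def field_simps)
    finally show "cmod (\<phi> a) \<le> Re (\<phi> u) * cnorm A a + \<epsilon>" .
  qed
qed

end

section \<open>Positive elements that add up to zero\<close>

context unital_cstar_algebra
begin

text \<open>The norm condition expresses positivity of \<open>a i\<close> in the corner of
  \<open>e\<close>. With \<open>n = card J\<close>, the other summands add up to
  \<open>- a j\<close>, so \<open>(n - 1) e + a j\<close> is a sum of \<open>n - 1\<close> elements
  of norm at most 1. Hence \<open>c = a j / n\<close> satisfies both conditions of
  \<open>zero_if_both_signs_positive\<close>.\<close>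

lemma positive_sum_zero:
  assumes J: "finite J" "j \<in> J"
    and e: "e \<in> carrier A" "cadj A e = e" "e \<otimes> e = e"
    and a: "\<And>i. i \<in> J \<Longrightarrow> a i \<in> carrier A" "cadj A (a j) = a j" "e \<otimes> a j = a j" "a j \<otimes> e = a j"
    and small: "\<And>i. i \<in> J \<Longrightarrow> cnorm A (e \<ominus> a i) \<le> 1"
    and sum: "finsum A a J = \<zero>"
  shows "a j = \<zero>"
proof -
  define n where "n = real (card J)"
  define K where "K = J - {j}"
  have K: "finite K" "j \<notin> K" "J = insert j K" using J by (auto simp: K_def)
  then have n: "n = real (card K) + 1" by (simp add: n_def)
  have ac: "a j \<in> carrier A" "a \<in> K \<rightarrow> carrier A" using a(1) J(2) by (auto simp: K_def)
  have "a j \<oplus> finsum A a K = \<zero>" using sum ac K by simp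
  then have "finsum A a K = cscale A (-1) (a j)"
    using ac minus_equality[of "finsum A a K" "a j"] a_inv_scale[of "a j"] by (simp add: a_comm)
  then have aj: "cscale A (-1) (finsum A a K) = a j"
    using ac by (simp flip: scale_scale)
  have "finsum A (\<lambda>i. e \<ominus> a i) K = finsum A (\<lambda>i. e \<oplus> cscale A (-1) (a i)) K"
    using ac e by (intro finsum_cong') (auto simp: minus_scale Pi_def)
  also have "\<dots> = cscale A (of_nat (card K)) e \<oplus> cscale A (-1) (finsum A a K)"
    using ac e K by (simp add: finsum_addf Pi_def finsum_const finsum_scale)
  finally have "cscale A (of_real (n - 1)) e \<oplus> a j = finsum A (\<lambda>i. e \<ominus> a i) K"
    by (simp add: aj n)
  then have "cnorm A (cscale A (of_real (n - 1)) e \<oplus> a j) \<le> n - 1"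
    using norm_finsum_le[of K "\<lambda>i. e \<ominus> a i"] K small ac e by (auto simp: n Pi_def)
  then have plus: "cnorm A (e \<oplus> (cscale A (of_real (n - 1)) e \<oplus> a j)) \<le> 1 + (n - 1)"
    using norm_projection_le_one[OF e] e ac norm_add[of e "cscale A (of_real (n - 1)) e \<oplus> a j"]
    by simp
  have "0 < n" "1 \<le> n" by (auto simp: n)
  define c where "c = cscale A (of_real (1 / n)) (a j)"
  have "e \<oplus> (cscale A (of_real (n - 1)) e \<oplus> a j) = cscale A (of_real n) (e \<oplus> c)"
  proof -
    have "e \<oplus> cscale A (of_real (n - 1)) e = cscale A (of_real n) e"
      using scale_add_left[OF e(1), of 1 "of_real (n - 1)"] e by simp
    then show ?thesis
      using e ac \<open>0 < n\<close> by (simp add: c_def scale_add_right flip: scale_scale a_assoc)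
  qed
  then have cp: "cnorm A (e \<oplus> c) \<le> 1"
    using plus \<open>0 < n\<close> e ac by (simp add: norm_scale c_def)
  have "e \<ominus> c = cscale A (of_real (1 - 1 / n)) e \<oplus> cscale A (of_real (1 / n)) (e \<ominus> a j)"
    using e ac scale_add_left[OF e(1), of "of_real (1 - 1 / n)" "of_real (1 / n)"]
    by (simp add: c_def minus_scale scale_add_right flip: scale_scale a_assoc)
  moreover have "cnorm A (cscale A (of_real (1 - 1 / n)) e) \<le> 1 - 1 / n"
    using e \<open>1 \<le> n\<close> mult_left_le[OF norm_projection_le_one[OF e], of "1 - 1 / n"]
    by (simp add: norm_scale del: of_real_diff)
  moreover have "cnorm A (cscale A (of_real (1 / n)) (e \<ominus> a j)) \<le> 1 / n"
    using e ac \<open>1 \<le> n\<close> small[OF J(2)] by (simp add: norm_scale norm_divide divide_right_mono)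
  ultimately have cm: "cnorm A (e \<ominus> c) \<le> 1"
    using e ac norm_add[of "cscale A (of_real (1 - 1 / n)) e" "cscale A (of_real (1 / n)) (e \<ominus> a j)"]
    by simp
  have "c = \<zero>"
    by (rule zero_if_both_signs_positive[OF e _ _ _ _ cm cp])
      (use ac e a in \<open>auto simp: c_def adj_scale mult_scale_left mult_scale_right\<close>)
  then have "cscale A (of_real n) c = \<zero>" by simp
  then show ?thesis using ac \<open>0 < n\<close> by (simp add: c_def flip: scale_scale)
qed

text \<open>
  If \<open>P\<close> is a sum of projections \<open>p i \<le> P\<close>, then compressing by \<open>p i\<close> shows that the positive
  elements \<open>p i p j p i\<close>, \<open>j \<noteq> i\<close>, add up to zero.
\<close>

lemma summand_projections_orthogonal:
  assumes I: "finite I" "i \<in> I" "j \<in> I" "i \<noteq> j"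
    and p: "\<And>i. i \<in> I \<Longrightarrow> p i \<in> carrier A" "\<And>i. i \<in> I \<Longrightarrow> cadj A (p i) = p i"
      "\<And>i. i \<in> I \<Longrightarrow> p i \<otimes> p i = p i"
    and dom: "\<And>i. i \<in> I \<Longrightarrow> finsum A p I \<otimes> p i = p i"
  shows "p j \<otimes> p i = \<zero>"
proof -
  define J where "J = I - {i}"
  have J: "finite J" "j \<in> J" "I = insert i J" "i \<notin> J" using I by (auto simp: J_def)
  define a where "a l = p i \<otimes> (p l \<otimes> p i)" for l
  have pc: "p l \<in> carrier A" if "l \<in> I" for l using p that by auto
  have ac: "a l \<in> carrier A" if "l \<in> I" for l using pc that I by (simp add: a_def)
  have ii: "p i \<otimes> (p i \<otimes> y) = p i \<otimes> y" if "y \<in> carrier A" for y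
    using mult_assoc[OF pc[OF I(2)] pc[OF I(2)] that] p(3)[OF I(2)] by simp
  have "p i = p i \<otimes> (finsum A p I \<otimes> p i)"
    using dom p I by simp
  also have "\<dots> = finsum A a I"
    using I pc by (simp add: a_def[abs_def] finsum_mult_left finsum_mult_right Pi_def)
  also have "\<dots> = p i \<oplus> finsum A a J"
    using J ac p I by (simp add: Pi_def a_def)
  finally have eq: "p i \<oplus> finsum A a J = p i" by simp
  have "finsum A a J \<in> carrier A" using ac J by (auto intro: finsum_closed)
  then have "finsum A a J = \<ominus> p i \<oplus> (p i \<oplus> finsum A a J)"
    using pc I by (simp add: r_neg1)
  then have "finsum A a J = \<zero>"
    using pc I by (simp add: eq l_neg)
  moreover have "cnorm A (p i \<ominus> a l) \<le> 1" if "l \<in> J" for l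
  proof -
    have l: "l \<in> I" "p l \<in> carrier A" "cadj A (p l) = p l" "p l \<otimes> p l = p l" using that J p by auto
    have u: "cadj A (u \<ominus> p l) = u \<ominus> p l" "(u \<ominus> p l) \<otimes> (u \<ominus> p l) = u \<ominus> p l"
      using l by (auto simp: adj_minus mult_minus_left mult_minus_right)
    \<comment> \<open>\<open>p i - a l\<close> is the square of this element, a product of two
      projections, so its norm is at most 1.\<close>
    define w where "w = (u \<ominus> p l) \<otimes> p i"
    have wc: "w \<in> carrier A" using l pc[OF I(2)] by (simp add: w_def)
    have "cadj A w \<otimes> w = p i \<otimes> ((u \<ominus> p l) \<otimes> (u \<ominus> p l) \<otimes> p i)"
      using l pc[OF I(2)] p(2)[OF I(2)] u(1) by (simp add: w_def adj_mult mult_assoc)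
    also have "\<dots> = p i \<ominus> a l"
      unfolding u(2) using l pc[OF I(2)] p(3)[OF I(2)] by (simp add: a_def mult_minus_left mult_minus_right)
    finally have "cnorm A (p i \<ominus> a l) = (cnorm A w)\<^sup>2" using norm_cstar[OF wc] by simp
    moreover have "cnorm A w \<le> 1 * 1"
      unfolding w_def using l pc[OF I(2)] p I u
      by (intro order_trans[OF norm_mult] mult_mono norm_projection_le_one norm_nonneg) auto
    ultimately show ?thesis
      using power_mono[of "cnorm A w" 1 2] norm_nonneg[OF wc] by simp
  qed
  ultimately have "a j = \<zero>"
    using J p I pc ac ii
    by (intro positive_sum_zero[of J j "p i" a]) (auto simp: a_def adj_mult mult_assoc)
  \<comment> \<open>The vanishing compression \<open>p i p j p i\<close> is the square of
    \<open>p j p i\<close>, which therefore vanishes by the C*-identity.\<close>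
  moreover have "cadj A (p j \<otimes> p i) \<otimes> (p j \<otimes> p i) = a j"
  proof -
    have "p j \<otimes> (p j \<otimes> p i) = p j \<otimes> p i"
      using p(3)[OF I(3)] pc I by (metis mult_assoc)
    then show ?thesis using p I pc by (simp add: a_def adj_mult mult_assoc)
  qed
  ultimately have "(cnorm A (p j \<otimes> p i))\<^sup>2 = 0"
    using norm_cstar[of "p j \<otimes> p i"] pc I by simp
  then show ?thesis using pc I by (simp add: norm_eq_0)
qed

end

section \<open>Cuntz-Krieger families\<close>

context kgraph
begin

lemma vertex_mor: "v \<in> vertices \<Lambda> \<Longrightarrow> v \<in> mor \<Lambda>"
  by (simp add: vertices_def)

lemma vertex_rng: "v \<in> vertices \<Lambda> \<Longrightarrow> rng \<Lambda> v = v"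
  by (simp add: vertices_def)

lemma vertex_src: "v \<in> vertices \<Lambda> \<Longrightarrow> src \<Lambda> v = v"
  by (simp add: vertices_def)

declare vertex_mor [simp] vertex_rng [simp] vertex_src [simp] rng_vertex [simp] src_vertex [simp] comp_closed [simp] rng_comp [simp] src_comp [simp]

lemma zero_Nk [simp]: "0 \<in> Nk k"
  by (simp add: Nk_def zero_fun_def)

lemma add_Nk [simp]: "\<lbrakk>m \<in> Nk k; n \<in> Nk k\<rbrakk> \<Longrightarrow> m + n \<in> Nk k"
  by (simp add: Nk_def)

lemma vertices_subset_paths: "vertices \<Lambda> \<subseteq> paths_deg \<Lambda> 0"
  using deg_id by (auto simp: paths_deg_def)

lemma factorE:
  assumes "\<kappa> \<in> mor \<Lambda>" "m \<in> Nk k" "n \<in> Nk k" "deg \<Lambda> \<kappa> = m + n"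
  obtains \<mu> \<nu> where "\<mu> \<in> mor \<Lambda>" "\<nu> \<in> mor \<Lambda>" "src \<Lambda> \<mu> = rng \<Lambda> \<nu>" "composite \<Lambda> \<mu> \<nu> = \<kappa>"
    "deg \<Lambda> \<mu> = m" "deg \<Lambda> \<nu> = n"
  using factorization[OF assms] by blast

text \<open>The two total degrees agree, so equality of one pair of degrees implies equality of the
  other by cancellation; uniqueness of the factorization then applies. In this form it serves as
  left and right cancellation.\<close>

lemma factor_unique:
  assumes "\<mu> \<in> mor \<Lambda>" "\<nu> \<in> mor \<Lambda>" "src \<Lambda> \<mu> = rng \<Lambda> \<nu>"
    and "\<mu>' \<in> mor \<Lambda>" "\<nu>' \<in> mor \<Lambda>" "src \<Lambda> \<mu>' = rng \<Lambda> \<nu>'"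
    and eq: "composite \<Lambda> \<mu> \<nu> = composite \<Lambda> \<mu>' \<nu>'"
    and d: "deg \<Lambda> \<mu> = deg \<Lambda> \<mu>' \<or> deg \<Lambda> \<nu> = deg \<Lambda> \<nu>'"
  shows "\<mu> = \<mu>'" "\<nu> = \<nu>'"
proof -
  have "deg \<Lambda> \<mu> + deg \<Lambda> \<nu> = deg \<Lambda> \<mu>' + deg \<Lambda> \<nu>'"
    using deg_comp[OF assms(1-3)] deg_comp[OF assms(4-6)] eq by simp
  then have d': "deg \<Lambda> \<mu> = deg \<Lambda> \<mu>'" "deg \<Lambda> \<nu> = deg \<Lambda> \<nu>'"
    using d by (metis add_left_cancel add_right_cancel)+
  define P where "P = (\<lambda>(\<alpha>, \<beta>). \<alpha> \<in> mor \<Lambda> \<and> \<beta> \<in> mor \<Lambda> \<and> src \<Lambda> \<alpha> = rng \<Lambda> \<beta> \<and>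
      composite \<Lambda> \<alpha> \<beta> = composite \<Lambda> \<mu> \<nu> \<and> deg \<Lambda> \<alpha> = deg \<Lambda> \<mu> \<and> deg \<Lambda> \<beta> = deg \<Lambda> \<nu>)"
  have "\<exists>!p. P p"
    unfolding P_def using assms(1-3) by (intro factorization deg_comp deg_Nk comp_closed)
  moreover have "P (\<mu>, \<nu>)" "P (\<mu>', \<nu>')"
    using assms(1-6) d' eq by (simp_all add: P_def)
  ultimately have "(\<mu>, \<nu>) = (\<mu>', \<nu>')" by metis
  then show "\<mu> = \<mu>'" "\<nu> = \<nu>'" by auto
qed

end

text \<open>Any algebra generated by a Cuntz-Krieger family qualifies; the lemmas that use
  universality take it as an explicit hypothesis.\<close>

locale cuntz_krieger_algebra = kgraph k \<Lambda> + cstar_algebra A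
  for k and \<Lambda> :: "'g kgraph" and A :: "'a cstar" (structure) +
  fixes S
  assumes finite_graph: "finite_kgraph k \<Lambda>"
    and family: "cuntz_krieger_family k \<Lambda> A S"
    and generated: "cstar_generated_by A (S ` mor \<Lambda>)"
begin

lemma finite_paths [simp]: "n \<in> Nk k \<Longrightarrow> finite (paths_deg \<Lambda> n)"
  using finite_graph by (simp add: finite_kgraph_def)

lemma finite_vertices [simp]: "finite (vertices \<Lambda>)"
  using vertices_subset_paths finite_paths[OF zero_Nk] by (rule finite_subset)

lemma S_closed [simp, intro]: "\<kappa> \<in> mor \<Lambda> \<Longrightarrow> S \<kappa> \<in> carrier A"
  using generated by (auto simp: cstar_generated_by_def)

lemma S_vertex:
  "v \<in> vertices \<Lambda> \<Longrightarrow> cadj A (S v) = S v" "v \<in> vertices \<Lambda> \<Longrightarrow> S v \<otimes> S v = S v"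
  "\<lbrakk>v \<in> vertices \<Lambda>; w \<in> vertices \<Lambda>; v \<noteq> w\<rbrakk> \<Longrightarrow> S v \<otimes> S w = \<zero>"
  using family by (auto simp: cuntz_krieger_family_def is_projection_def)

lemma S_comp: "\<lbrakk>\<mu> \<in> mor \<Lambda>; \<kappa> \<in> mor \<Lambda>; src \<Lambda> \<mu> = rng \<Lambda> \<kappa>\<rbrakk> \<Longrightarrow> S \<mu> \<otimes> S \<kappa> = S (composite \<Lambda> \<mu> \<kappa>)"
  using family by (auto simp: cuntz_krieger_family_def)

lemma S_adj_S: "\<mu> \<in> mor \<Lambda> \<Longrightarrow> cadj A (S \<mu>) \<otimes> S \<mu> = S (src \<Lambda> \<mu>)"
  using family by (auto simp: cuntz_krieger_family_def)

lemma S_vertex_sum: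
  "\<lbrakk>v \<in> vertices \<Lambda>; n \<in> Nk k\<rbrakk> \<Longrightarrow>
    S v = (\<Oplus>\<kappa> \<in> {\<kappa> \<in> paths_deg \<Lambda> n. rng \<Lambda> \<kappa> = v}. S \<kappa> \<otimes> cadj A (S \<kappa>))"
  using family by (auto simp: cuntz_krieger_family_def)

lemma S_rng: "\<kappa> \<in> mor \<Lambda> \<Longrightarrow> S (rng \<Lambda> \<kappa>) \<otimes> S \<kappa> = S \<kappa>"
  using S_comp[of "rng \<Lambda> \<kappa>" \<kappa>] by (simp add: comp_id_left)

lemma S_src: "\<kappa> \<in> mor \<Lambda> \<Longrightarrow> S \<kappa> \<otimes> S (src \<Lambda> \<kappa>) = S \<kappa>"
  using S_comp[of \<kappa> "src \<Lambda> \<kappa>"] by (simp add: comp_id_right)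

lemma S_src_adj: "\<kappa> \<in> mor \<Lambda> \<Longrightarrow> S (src \<Lambda> \<kappa>) \<otimes> cadj A (S \<kappa>) = cadj A (S \<kappa>)"
  using arg_cong[OF S_src, of \<kappa> "cadj A"] by (simp add: adj_mult S_vertex)

lemma S_adj_rng: "\<kappa> \<in> mor \<Lambda> \<Longrightarrow> cadj A (S \<kappa>) \<otimes> S (rng \<Lambda> \<kappa>) = cadj A (S \<kappa>)"
  using arg_cong[OF S_rng, of \<kappa> "cadj A"] by (simp add: adj_mult S_vertex)

lemma S_mult_zero:
  assumes "\<mu> \<in> mor \<Lambda>" "\<kappa> \<in> mor \<Lambda>" "src \<Lambda> \<mu> \<noteq> rng \<Lambda> \<kappa>"
  shows "S \<mu> \<otimes> S \<kappa> = \<zero>"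
proof -
  have "S \<mu> \<otimes> S \<kappa> = (S \<mu> \<otimes> S (src \<Lambda> \<mu>)) \<otimes> (S (rng \<Lambda> \<kappa>) \<otimes> S \<kappa>)"
    using assms by (simp add: S_src S_rng)
  also have "\<dots> = S \<mu> \<otimes> ((S (src \<Lambda> \<mu>) \<otimes> S (rng \<Lambda> \<kappa>)) \<otimes> S \<kappa>)"
    using assms by (simp add: mult_assoc)
  finally show ?thesis using assms by (simp add: S_vertex)
qed

definition unit :: 'a where "unit = finsum A S (vertices \<Lambda>)"

lemma unit_carrier: "unit \<in> carrier A"
  unfolding unit_def by (rule finsum_closed) auto

lemma adj_unit_self: "cadj A unit = unit"
  unfolding unit_def by (subst adj_finsum) (auto intro!: finsum_cong' simp: S_vertex)

lemma unit_S: assumes "\<kappa> \<in> mor \<Lambda>" shows "unit \<otimes> S \<kappa> = S \<kappa>"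
proof -
  have "unit \<otimes> S \<kappa> = finsum A (\<lambda>v. S v \<otimes> S \<kappa>) (vertices \<Lambda>)"
    unfolding unit_def using assms by (intro finsum_mult_right) auto
  also have "\<dots> = finsum A (\<lambda>v. if v = rng \<Lambda> \<kappa> then S \<kappa> else \<zero>) (vertices \<Lambda>)"
    using assms by (intro finsum_cong') (auto simp: S_rng S_mult_zero)
  finally show ?thesis using assms by (simp add: finsum_single)
qed

lemma unit_S_adj: assumes "\<kappa> \<in> mor \<Lambda>" shows "unit \<otimes> cadj A (S \<kappa>) = cadj A (S \<kappa>)"
proof -
  have "unit \<otimes> cadj A (S \<kappa>) = unit \<otimes> (S (src \<Lambda> \<kappa>) \<otimes> cadj A (S \<kappa>))"
    using assms by (simp add: S_src_adj)
  also have "\<dots> = unit \<otimes> S (src \<Lambda> \<kappa>) \<otimes> cadj A (S \<kappa>)"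
    using assms unit_carrier by (simp add: mult_assoc)
  also have "\<dots> = cadj A (S \<kappa>)"
    using assms by (simp add: unit_S S_src_adj)
  finally show ?thesis .
qed

text \<open>The limits of sequences in a star-subalgebra form a closed star-subalgebra. This turns
  \<open>cstar_generated_by\<close> into density of every star-subalgebra that contains the
  generators.\<close>

lemma generated_closure:
  assumes W: "W \<subseteq> carrier A" "\<zero> \<in> W" "S ` mor \<Lambda> \<subseteq> W"
    and add: "\<And>a b. \<lbrakk>a \<in> W; b \<in> W\<rbrakk> \<Longrightarrow> a \<oplus> b \<in> W"
    and mult: "\<And>a b. \<lbrakk>a \<in> W; b \<in> W\<rbrakk> \<Longrightarrow> a \<otimes> b \<in> W"
    and scale: "\<And>a z. a \<in> W \<Longrightarrow> cscale A z a \<in> W"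
    and adj: "\<And>a. a \<in> W \<Longrightarrow> cadj A a \<in> W"
    and a: "a \<in> carrier A"
  obtains f where "range f \<subseteq> W" "tends_to f a"
proof -
  define C where "C = {a \<in> carrier A. \<exists>f. range f \<subseteq> W \<and> tends_to f a}"
  have CI: "b \<in> C" if "b \<in> carrier A" "range f \<subseteq> W" "tends_to f b" for b f
    using that by (auto simp: C_def)
  have CE: "\<exists>f. range f \<subseteq> W \<and> range f \<subseteq> carrier A \<and> tends_to f b \<and> b \<in> carrier A" if "b \<in> C" for b
    using that W(1) by (auto simp: C_def)
  have WC: "w \<in> C" if "w \<in> W" for w
    using that W(1) by (intro CI[of w "\<lambda>_. w"]) (auto intro!: tends_to_const)
  have "closed_star_subalgebra A C"
    unfolding closed_star_subalgebra_def
  proof (intro conjI ballI allI impI)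
    show "C \<subseteq> carrier A" by (auto simp: C_def)
    show "\<zero> \<in> C" by (rule WC[OF W(2)])
  next
    fix b assume "b \<in> C"
    then obtain f where f: "range f \<subseteq> W" "range f \<subseteq> carrier A" "tends_to f b" "b \<in> carrier A"
      using CE by blast
    show "cadj A b \<in> C"
      using f adj by (intro CI[of _ "\<lambda>n. cadj A (f n)"] tends_to_adj) auto
    show "cscale A z b \<in> C" for z
      using f scale by (intro CI[of _ "\<lambda>n. cscale A z (f n)"] tends_to_scale) auto
  next
    fix b c assume "b \<in> C" "c \<in> C"
    then obtain f g where f: "range f \<subseteq> W" "range f \<subseteq> carrier A" "tends_to f b" "b \<in> carrier A"
      and g: "range g \<subseteq> W" "range g \<subseteq> carrier A" "tends_to g c" "c \<in> carrier A"
      using CE by meson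
    show "b \<oplus> c \<in> C"
      using f g add by (intro CI[of _ "\<lambda>n. f n \<oplus> g n"] tends_to_add) (auto simp: range_subsetD)
    show "b \<otimes> c \<in> C"
      using f g mult by (intro CI[of _ "\<lambda>n. f n \<otimes> g n"] tends_to_mult) (auto simp: range_subsetD)
  next
    fix f b assume f: "range f \<subseteq> C \<and> b \<in> carrier A \<and> (\<lambda>n::nat. cnorm A (f n \<ominus> b)) \<longlonglongrightarrow> 0"
    \<comment> \<open>A limit of limits is reached directly by picking from \<open>W\<close> an
      element within \<open>1 / (n + 1)\<close> of the n-th one.\<close>
    have "\<exists>w\<in>W. cnorm A (w \<ominus> f n) < inverse (real (Suc n))" for n
    proof -
      obtain g where g: "range g \<subseteq> W" "tends_to g (f n)"
        using CE[of "f n"] f by (auto simp: range_subsetD)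
      have "\<forall>\<^sub>F m in sequentially. cnorm A (g m \<ominus> f n) < inverse (real (Suc n))"
        using g(2) unfolding tends_to_def by (rule order_tendstoD) simp
      then obtain m where "cnorm A (g m \<ominus> f n) < inverse (real (Suc n))"
        by (auto simp: eventually_sequentially)
      then show ?thesis using g(1) by blast
    qed
    then obtain w where w: "\<And>n. w n \<in> W" "\<And>n. cnorm A (w n \<ominus> f n) < inverse (real (Suc n))"
      by metis
    have wf: "w n \<in> carrier A" "f n \<in> carrier A" for n
      using w(1) W(1) f by (auto simp: C_def subset_iff)
    show "b \<in> C"
    proof (rule CI[of b w])
      show "tends_to w b"
      proof (rule tends_toI)
        show "cnorm A (w n \<ominus> b) \<le> inverse (real (Suc n)) + cnorm A (f n \<ominus> b)" for n
          using norm_triangle_minus[of "w n" "f n" b] w(2)[of n] wf f by simp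
        show "(\<lambda>n. inverse (real (Suc n)) + cnorm A (f n \<ominus> b)) \<longlonglongrightarrow> 0"
          using tendsto_add[OF LIMSEQ_inverse_real_of_nat] f by force
      qed (use f wf in auto)
    qed (use f w(1) in \<open>simp_all add: image_subset_iff\<close>)
  qed
  moreover have "S ` mor \<Lambda> \<subseteq> C" using W(3) WC by blast
  ultimately have "C = carrier A" using generated by (simp add: cstar_generated_by_def)
  then show ?thesis using a that by (auto simp: C_def)
qed

lemma unit_neutral: assumes "a \<in> carrier A" shows "unit \<otimes> a = a" "a \<otimes> unit = a"
proof -
  \<comment> \<open>Neutrality is required on both sides at once because taking adjoints exchanges
    the sides.\<close>
  define W where "W = {a \<in> carrier A. unit \<otimes> a = a \<and> a \<otimes> unit = a}"
  have adjW: "cadj A b \<otimes> unit = cadj A b" if "b \<in> carrier A" "unit \<otimes> b = b" for b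
    using arg_cong[OF that(2), of "cadj A"] that(1) unit_carrier by (simp add: adj_mult adj_unit_self)
  have adjW': "unit \<otimes> cadj A b = cadj A b" if "b \<in> carrier A" "b \<otimes> unit = b" for b
    using arg_cong[OF that(2), of "cadj A"] that(1) unit_carrier by (simp add: adj_mult adj_unit_self)
  obtain f where f: "range f \<subseteq> W" "tends_to f a"
  proof (rule generated_closure[of W a])
    have "S \<kappa> \<otimes> unit = S \<kappa>" if "\<kappa> \<in> mor \<Lambda>" for \<kappa>
      using adjW[of "cadj A (S \<kappa>)"] unit_S_adj that by simp
    then show "S ` mor \<Lambda> \<subseteq> W" by (auto simp: W_def unit_S)
    show "b \<otimes> c \<in> W" if "b \<in> W" "c \<in> W" for b c
      using that unit_carrier mult_assoc[of unit b c] mult_assoc[of b c unit] by (simp add: W_def)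
  qed (use assms unit_carrier adjW adjW' in
      \<open>auto simp: W_def distr_left distr_right mult_scale_left mult_scale_right\<close>)
  have fc: "range f \<subseteq> carrier A" using f by (auto simp: W_def)
  have "limit_closed {y \<in> carrier A. unit \<otimes> y = y}" "limit_closed {y \<in> carrier A. y \<otimes> unit = y}"
    by (intro limit_closed_eq seq_continuous_intros unit_carrier)+
  from this[THEN limit_closedD, OF _ assms f(2)]
  have "a \<in> {y \<in> carrier A. unit \<otimes> y = y}" "a \<in> {y \<in> carrier A. y \<otimes> unit = y}"
    using f(1) by (auto simp: W_def)
  then show "unit \<otimes> a = a" "a \<otimes> unit = a" by auto
qed

sublocale unital_cstar_algebra A unit
  by unfold_locales (auto simp: unit_carrier unit_neutral)

text \<open>For different ranges the vertex projections are orthogonal. For a common range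
  \<open>v\<close>, the range projections of the paths of one degree add up to the projection
  \<open>S v\<close>, which dominates each of them; this forces them to be orthogonal.\<close>

lemma S_adj_S_orthogonal:
  assumes "\<mu> \<in> mor \<Lambda>" "\<nu> \<in> mor \<Lambda>" "deg \<Lambda> \<mu> = deg \<Lambda> \<nu>" "\<mu> \<noteq> \<nu>"
  shows "cadj A (S \<mu>) \<otimes> S \<nu> = \<zero>"
proof (cases "rng \<Lambda> \<mu> = rng \<Lambda> \<nu>")
  case False
  have "cadj A (S \<mu>) \<otimes> S \<nu> = (cadj A (S \<mu>) \<otimes> S (rng \<Lambda> \<mu>)) \<otimes> (S (rng \<Lambda> \<nu>) \<otimes> S \<nu>)"
    using assms by (simp add: S_adj_rng S_rng)
  also have "\<dots> = cadj A (S \<mu>) \<otimes> ((S (rng \<Lambda> \<mu>) \<otimes> S (rng \<Lambda> \<nu>)) \<otimes> S \<nu>)"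
    using assms by (simp add: mult_assoc)
  finally show ?thesis using assms False by (simp add: S_vertex)
next
  case True
  define v where "v = rng \<Lambda> \<mu>"
  define n where "n = deg \<Lambda> \<mu>"
  define p where "p \<kappa> = S \<kappa> \<otimes> cadj A (S \<kappa>)" for \<kappa>
  define I where "I = {\<kappa> \<in> paths_deg \<Lambda> n. rng \<Lambda> \<kappa> = v}"
  have vn: "v \<in> vertices \<Lambda>" "n \<in> Nk k" using assms deg_Nk by (auto simp: v_def n_def)
  have I: "finite I" using vn by (simp add: I_def)
  have I': "\<mu> \<in> I" "\<nu> \<in> I"
    using vn assms True by (auto simp: I_def paths_deg_def v_def n_def)
  have Imor: "\<kappa> \<in> mor \<Lambda>" "rng \<Lambda> \<kappa> = v" if "\<kappa> \<in> I" for \<kappa> using that by (auto simp: I_def paths_deg_def)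
  have SSS: "cadj A (S \<kappa>) \<otimes> (S \<kappa> \<otimes> b) = S (src \<Lambda> \<kappa>) \<otimes> b" if "\<kappa> \<in> mor \<Lambda>" "b \<in> carrier A" for \<kappa> b
    using that by (simp add: S_adj_S flip: mult_assoc)
  have sum: "finsum A p I = S v"
    unfolding p_def I_def using S_vertex_sum[OF vn] by simp
  have "p \<mu> \<otimes> p \<nu> = \<zero>"
  proof (rule summand_projections_orthogonal[OF I I'(2,1) assms(4)[symmetric]])
    fix \<kappa> assume \<kappa>: "\<kappa> \<in> I"
    show "p \<kappa> \<otimes> p \<kappa> = p \<kappa>"
      using Imor[OF \<kappa>] by (simp add: p_def mult_assoc SSS S_src_adj)
    show "finsum A p I \<otimes> p \<kappa> = p \<kappa>"
      unfolding sum using vn Imor[OF \<kappa>] S_rng[of \<kappa>] by (simp add: p_def flip: mult_assoc)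
  qed (use Imor in \<open>simp_all add: p_def adj_mult\<close>)
  \<comment> \<open>Framing the product of the range projections by the adjoint of
    \<open>S \<mu>\<close> and by \<open>S \<nu>\<close> recovers the element in question.\<close>
  then have "cadj A (S \<mu>) \<otimes> (p \<mu> \<otimes> p \<nu>) \<otimes> S \<nu> = \<zero>" using assms by simp
  moreover have "cadj A (S \<mu>) \<otimes> (p \<mu> \<otimes> p \<nu>) \<otimes> S \<nu> =
    (cadj A (S \<mu>) \<otimes> S \<mu> \<otimes> cadj A (S \<mu>)) \<otimes> (S \<nu> \<otimes> (cadj A (S \<nu>) \<otimes> S \<nu>))"
    using assms by (simp add: p_def mult_assoc)
  ultimately show ?thesis using assms by (simp add: S_adj_S S_src S_src_adj)
qed

lemma S_adj_comp:
  assumes "\<mu> \<in> mor \<Lambda>" "\<zeta> \<in> mor \<Lambda>" "src \<Lambda> \<mu> = rng \<Lambda> \<zeta>" "\<nu> \<in> mor \<Lambda>" "deg \<Lambda> \<nu> = deg \<Lambda> \<mu>"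
  shows "cadj A (S \<nu>) \<otimes> S (composite \<Lambda> \<mu> \<zeta>) = (if \<nu> = \<mu> then S \<zeta> else \<zero>)"
proof -
  have "cadj A (S \<nu>) \<otimes> S (composite \<Lambda> \<mu> \<zeta>) = (cadj A (S \<nu>) \<otimes> S \<mu>) \<otimes> S \<zeta>"
    using assms by (simp add: mult_assoc flip: S_comp)
  then show ?thesis using assms by (simp add: S_adj_S S_adj_S_orthogonal S_rng)
qed

text \<open>The projection at the source of \<sigma> is expanded in the degree of \<nu>. Each
  \<open>composite \<Lambda> \<sigma> \<eta>\<close> is then long enough to split off an initial
  part of that degree, after which \<open>S_adj_comp\<close> evaluates the summand.\<close>

lemma S_adj_S_expand:
  assumes "\<nu> \<in> mor \<Lambda>" "\<sigma> \<in> mor \<Lambda>"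
  shows "cadj A (S \<nu>) \<otimes> S \<sigma> = (\<Oplus>\<eta> \<in> {\<eta> \<in> paths_deg \<Lambda> (deg \<Lambda> \<nu>). rng \<Lambda> \<eta> = src \<Lambda> \<sigma>}.
    (cadj A (S \<nu>) \<otimes> S (composite \<Lambda> \<sigma> \<eta>)) \<otimes> cadj A (S \<eta>))"
proof -
  define H where "H = {\<eta> \<in> paths_deg \<Lambda> (deg \<Lambda> \<nu>). rng \<Lambda> \<eta> = src \<Lambda> \<sigma>}"
  have H: "finite H" "\<And>\<eta>. \<eta> \<in> H \<Longrightarrow> \<eta> \<in> mor \<Lambda> \<and> src \<Lambda> \<sigma> = rng \<Lambda> \<eta>"
    using assms deg_Nk unfolding H_def by (simp, auto simp: paths_deg_def)
  have "cadj A (S \<nu>) \<otimes> S \<sigma> = (cadj A (S \<nu>) \<otimes> S \<sigma>) \<otimes> S (src \<Lambda> \<sigma>)"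
    using assms by (simp add: mult_assoc S_src)
  also have "\<dots> = (cadj A (S \<nu>) \<otimes> S \<sigma>) \<otimes> (\<Oplus>\<eta>\<in>H. S \<eta> \<otimes> cadj A (S \<eta>))"
    unfolding H_def using assms deg_Nk by (subst (2) S_vertex_sum[of _ "deg \<Lambda> \<nu>"]) auto
  also have "\<dots> = (\<Oplus>\<eta>\<in>H. (cadj A (S \<nu>) \<otimes> S \<sigma>) \<otimes> (S \<eta> \<otimes> cadj A (S \<eta>)))"
    using assms H by (intro finsum_mult_left) auto
  also have "\<dots> = (\<Oplus>\<eta>\<in>H. (cadj A (S \<nu>) \<otimes> S (composite \<Lambda> \<sigma> \<eta>)) \<otimes> cadj A (S \<eta>))"
    using assms H by (intro finsum_cong') (auto simp: mult_assoc simp flip: S_comp)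
  finally show ?thesis unfolding H_def .
qed

section \<open>The dense span of the monomials\<close>

inductive_set monomial_span :: "'a set" where
  zero: "\<zero> \<in> monomial_span"
| add: "\<lbrakk>\<kappa> \<in> mor \<Lambda>; \<nu> \<in> mor \<Lambda>; w \<in> monomial_span\<rbrakk> \<Longrightarrow>
    cscale A z (S \<kappa> \<otimes> cadj A (S \<nu>)) \<oplus> w \<in> monomial_span"

lemma span_carrier: "w \<in> monomial_span \<Longrightarrow> w \<in> carrier A"
  by (induction rule: monomial_span.induct) auto

lemma span_monomial: "\<lbrakk>\<kappa> \<in> mor \<Lambda>; \<nu> \<in> mor \<Lambda>\<rbrakk> \<Longrightarrow> S \<kappa> \<otimes> cadj A (S \<nu>) \<in> monomial_span"
  using monomial_span.add[OF _ _ monomial_span.zero, of \<kappa> \<nu> 1] by simp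

lemma span_add: "\<lbrakk>w \<in> monomial_span; w' \<in> monomial_span\<rbrakk> \<Longrightarrow> w \<oplus> w' \<in> monomial_span"
  by (induction rule: monomial_span.induct)
    (auto simp: span_carrier a_assoc intro: monomial_span.add)

lemma span_scale: "w \<in> monomial_span \<Longrightarrow> cscale A z w \<in> monomial_span"
  by (induction rule: monomial_span.induct)
    (auto simp: span_carrier scale_add_right simp flip: scale_scale intro: monomial_span.intros)

lemma span_adj: "w \<in> monomial_span \<Longrightarrow> cadj A w \<in> monomial_span"
  by (induction rule: monomial_span.induct)
    (auto simp: span_carrier adj_add adj_scale adj_mult intro: monomial_span.intros)

lemma span_finsum:
  assumes "finite I" "f \<in> I \<rightarrow> monomial_span"
  shows "finsum A f I \<in> monomial_span"
  using assms by (induction I rule: finite_induct)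
    (auto simp: Pi_def span_carrier intro: span_add monomial_span.zero)

text \<open>After expanding the inner product of \<nu> and \<sigma>, a summand survives only if
  \<nu> is the initial part of \<open>composite \<Lambda> \<sigma> \<eta>\<close>. With remainder
  \<zeta> it becomes the monomial of \<kappa>\<zeta> and \<tau>\<eta>, or zero if these paths cannot
  be composed.\<close>

lemma span_mult_monomial:
  assumes "\<kappa> \<in> mor \<Lambda>" "\<nu> \<in> mor \<Lambda>" "\<sigma> \<in> mor \<Lambda>" "\<tau> \<in> mor \<Lambda>"
  shows "(S \<kappa> \<otimes> cadj A (S \<nu>)) \<otimes> (S \<sigma> \<otimes> cadj A (S \<tau>)) \<in> monomial_span"
proof -
  define H where "H = {\<eta> \<in> paths_deg \<Lambda> (deg \<Lambda> \<nu>). rng \<Lambda> \<eta> = src \<Lambda> \<sigma>}"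
  have H: "finite H" "\<And>\<eta>. \<eta> \<in> H \<Longrightarrow> \<eta> \<in> mor \<Lambda> \<and> src \<Lambda> \<sigma> = rng \<Lambda> \<eta> \<and> deg \<Lambda> \<eta> = deg \<Lambda> \<nu>"
    using assms deg_Nk unfolding H_def by (simp, auto simp: paths_deg_def)
  define g where "g \<eta> = (cadj A (S \<nu>) \<otimes> S (composite \<Lambda> \<sigma> \<eta>)) \<otimes> cadj A (S \<eta>)" for \<eta>
  have gc: "g \<eta> \<in> carrier A" if "\<eta> \<in> H" for \<eta> using H(2)[OF that] assms by (simp add: g_def)
  have summand: "S \<kappa> \<otimes> (g \<eta> \<otimes> cadj A (S \<tau>)) \<in> monomial_span" if "\<eta> \<in> H" for \<eta>
  proof -
    have \<eta>: "\<eta> \<in> mor \<Lambda>" "src \<Lambda> \<sigma> = rng \<Lambda> \<eta>" "deg \<Lambda> \<eta> = deg \<Lambda> \<nu>" using H(2)[OF that] by auto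
    have "deg \<Lambda> (composite \<Lambda> \<sigma> \<eta>) = deg \<Lambda> \<nu> + deg \<Lambda> \<sigma>"
      using deg_comp[of \<sigma> \<eta>] \<eta> assms by (simp add: add.commute)
    then obtain \<mu> \<zeta> where f: "\<mu> \<in> mor \<Lambda>" "\<zeta> \<in> mor \<Lambda>" "src \<Lambda> \<mu> = rng \<Lambda> \<zeta>"
      "composite \<Lambda> \<mu> \<zeta> = composite \<Lambda> \<sigma> \<eta>" "deg \<Lambda> \<mu> = deg \<Lambda> \<nu>"
      using factorE[of "composite \<Lambda> \<sigma> \<eta>" "deg \<Lambda> \<nu>" "deg \<Lambda> \<sigma>"] \<eta> assms deg_Nk by (metis comp_closed)
    have src: "src \<Lambda> \<zeta> = src \<Lambda> \<eta>" using f \<eta> assms by (metis src_comp)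
    have S_prod: "S \<alpha> \<otimes> S \<beta> = \<zero> \<or> (src \<Lambda> \<alpha> = rng \<Lambda> \<beta> \<and> S \<alpha> \<otimes> S \<beta> = S (composite \<Lambda> \<alpha> \<beta>))"
      if "\<alpha> \<in> mor \<Lambda>" "\<beta> \<in> mor \<Lambda>" for \<alpha> \<beta> using S_mult_zero S_comp that by blast
    have "S \<kappa> \<otimes> (g \<eta> \<otimes> cadj A (S \<tau>)) =
        (if \<nu> = \<mu> then (S \<kappa> \<otimes> S \<zeta>) \<otimes> cadj A (S \<tau> \<otimes> S \<eta>) else \<zero>)"
      using S_adj_comp[OF f(1-3) assms(2)] f(4,5) \<eta> f(1-3) assms
      by (simp add: g_def mult_assoc adj_mult)
    moreover have "(S \<kappa> \<otimes> S \<zeta>) \<otimes> cadj A (S \<tau> \<otimes> S \<eta>) \<in> monomial_span"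
      using S_prod[OF assms(1) f(2)] S_prod[OF assms(4) \<eta>(1)] assms f \<eta>
      by (auto intro: monomial_span.zero intro!: span_monomial)
    ultimately show ?thesis by (simp add: monomial_span.zero)
  qed
  have "(S \<kappa> \<otimes> cadj A (S \<nu>)) \<otimes> (S \<sigma> \<otimes> cadj A (S \<tau>)) =
      S \<kappa> \<otimes> ((cadj A (S \<nu>) \<otimes> S \<sigma>) \<otimes> cadj A (S \<tau>))"
    using assms by (simp add: mult_assoc)
  also have "\<dots> = (\<Oplus>\<eta>\<in>H. S \<kappa> \<otimes> (g \<eta> \<otimes> cadj A (S \<tau>)))"
    unfolding S_adj_S_expand[OF assms(2,3), folded H_def] g_def[symmetric]
    using H(1) gc assms by (simp add: finsum_mult_right finsum_mult_left Pi_def)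
  finally show ?thesis using summand H(1) by (auto intro!: span_finsum)
qed

lemma span_mult:
  assumes "w \<in> monomial_span" "w' \<in> monomial_span"
  shows "w \<otimes> w' \<in> monomial_span"
proof -
  have *: "(S \<kappa> \<otimes> cadj A (S \<nu>)) \<otimes> w' \<in> monomial_span" if "\<kappa> \<in> mor \<Lambda>" "\<nu> \<in> mor \<Lambda>" for \<kappa> \<nu>
    using assms(2)
  proof (induction rule: monomial_span.induct)
    case zero
    then show ?case using that by (simp add: monomial_span.zero)
  next
    case (add \<sigma> \<tau> w z)
    have "(S \<kappa> \<otimes> cadj A (S \<nu>)) \<otimes> (cscale A z (S \<sigma> \<otimes> cadj A (S \<tau>)) \<oplus> w) =
        cscale A z ((S \<kappa> \<otimes> cadj A (S \<nu>)) \<otimes> (S \<sigma> \<otimes> cadj A (S \<tau>))) \<oplus> (S \<kappa> \<otimes> cadj A (S \<nu>)) \<otimes> w"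
      using that add(1,2) span_carrier[OF add(3)] by (simp add: distr_right mult_scale_right)
    then show ?case
      using span_add[OF span_scale[OF span_mult_monomial[OF that add(1,2)]] add.IH] by simp
  qed
  show ?thesis
    using assms(1)
  proof (induction rule: monomial_span.induct)
    case zero
    then show ?case using span_carrier[OF assms(2)] by (simp add: monomial_span.zero)
  next
    case (add \<kappa> \<nu> w z)
    have "(cscale A z (S \<kappa> \<otimes> cadj A (S \<nu>)) \<oplus> w) \<otimes> w' =
        cscale A z ((S \<kappa> \<otimes> cadj A (S \<nu>)) \<otimes> w') \<oplus> w \<otimes> w'"
      using add(1,2) span_carrier[OF add(3)] span_carrier[OF assms(2)]
      by (simp add: distr_left mult_scale_left)
    then show ?case
      using span_add[OF span_scale[OF *[OF add(1,2)]] add.IH] by simp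
  qed
qed

lemma span_dense:
  assumes "a \<in> carrier A"
  obtains f where "range f \<subseteq> monomial_span" "tends_to f a"
proof (rule generated_closure[of monomial_span a])
  \<comment> \<open>A generator is itself a monomial, because vertex projections are
    self-adjoint.\<close>
  have "S \<kappa> = S \<kappa> \<otimes> cadj A (S (src \<Lambda> \<kappa>))" if "\<kappa> \<in> mor \<Lambda>" for \<kappa>
    using that by (simp add: S_vertex S_src)
  then show "S ` mor \<Lambda> \<subseteq> monomial_span"
    using span_monomial by (metis image_subsetI src_vertex vertex_mor)
qed (use assms that span_carrier span_add span_mult span_scale span_adj monomial_span.zero in auto)

end

section \<open>The KMS condition\<close>

context unital_cstar_algebra
begin

lemma functional_tendsto:
  assumes "positive_functional \<phi>" "tends_to f a" "range f \<subseteq> carrier A" "a \<in> carrier A"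
  shows "(\<lambda>n. \<phi> (f n)) \<longlonglongrightarrow> \<phi> a"
proof (rule LIM_zero_cancel, rule Lim_null_comparison)
  show "\<forall>\<^sub>F n in sequentially. cmod (\<phi> (f n) - \<phi> a) \<le> Re (\<phi> u) * cnorm A (f n \<ominus> a)"
    using functional_bound[OF assms(1)] assms(3,4)
    by (auto intro!: always_eventually simp: functional_minus[OF assms(1), symmetric] range_subsetD)
  show "(\<lambda>n. Re (\<phi> u) * cnorm A (f n \<ominus> a)) \<longlonglongrightarrow> 0"
    using tendsto_mult_left[OF assms(2)[unfolded tends_to_def], of "Re (\<phi> u)"] by simp
qed

text \<open>The error \<open>q\<close> of the difference quotient tends to zero in norm, and \<phi>
  is bounded, so the scalar difference quotients converge.\<close>

lemma functional_analytic:
  assumes \<phi>: "positive_functional \<phi>" and F: "analytic_fun A F" and b: "b \<in> carrier A"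
  shows "(\<lambda>z. \<phi> (F z \<otimes> b)) holomorphic_on UNIV"
proof -
  have Fc: "F z \<in> carrier A" for z using F by (auto simp: analytic_fun_def)
  have "\<exists>d. ((\<lambda>z. \<phi> (F z \<otimes> b)) has_field_derivative d) (at z)" for z
  proof -
    obtain D where D: "D \<in> carrier A"
      "((\<lambda>w. cnorm A (cscale A (1 / (w - z)) (F w \<ominus> F z) \<ominus> D)) \<longlongrightarrow> 0) (at z)"
      using F by (auto simp: analytic_fun_def)
    define q where "q w = cscale A (1 / (w - z)) (F w \<ominus> F z) \<ominus> D" for w
    have qc: "q w \<in> carrier A" for w using D Fc by (simp add: q_def)
    have quot: "(\<phi> (F w \<otimes> b) - \<phi> (F z \<otimes> b)) / (w - z) - \<phi> (D \<otimes> b) = \<phi> (q w \<otimes> b)" for w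
      using Fc D(1) b by (simp add: q_def mult_minus_left mult_scale_left functional_minus[OF \<phi>]
          functional_scale[OF \<phi>])
    have "((\<lambda>w. \<phi> (q w \<otimes> b)) \<longlongrightarrow> 0) (at z)"
    proof (rule Lim_null_comparison)
      have "cmod (\<phi> (q w \<otimes> b)) \<le> Re (\<phi> u) * (cnorm A (q w) * cnorm A b)" for w
        using functional_bound[OF \<phi>, of "q w \<otimes> b"] norm_mult[OF qc b, of w]
          functional_square_real(2)[OF \<phi>, of u] qc b
        by (smt (verit) adj_unit mult_closed mult_left_mono unit_closed unit_left)
      then show "\<forall>\<^sub>F w in at z. cmod (\<phi> (q w \<otimes> b)) \<le> Re (\<phi> u) * (cnorm A (q w) * cnorm A b)"
        by simp
      show "((\<lambda>w. Re (\<phi> u) * (cnorm A (q w) * cnorm A b)) \<longlongrightarrow> 0) (at z)"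
        using tendsto_mult_left[OF tendsto_mult_right[OF D(2)[folded q_def], of "cnorm A b"], of "Re (\<phi> u)"]
        by simp
    qed
    then have "((\<lambda>w. (\<phi> (F w \<otimes> b) - \<phi> (F z \<otimes> b)) / (w - z)) \<longlongrightarrow> \<phi> (D \<otimes> b)) (at z)"
      unfolding quot[symmetric] by (rule LIM_zero_cancel)
    then show ?thesis by (auto simp: has_field_derivative_iff)
  qed
  then show ?thesis by (metis field_differentiable_def holomorphic_onI field_differentiable_at_within)
qed

end

section \<open>The KMS condition for a functional supported on the diagonal\<close>

context cuntz_krieger_algebra
begin

lemma functional_eq_on_span:
  assumes "positive_functional \<phi>" "positive_functional \<psi>"
    and "\<And>\<kappa> \<nu>. \<lbrakk>\<kappa> \<in> mor \<Lambda>; \<nu> \<in> mor \<Lambda>\<rbrakk> \<Longrightarrow>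
      \<phi> (S \<kappa> \<otimes> cadj A (S \<nu>)) = \<psi> (S \<kappa> \<otimes> cadj A (S \<nu>))"
    and "w \<in> monomial_span"
  shows "\<phi> w = \<psi> w"
  using assms(4)
proof (induction rule: monomial_span.induct)
  case zero
  then show ?case using functional_zero assms(1,2) by metis
next
  case (add \<kappa> \<nu> w z)
  then show ?case
    using assms(1-3) span_carrier[OF add(3)] by (simp add: functional_add functional_scale)
qed

lemma functional_eqI:
  assumes "positive_functional \<phi>" "positive_functional \<psi>"
    and "\<And>\<kappa> \<nu>. \<lbrakk>\<kappa> \<in> mor \<Lambda>; \<nu> \<in> mor \<Lambda>\<rbrakk> \<Longrightarrow>
      \<phi> (S \<kappa> \<otimes> cadj A (S \<nu>)) = \<psi> (S \<kappa> \<otimes> cadj A (S \<nu>))"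
    and "a \<in> carrier A"
  shows "\<phi> a = \<psi> a"
proof -
  obtain f where f: "range f \<subseteq> monomial_span" "tends_to f a" using span_dense[OF assms(4)] .
  have fc: "range f \<subseteq> carrier A" using f(1) span_carrier by blast
  have "\<phi> (f n) = \<psi> (f n)" for n using functional_eq_on_span[OF assms(1-3)] f(1) by blast
  then have "(\<lambda>n. \<psi> (f n)) \<longlonglongrightarrow> \<phi> a"
    using functional_tendsto[OF assms(1) f(2) fc assms(4)] by simp
  then show ?thesis
    using functional_tendsto[OF assms(2) f(2) fc assms(4)] LIMSEQ_unique by blast
qed

text \<open>In the application \<open>m \<kappa>\<close> is the measure of the cylinder of \<kappa>,
  and \<open>L \<kappa>\<close> is the logarithm of the product of the powers
  \<open>rho \<Lambda> lab i ^ deg \<Lambda> \<kappa> i\<close>.\<close>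

context
  fixes \<phi> :: "'a \<Rightarrow> complex" and m L :: "'g \<Rightarrow> real"
  assumes \<phi>: "positive_functional \<phi>"
    and diag: "\<And>\<kappa> \<nu>. \<lbrakk>\<kappa> \<in> mor \<Lambda>; \<nu> \<in> mor \<Lambda>\<rbrakk> \<Longrightarrow>
      \<phi> (S \<kappa> \<otimes> cadj A (S \<nu>)) = (if \<kappa> = \<nu> then of_real (m \<kappa>) else 0)"
    and m: "\<And>\<kappa> \<sigma>. \<lbrakk>\<kappa> \<in> mor \<Lambda>; \<sigma> \<in> mor \<Lambda>; src \<Lambda> \<kappa> = rng \<Lambda> \<sigma>\<rbrakk> \<Longrightarrow>
      m (composite \<Lambda> \<kappa> \<sigma>) = exp (- L \<kappa>) * m \<sigma>"
begin

text \<open>Both sides vanish unless \<tau> is the composite of \<kappa> and \<sigma>. In that case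
  the left side is \<open>m \<tau>\<close>, the value on the right is \<open>m \<sigma>\<close>, and
  the scaling of \<open>m\<close> relates them.\<close>

lemma KMS_generator_monomial:
  assumes mor: "\<kappa> \<in> mor \<Lambda>" "\<sigma> \<in> mor \<Lambda>" "\<tau> \<in> mor \<Lambda>"
  shows "\<phi> (S \<kappa> \<otimes> (S \<sigma> \<otimes> cadj A (S \<tau>))) =
    of_real (exp (- L \<kappa>)) * \<phi> ((S \<sigma> \<otimes> cadj A (S \<tau>)) \<otimes> S \<kappa>)"
proof (cases "src \<Lambda> \<kappa> = rng \<Lambda> \<sigma> \<and> composite \<Lambda> \<kappa> \<sigma> = \<tau>")
  case True
  then have S\<tau>: "S \<tau> = S \<kappa> \<otimes> S \<sigma>" using mor by (simp add: S_comp)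
  have "S \<kappa> \<otimes> (S \<sigma> \<otimes> cadj A (S \<tau>)) = S \<tau> \<otimes> cadj A (S \<tau>)"
    using mor by (simp add: S\<tau> mult_assoc)
  moreover have "(S \<sigma> \<otimes> cadj A (S \<tau>)) \<otimes> S \<kappa> = S \<sigma> \<otimes> (cadj A (S \<sigma>) \<otimes> S (rng \<Lambda> \<sigma>))"
    using mor True by (simp add: S\<tau> mult_assoc adj_mult S_adj_S)
  ultimately show ?thesis
    using mor True m[of \<kappa> \<sigma>] by (simp add: diag S_adj_rng)
next
  case False
  define H where "H = {\<eta> \<in> paths_deg \<Lambda> (deg \<Lambda> \<tau>). rng \<Lambda> \<eta> = src \<Lambda> \<kappa>}"
  have H: "finite H" "\<And>\<eta>. \<eta> \<in> H \<Longrightarrow> \<eta> \<in> mor \<Lambda> \<and> src \<Lambda> \<kappa> = rng \<Lambda> \<eta> \<and> deg \<Lambda> \<eta> = deg \<Lambda> \<tau>"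
    using mor deg_Nk unfolding H_def by (simp, auto simp: paths_deg_def)
  define g where "g \<eta> = (cadj A (S \<tau>) \<otimes> S (composite \<Lambda> \<kappa> \<eta>)) \<otimes> cadj A (S \<eta>)" for \<eta>
  have gc: "g \<eta> \<in> carrier A" if "\<eta> \<in> H" for \<eta> using H(2)[OF that] mor by (simp add: g_def)
  have zero: "\<phi> (S \<sigma> \<otimes> g \<eta>) = 0" if "\<eta> \<in> H" for \<eta>
  proof -
    have \<eta>: "\<eta> \<in> mor \<Lambda>" "src \<Lambda> \<kappa> = rng \<Lambda> \<eta>" "deg \<Lambda> \<eta> = deg \<Lambda> \<tau>" using H(2)[OF that] by auto
    have "deg \<Lambda> (composite \<Lambda> \<kappa> \<eta>) = deg \<Lambda> \<tau> + deg \<Lambda> \<kappa>"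
      using deg_comp[of \<kappa> \<eta>] \<eta> mor by (simp add: add.commute)
    then obtain \<mu> \<zeta> where f: "\<mu> \<in> mor \<Lambda>" "\<zeta> \<in> mor \<Lambda>" "src \<Lambda> \<mu> = rng \<Lambda> \<zeta>"
      "composite \<Lambda> \<mu> \<zeta> = composite \<Lambda> \<kappa> \<eta>" "deg \<Lambda> \<mu> = deg \<Lambda> \<tau>"
      using factorE[of "composite \<Lambda> \<kappa> \<eta>" "deg \<Lambda> \<tau>" "deg \<Lambda> \<kappa>"] \<eta> mor deg_Nk by (metis comp_closed)
    have eq: "S \<sigma> \<otimes> g \<eta> = (if \<tau> = \<mu> then (S \<sigma> \<otimes> S \<zeta>) \<otimes> cadj A (S \<eta>) else \<zero>)"
      using S_adj_comp[OF f(1-3) mor(3)] f \<eta> mor by (simp add: g_def mult_assoc)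
    show ?thesis
    proof (cases "\<tau> = \<mu> \<and> src \<Lambda> \<sigma> = rng \<Lambda> \<zeta>")
      case True
      \<comment> \<open>If \<sigma>\<zeta> were \<eta>, then \<kappa>\<sigma>\<zeta> =
        \<kappa>\<eta> = \<tau>\<zeta>; cancelling \<zeta> gives \<kappa>\<sigma> = \<tau>, which is
        the excluded case.\<close>
      have "composite \<Lambda> \<sigma> \<zeta> \<noteq> \<eta>"
      proof
        assume *: "composite \<Lambda> \<sigma> \<zeta> = \<eta>"
        then have src: "src \<Lambda> \<kappa> = rng \<Lambda> \<sigma>"
          using \<eta>(2) rng_comp[of \<sigma> \<zeta>] mor f(2) True by simp
        have "composite \<Lambda> (composite \<Lambda> \<kappa> \<sigma>) \<zeta> = composite \<Lambda> \<tau> \<zeta>"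
          using comp_assoc[of \<kappa> \<sigma> \<zeta>] src mor f(2,4) True * by simp
        then have "composite \<Lambda> \<kappa> \<sigma> = \<tau>"
          using src mor f(2,3) True
          by (intro factor_unique(1)[of "composite \<Lambda> \<kappa> \<sigma>" \<zeta> \<tau> \<zeta>]) simp_all
        then show False using False src by simp
      qed
      then show ?thesis using eq True mor f(2) \<eta>(1) by (simp add: S_comp diag)
    next
      case False
      then have "S \<sigma> \<otimes> g \<eta> = \<zero>"
        using eq mor(2) f(2) \<eta>(1) by (cases "\<tau> = \<mu>") (simp_all add: S_mult_zero)
      then show ?thesis by (simp add: functional_zero[OF \<phi>])
    qed
  qed
  have "(S \<sigma> \<otimes> cadj A (S \<tau>)) \<otimes> S \<kappa> = S \<sigma> \<otimes> (cadj A (S \<tau>) \<otimes> S \<kappa>)"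
    using mor by (simp add: mult_assoc)
  also have "\<dots> = (\<Oplus>\<eta>\<in>H. S \<sigma> \<otimes> g \<eta>)"
    unfolding S_adj_S_expand[OF mor(3,1), folded H_def] g_def[symmetric]
    using H(1) gc mor by (simp add: finsum_mult_left Pi_def)
  finally have "\<phi> ((S \<sigma> \<otimes> cadj A (S \<tau>)) \<otimes> S \<kappa>) = 0"
    using H(1) gc mor zero by (simp add: functional_finsum[OF \<phi>] Pi_def)
  moreover have "\<phi> (S \<kappa> \<otimes> (S \<sigma> \<otimes> cadj A (S \<tau>))) = 0"
  proof (cases "src \<Lambda> \<kappa> = rng \<Lambda> \<sigma>")
    case True
    then show ?thesis
      using False mor diag[of "composite \<Lambda> \<kappa> \<sigma>" \<tau>] by (simp flip: S_comp add: mult_assoc)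
  next
    case False
    then have "S \<kappa> \<otimes> (S \<sigma> \<otimes> cadj A (S \<tau>)) = \<zero>"
      using mor S_mult_zero[of \<kappa> \<sigma>] by (simp flip: mult_assoc)
    then show ?thesis by (simp add: functional_zero[OF \<phi>])
  qed
  ultimately show ?thesis by simp
qed

text \<open>Both sides are linear and norm continuous in \<open>b\<close>, so the monomials
  decide.\<close>

lemma KMS_generator:
  assumes \<kappa>: "\<kappa> \<in> mor \<Lambda>" and b: "b \<in> carrier A"
  shows "\<phi> (S \<kappa> \<otimes> b) = of_real (exp (- L \<kappa>)) * \<phi> (b \<otimes> S \<kappa>)"
proof -
  have span: "\<phi> (S \<kappa> \<otimes> w) = of_real (exp (- L \<kappa>)) * \<phi> (w \<otimes> S \<kappa>)" if "w \<in> monomial_span" for w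
    using that
  proof (induction rule: monomial_span.induct)
    case zero
    then show ?case using \<kappa> by (simp add: functional_zero[OF \<phi>])
  next
    case (add \<sigma> \<tau> w z)
    define e where "e = S \<sigma> \<otimes> cadj A (S \<tau>)"
    have e: "e \<in> carrier A"
      "\<phi> (S \<kappa> \<otimes> e) = of_real (exp (- L \<kappa>)) * \<phi> (e \<otimes> S \<kappa>)"
      using add(1,2) KMS_generator_monomial[OF \<kappa> add(1,2)] by (simp_all add: e_def)
    have "\<phi> (S \<kappa> \<otimes> (cscale A z e \<oplus> w)) = z * \<phi> (S \<kappa> \<otimes> e) + \<phi> (S \<kappa> \<otimes> w)"
      "\<phi> ((cscale A z e \<oplus> w) \<otimes> S \<kappa>) = z * \<phi> (e \<otimes> S \<kappa>) + \<phi> (w \<otimes> S \<kappa>)"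
      using \<kappa> e(1) span_carrier[OF add(3)]
      by (simp_all add: distr_left distr_right mult_scale_left mult_scale_right functional_add[OF \<phi>]
          functional_scale[OF \<phi>])
    then show ?case by (simp only: e(2) add.IH e_def[symmetric] distrib_left mult.left_commute)
  qed
  obtain f where f: "range f \<subseteq> monomial_span" "tends_to f b" using span_dense[OF b] .
  have fc: "range f \<subseteq> carrier A" using f(1) span_carrier by blast
  have "(\<lambda>n. \<phi> (S \<kappa> \<otimes> f n)) \<longlonglongrightarrow> \<phi> (S \<kappa> \<otimes> b)"
    using \<kappa> b f(2) fc by (intro functional_tendsto[OF \<phi>] tends_to_mult tends_to_const) auto
  moreover have "(\<lambda>n. of_real (exp (- L \<kappa>)) * \<phi> (f n \<otimes> S \<kappa>)) \<longlonglongrightarrow> of_real (exp (- L \<kappa>)) * \<phi> (b \<otimes> S \<kappa>)"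
    using \<kappa> b f(2) fc by (intro tendsto_mult_left functional_tendsto[OF \<phi>] tends_to_mult tends_to_const) auto
  moreover have "(\<lambda>n. \<phi> (S \<kappa> \<otimes> f n)) = (\<lambda>n. of_real (exp (- L \<kappa>)) * \<phi> (f n \<otimes> S \<kappa>))"
    using span f(1) by blast
  ultimately show ?thesis using LIMSEQ_unique by metis
qed

text \<open>The complex conjugate of \<open>KMS_generator\<close> at the adjoint of
  \<open>b\<close>, solved for the other side; hence the inverse factor.\<close>

lemma KMS_generator_adj:
  assumes \<kappa>: "\<kappa> \<in> mor \<Lambda>" and b: "b \<in> carrier A"
  shows "\<phi> (cadj A (S \<kappa>) \<otimes> b) = of_real (exp (L \<kappa>)) * \<phi> (b \<otimes> cadj A (S \<kappa>))"
proof -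
  have "\<phi> (cadj A b \<otimes> S \<kappa>) = of_real (exp (L \<kappa>)) * \<phi> (S \<kappa> \<otimes> cadj A b)"
    using KMS_generator[OF \<kappa>, of "cadj A b"] b
    by (simp flip: exp_of_real) (simp add: exp_add[symmetric] mult.assoc[symmetric])
  then show ?thesis
    using functional_cnj[OF \<phi> b S_closed[OF \<kappa>]] functional_cnj[OF \<phi>, of "cadj A (S \<kappa>)" "cadj A b"] \<kappa> b
    by simp
qed

lemma KMS_monomial:
  assumes "\<kappa> \<in> mor \<Lambda>" "\<nu> \<in> mor \<Lambda>" "b \<in> carrier A"
  shows "\<phi> ((S \<kappa> \<otimes> cadj A (S \<nu>)) \<otimes> b) = of_real (exp (L \<nu> - L \<kappa>)) * \<phi> (b \<otimes> (S \<kappa> \<otimes> cadj A (S \<nu>)))"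
proof -
  have "\<phi> ((S \<kappa> \<otimes> cadj A (S \<nu>)) \<otimes> b) = of_real (exp (- L \<kappa>)) * \<phi> (cadj A (S \<nu>) \<otimes> (b \<otimes> S \<kappa>))"
    using KMS_generator[of \<kappa> "cadj A (S \<nu>) \<otimes> b"] assms by (simp add: mult_assoc)
  also have "\<phi> (cadj A (S \<nu>) \<otimes> (b \<otimes> S \<kappa>)) = of_real (exp (L \<nu>)) * \<phi> (b \<otimes> (S \<kappa> \<otimes> cadj A (S \<nu>)))"
    using KMS_generator_adj[of \<nu> "b \<otimes> S \<kappa>"] assms by (simp add: mult_assoc)
  finally show ?thesis by (simp add: exp_diff exp_minus field_simps)
qed

text \<open>
  For a monomial \<open>b\<close>, an eigenvector of the dynamics, the function
  $z \mapsto \phi(\alpha_z(a) b) e^{i \delta z}$ is entire and, by invariance of \<open>\<phi>\<close>, constant on the real line.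
\<close>

theorem KMS_analytic:
  fixes \<alpha> :: "real \<Rightarrow> 'a \<Rightarrow> 'a"
  assumes hom: "\<And>t. star_hom A A (\<alpha> t)"
    and eigen: "\<And>t \<kappa>. \<kappa> \<in> mor \<Lambda> \<Longrightarrow> \<alpha> t (S \<kappa>) = cscale A (cis (t * L \<kappa> / \<beta>)) (S \<kappa>)"
    and \<beta>: "\<beta> \<noteq> 0"
    and a: "a \<in> carrier A" "analytic_extension A \<alpha> a F" and b: "b \<in> carrier A"
  shows "\<phi> (a \<otimes> b) = \<phi> (b \<otimes> F (\<i> * of_real \<beta>))"
proof -
  have F: "analytic_fun A F" "\<And>t. F (of_real t) = \<alpha> t a"
    using a(2) by (auto simp: analytic_extension_def)
  then have Fc: "F z \<in> carrier A" for z by (auto simp: analytic_fun_def)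
  have \<alpha>: "\<And>c. c \<in> carrier A \<Longrightarrow> \<alpha> t c \<in> carrier A" "\<And>c. c \<in> carrier A \<Longrightarrow> \<alpha> t (cadj A c) = cadj A (\<alpha> t c)"
    "\<And>c z. c \<in> carrier A \<Longrightarrow> \<alpha> t (cscale A z c) = cscale A z (\<alpha> t c)"
    "\<And>c d. \<lbrakk>c \<in> carrier A; d \<in> carrier A\<rbrakk> \<Longrightarrow> \<alpha> t (c \<oplus> d) = \<alpha> t c \<oplus> \<alpha> t d"
    "\<And>c d. \<lbrakk>c \<in> carrier A; d \<in> carrier A\<rbrakk> \<Longrightarrow> \<alpha> t (c \<otimes> d) = \<alpha> t c \<otimes> \<alpha> t d" for t
    using hom[of t] by (auto simp: star_hom_def)
  have monomial: "\<alpha> t (S \<kappa> \<otimes> cadj A (S \<nu>)) = cscale A (cis (t * (L \<kappa> - L \<nu>) / \<beta>)) (S \<kappa> \<otimes> cadj A (S \<nu>))"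
    if "\<kappa> \<in> mor \<Lambda>" "\<nu> \<in> mor \<Lambda>" for t \<kappa> \<nu>
    using that by (simp add: \<alpha> eigen adj_scale mult_scale_left mult_scale_right cis_mult cis_cnj
        diff_divide_distrib right_diff_distrib flip: scale_scale)
  \<comment> \<open>Off-diagonal monomials have value 0, and on diagonal ones the eigenvalue of the
    dynamics is 1.\<close>
  have inv: "\<phi> (\<alpha> t c) = \<phi> c" if "c \<in> carrier A" for t c
  proof (rule functional_eqI[OF _ \<phi> _ that])
    show "positive_functional (\<lambda>c. \<phi> (\<alpha> t c))"
      using \<phi> \<alpha> by (simp add: positive_functional_def)
    show "\<phi> (\<alpha> t (S \<kappa> \<otimes> cadj A (S \<nu>))) = \<phi> (S \<kappa> \<otimes> cadj A (S \<nu>))"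
      if "\<kappa> \<in> mor \<Lambda>" "\<nu> \<in> mor \<Lambda>" for \<kappa> \<nu>
      using that by (simp add: monomial functional_scale[OF \<phi>] diag)
  qed
  have key: "\<phi> (a \<otimes> (S \<kappa> \<otimes> cadj A (S \<nu>))) = \<phi> ((S \<kappa> \<otimes> cadj A (S \<nu>)) \<otimes> F (\<i> * of_real \<beta>))"
    if \<kappa>\<nu>: "\<kappa> \<in> mor \<Lambda>" "\<nu> \<in> mor \<Lambda>" for \<kappa> \<nu>
  proof -
    define e where "e = S \<kappa> \<otimes> cadj A (S \<nu>)"
    \<comment> \<open>The frequency of the monomial \<open>e\<close> under the dynamics.\<close>
    define \<delta> where "\<delta> = (L \<kappa> - L \<nu>) / \<beta>"
    have e: "e \<in> carrier A" "\<alpha> t e = cscale A (cis (t * \<delta>)) e" for t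
      using \<kappa>\<nu> monomial by (auto simp: e_def \<delta>_def)
    define g where "g z = \<phi> (F z \<otimes> e) * exp (\<i> * of_real \<delta> * z)" for z
    have hol: "g holomorphic_on UNIV"
      unfolding g_def using functional_analytic[OF \<phi> F(1) e(1)] by (intro holomorphic_intros) auto
    have zero: "g z - \<phi> (a \<otimes> e) = 0" if "z \<in> \<real>" for z
    proof -
      obtain t where t: "z = of_real t" using \<open>z \<in> \<real>\<close> Reals_cases by blast
      have "g z = \<phi> (\<alpha> t a \<otimes> e) * cis (t * \<delta>)"
        by (simp add: g_def t F(2) cis_conv_exp mult_ac)
      also have "\<dots> = \<phi> (\<alpha> t (a \<otimes> e))"
        using a(1) e by (simp add: \<alpha> mult_scale_right functional_scale[OF \<phi>])
      also have "\<dots> = \<phi> (a \<otimes> e)" using inv a(1) e by simp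
      finally show ?thesis by simp
    qed
    have lim: "(0::complex) islimpt \<real>"
    proof (rule islimptI)
      fix T :: "complex set" assume "0 \<in> T" "open T"
      then obtain r where r: "0 < r" "ball 0 r \<subseteq> T" using open_contains_ball by blast
      then have "of_real (r / 2) \<in> T" by (intro subsetD[OF r(2)]) simp
      then show "\<exists>y\<in>\<real>. y \<in> T \<and> y \<noteq> 0" using r(1) by (intro bexI[of _ "of_real (r / 2)"]) auto
    qed
    \<comment> \<open>Identity theorem: the entire function \<open>g\<close> minus its constant
      vanishes on the real line, which accumulates at 0.\<close>
    have "g (\<i> * of_real \<beta>) - \<phi> (a \<otimes> e) = 0"
      by (rule analytic_continuation[OF holomorphic_on_diff[OF hol holomorphic_on_const] open_UNIV
          connected_UNIV subset_UNIV UNIV_I lim zero UNIV_I])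
    then have "\<phi> (a \<otimes> e) = \<phi> (F (\<i> * of_real \<beta>) \<otimes> e) * exp (\<i> * of_real \<delta> * (\<i> * of_real \<beta>))"
      by (simp add: g_def)
    \<comment> \<open>At \<open>\<i> * \<beta>\<close> the phase becomes the real factor with which
      \<open>KMS_monomial\<close> moves \<open>e\<close> from one side to the other.\<close>
    also have "\<i> * of_real \<delta> * (\<i> * of_real \<beta>) = of_real (L \<nu> - L \<kappa>)"
      using \<beta> by (simp add: \<delta>_def field_simps)
    also have "\<phi> (F (\<i> * of_real \<beta>) \<otimes> e) * exp (of_real (L \<nu> - L \<kappa>)) = \<phi> (e \<otimes> F (\<i> * of_real \<beta>))"
      using KMS_monomial[OF \<kappa>\<nu> Fc, of "\<i> * of_real \<beta>"]
      by (simp only: e_def exp_of_real mult.commute)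
    finally show ?thesis by (simp add: e_def)
  qed
  have span: "\<phi> (a \<otimes> w) = \<phi> (w \<otimes> F (\<i> * of_real \<beta>))" if "w \<in> monomial_span" for w
    using that
  proof (induction rule: monomial_span.induct)
    case zero
    then show ?case using a(1) Fc by (simp add: functional_zero[OF \<phi>])
  next
    case (add \<sigma> \<tau> w z)
    then show ?case
      using a(1) Fc span_carrier[OF add(3)] key[of \<sigma> \<tau>]
      by (simp add: distr_left distr_right mult_scale_left mult_scale_right functional_add[OF \<phi>]
          functional_scale[OF \<phi>])
  qed
  obtain f where f: "range f \<subseteq> monomial_span" "tends_to f b" using span_dense[OF b] .
  have fc: "range f \<subseteq> carrier A" using f(1) span_carrier by blast
  have "(\<lambda>n. \<phi> (a \<otimes> f n)) \<longlonglongrightarrow> \<phi> (a \<otimes> b)"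
    using a b f(2) fc by (intro functional_tendsto[OF \<phi>] tends_to_mult tends_to_const) auto
  moreover have "(\<lambda>n. \<phi> (f n \<otimes> F (\<i> * of_real \<beta>))) \<longlonglongrightarrow> \<phi> (b \<otimes> F (\<i> * of_real \<beta>))"
    using b f(2) fc Fc by (intro functional_tendsto[OF \<phi>] tends_to_mult tends_to_const) auto
  moreover have "(\<lambda>n. \<phi> (a \<otimes> f n)) = (\<lambda>n. \<phi> (f n \<otimes> F (\<i> * of_real \<beta>)))"
    using span f(1) by blast
  ultimately show ?thesis using LIMSEQ_unique by metis
qed

end

end

section \<open>Bounded operators on square-summable sequences\<close>

abbreviation trunc_norm :: "nat \<Rightarrow> (nat \<Rightarrow> complex) \<Rightarrow> real" where
  "trunc_norm n v \<equiv> L2_set (\<lambda>i. cmod (v i)) {..<n}"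

definition trunc_form :: "(nat \<Rightarrow> nat \<Rightarrow> complex) \<Rightarrow> nat \<Rightarrow> (nat \<Rightarrow> complex) \<Rightarrow> (nat \<Rightarrow> complex) \<Rightarrow> complex" where
  "trunc_form a n u v = (\<Sum>i<n. \<Sum>j<n. cnj (u i) * a i j * v j)"

definition trunc_apply :: "(nat \<Rightarrow> nat \<Rightarrow> complex) \<Rightarrow> nat \<Rightarrow> (nat \<Rightarrow> complex) \<Rightarrow> nat \<Rightarrow> complex" where
  "trunc_apply a m v i = (\<Sum>j<m. a i j * v j)"

text \<open>
  An infinite matrix defines a bounded operator on the square-summable sequences if its finite
  truncations are uniformly bounded as sesquilinear forms.
\<close>

definition form_bound :: "(nat \<Rightarrow> nat \<Rightarrow> complex) \<Rightarrow> real \<Rightarrow> bool" where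
  "form_bound a C \<longleftrightarrow> 0 \<le> C \<and> (\<forall>n u v. cmod (trunc_form a n u v) \<le> C * trunc_norm n u * trunc_norm n v)"

definition bounded_matrix :: "(nat \<Rightarrow> nat \<Rightarrow> complex) \<Rightarrow> bool" where
  "bounded_matrix a \<longleftrightarrow> (\<exists>C. form_bound a C)"

text \<open>For a bounded matrix this is the operator norm; \<open>form_bound_norm\<close> shows
  that the infimum is attained.\<close>

definition matrix_norm :: "(nat \<Rightarrow> nat \<Rightarrow> complex) \<Rightarrow> real" where
  "matrix_norm a = Inf {C. form_bound a C}"

definition matrix_adj :: "(nat \<Rightarrow> nat \<Rightarrow> complex) \<Rightarrow> nat \<Rightarrow> nat \<Rightarrow> complex" where
  "matrix_adj a i j = cnj (a j i)"

definition matrix_mult :: "(nat \<Rightarrow> nat \<Rightarrow> complex) \<Rightarrow> (nat \<Rightarrow> nat \<Rightarrow> complex) \<Rightarrow> nat \<Rightarrow> nat \<Rightarrow> complex" where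
  "matrix_mult a b i j = (\<Sum>l. a i l * b l j)"

section \<open>The operator norm as the least form bound\<close>

lemma form_bound_nonneg: "form_bound a C \<Longrightarrow> 0 \<le> C"
  by (simp add: form_bound_def)

lemma form_boundD:
  "form_bound a C \<Longrightarrow> cmod (trunc_form a n u v) \<le> C * trunc_norm n u * trunc_norm n v"
  by (simp add: form_bound_def)

lemma form_bound_mono: "\<lbrakk>form_bound a C; C \<le> D\<rbrakk> \<Longrightarrow> form_bound a D"
  unfolding form_bound_def
  by (meson L2_set_nonneg mult_right_mono order_trans)

lemma form_bound_zero: "form_bound (\<lambda>i j. 0) 0"
  by (simp add: form_bound_def trunc_form_def)

lemma form_bound_add:
  assumes "form_bound a C" "form_bound b D"
  shows "form_bound (\<lambda>i j. a i j + b i j) (C + D)"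
proof -
  have "trunc_form (\<lambda>i j. a i j + b i j) n u v = trunc_form a n u v + trunc_form b n u v" for n u v
    by (simp add: trunc_form_def algebra_simps sum.distrib)
  then have "cmod (trunc_form (\<lambda>i j. a i j + b i j) n u v) \<le>
      C * trunc_norm n u * trunc_norm n v + D * trunc_norm n u * trunc_norm n v" for n u v
    by (auto intro!: order_trans[OF norm_triangle_ineq] add_mono form_boundD assms)
  then show ?thesis
    using assms by (simp add: form_bound_def algebra_simps)
qed

lemma form_bound_scale:
  assumes "form_bound a C"
  shows "form_bound (\<lambda>i j. z * a i j) (cmod z * C)"
proof -
  have "trunc_form (\<lambda>i j. z * a i j) n u v = z * trunc_form a n u v" for n u v
    by (simp add: trunc_form_def sum_distrib_left mult_ac)
  then show ?thesis
    using assms by (simp add: form_bound_def norm_mult mult_left_mono mult.assoc)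
qed

lemma form_bound_adj:
  assumes "form_bound a C"
  shows "form_bound (matrix_adj a) C"
proof -
  have "trunc_form (matrix_adj a) n u v = cnj (trunc_form a n v u)" for n u v
    unfolding trunc_form_def matrix_adj_def cnj_sum
    by (subst sum.swap) (simp add: mult_ac)
  then have "cmod (trunc_form (matrix_adj a) n u v) \<le> C * trunc_norm n u * trunc_norm n v" for n u v
    using form_boundD[OF assms, of n v u] by (simp add: mult_ac)
  then show ?thesis
    using form_bound_nonneg[OF assms] by (simp add: form_bound_def)
qed

lemma matrix_norm_le: "form_bound a C \<Longrightarrow> matrix_norm a \<le> C"
  unfolding matrix_norm_def by (rule cInf_lower) (auto simp: bdd_below_def form_bound_def)

text \<open>For nonzero vectors every bound \<open>C\<close> is at least the quotient of the form by
  the product of the norms, so the infimum is at least this quotient too.\<close>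

lemma form_bound_norm:
  assumes "bounded_matrix a"
  shows "form_bound a (matrix_norm a)"
proof -
  have ne: "{C. form_bound a C} \<noteq> {}" using assms by (auto simp: bounded_matrix_def)
  have "cmod (trunc_form a n u v) \<le> matrix_norm a * trunc_norm n u * trunc_norm n v" for n u v
  proof (cases "trunc_norm n u * trunc_norm n v = 0")
    case True
    obtain C where "form_bound a C" using ne by auto
    then show ?thesis using True form_boundD[of a C n u v] by (auto simp: mult.assoc)
  next
    case False
    then have pos: "0 < trunc_norm n u * trunc_norm n v" by (simp add: less_le)
    have "cmod (trunc_form a n u v) / (trunc_norm n u * trunc_norm n v) \<le> matrix_norm a"
      unfolding matrix_norm_def
    proof (rule cInf_greatest[OF ne])
      fix C assume "C \<in> {C. form_bound a C}"
      then show "cmod (trunc_form a n u v) / (trunc_norm n u * trunc_norm n v) \<le> C"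
        using form_boundD[of a C n u v] pos by (simp add: pos_divide_le_eq mult.assoc)
    qed
    then show ?thesis using pos by (simp add: pos_divide_le_eq mult.assoc)
  qed
  moreover have "0 \<le> matrix_norm a"
    unfolding matrix_norm_def by (rule cInf_greatest[OF ne]) (auto simp: form_bound_def)
  ultimately show ?thesis by (simp add: form_bound_def)
qed

lemma trunc_norm_square: "(trunc_norm n v)\<^sup>2 = (\<Sum>i<n. (cmod (v i))\<^sup>2)"
  by (simp add: L2_set_def sum_nonneg)

lemma sum_mult_le_trunc_norm: "cmod (\<Sum>i<n. u i * v i) \<le> trunc_norm n u * trunc_norm n v"
proof -
  have "cmod (\<Sum>i<n. u i * v i) \<le> (\<Sum>i<n. cmod (u i) * cmod (v i))"
    by (rule order_trans[OF norm_sum]) (simp add: norm_mult)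
  also have "\<dots> \<le> trunc_norm n u * trunc_norm n v"
    using L2_set_mult_ineq[of "\<lambda>i. cmod (u i)" "\<lambda>i. cmod (v i)" "{..<n}"] by simp
  finally show ?thesis .
qed

text \<open>Duality: testing the form against the image vector itself yields the square of the norm
  to be bounded, and one factor cancels.\<close>

lemma trunc_apply_bound:
  assumes "form_bound a C"
  shows "trunc_norm n (trunc_apply a m v) \<le> C * trunc_norm m v"
proof -
  \<comment> \<open>The forms are square while this truncation is rectangular, so both vectors are
    padded with zeros to the larger size.\<close>
  define N where "N = max n m"
  define u where "u i = (if i < n then trunc_apply a m v i else 0)" for i
  define w where "w j = (if j < m then v j else 0)" for j
  have u: "trunc_norm N u = trunc_norm n (trunc_apply a m v)"
    unfolding L2_set_def u_def N_def
    by (rule arg_cong[of _ _ sqrt], rule sum.mono_neutral_cong_right) auto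
  have w: "trunc_norm N w = trunc_norm m v"
    unfolding L2_set_def w_def N_def
    by (rule arg_cong[of _ _ sqrt], rule sum.mono_neutral_cong_right) auto
  have "(\<Sum>j<N. a i j * w j) = trunc_apply a m v i" for i
    unfolding trunc_apply_def w_def N_def by (rule sum.mono_neutral_cong_right) auto
  then have "trunc_form a N u w = (\<Sum>i<N. cnj (u i) * trunc_apply a m v i)"
    by (simp add: trunc_form_def mult.assoc flip: sum_distrib_left)
  also have "\<dots> = (\<Sum>i<n. cnj (trunc_apply a m v i) * trunc_apply a m v i)"
    unfolding u_def N_def by (rule sum.mono_neutral_cong_right) auto
  also have "\<dots> = of_real ((trunc_norm n (trunc_apply a m v))\<^sup>2)"
    unfolding trunc_norm_square of_real_sum
    by (rule sum.cong) (simp_all only: complex_norm_square mult.commute)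
  finally have "cmod (trunc_form a N u w) = (trunc_norm n (trunc_apply a m v))\<^sup>2"
    by (simp only: norm_of_real abs_power2)
  then have "(trunc_norm n (trunc_apply a m v))\<^sup>2 \<le> C * trunc_norm n (trunc_apply a m v) * trunc_norm m v"
    using form_boundD[OF assms, of N u w] by (simp add: u w)
  then have *: "trunc_norm n (trunc_apply a m v) * trunc_norm n (trunc_apply a m v)
      \<le> trunc_norm n (trunc_apply a m v) * (C * trunc_norm m v)"
    by (simp add: power2_eq_square mult_ac)
  show ?thesis
  proof (cases "trunc_norm n (trunc_apply a m v) = 0")
    case True
    then show ?thesis using form_bound_nonneg[OF assms] by simp
  next
    case False
    then have "0 < trunc_norm n (trunc_apply a m v)" by (simp add: less_le)
    then show ?thesis using * by (simp only: mult_le_cancel_left_pos)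
  qed
qed

lemma trunc_column_bound:
  assumes "form_bound a C"
  shows "trunc_norm n (\<lambda>i. a i j) \<le> C"
proof -
  have "trunc_apply a (Suc j) (\<lambda>l. if l = j then 1 else 0) = (\<lambda>i. a i j)"
    by (auto simp: trunc_apply_def fun_eq_iff if_distrib cong: if_cong)
  moreover have "trunc_norm (Suc j) (\<lambda>l. if l = j then 1 else 0) = 1"
    by (simp add: L2_set_def if_distrib cong: if_cong)
  ultimately show ?thesis
    using trunc_apply_bound[OF assms, of "Suc j" "\<lambda>l. if l = j then 1 else 0" n] by simp
qed

lemma trunc_row_bound:
  assumes "form_bound a C"
  shows "trunc_norm n (\<lambda>j. a i j) \<le> C"
  using trunc_column_bound[OF form_bound_adj[OF assms], of i n] by (simp add: matrix_adj_def)

lemma entry_bound: "form_bound a C \<Longrightarrow> cmod (a i j) \<le> C"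
  using member_le_L2_set[of "{..<Suc i}" i "\<lambda>i. cmod (a i j)"] trunc_column_bound[of a C j "Suc i"]
  by fastforce

section \<open>Products of infinite matrices\<close>

definition square_summable :: "(nat \<Rightarrow> complex) \<Rightarrow> bool" where
  "square_summable v \<longleftrightarrow> summable (\<lambda>i. (cmod (v i))\<^sup>2)"

lemma square_summableI:
  assumes "\<And>n. trunc_norm n v \<le> C"
  shows "square_summable v"
  unfolding square_summable_def
proof (rule summableI_nonneg_bounded)
  show "(\<Sum>i<n. (cmod (v i))\<^sup>2) \<le> C\<^sup>2" for n
    unfolding trunc_norm_square[symmetric] using assms by (intro power_mono) auto
qed simp

lemma trunc_norm_le_suminf:
  assumes "square_summable v"
  shows "trunc_norm n v \<le> sqrt (\<Sum>i. (cmod (v i))\<^sup>2)"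
  unfolding L2_set_def using assms
  by (intro real_sqrt_le_mono sum_le_suminf) (auto simp: square_summable_def)

lemma summable_mult_square:
  assumes "square_summable u" "square_summable v"
  shows "summable (\<lambda>i. u i * v i)"
proof (rule summable_comparison_test')
  show "summable (\<lambda>i. (cmod (u i))\<^sup>2 + (cmod (v i))\<^sup>2)"
    using assms by (intro summable_add) (auto simp: square_summable_def)
  show "cmod (u i * v i) \<le> (cmod (u i))\<^sup>2 + (cmod (v i))\<^sup>2" if "0 \<le> i" for i
  proof -
    have "cmod (u i * v i) \<le> 2 * cmod (u i) * cmod (v i)"
      using norm_ge_zero[of "u i * v i"] unfolding norm_mult mult.assoc by simp
    also have "\<dots> \<le> (cmod (u i))\<^sup>2 + (cmod (v i))\<^sup>2" by (rule sum_squares_bound)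
    finally show ?thesis .
  qed
qed

lemma row_square_summable: "form_bound a C \<Longrightarrow> square_summable (\<lambda>j. a i j)"
  by (rule square_summableI[OF trunc_row_bound])

lemma column_square_summable: "form_bound a C \<Longrightarrow> square_summable (\<lambda>i. a i j)"
  by (rule square_summableI[OF trunc_column_bound])

lemma matrix_mult_sums:
  assumes "form_bound a C" "form_bound b D"
  shows "(\<lambda>l. a i l * b l j) sums matrix_mult a b i j"
  unfolding matrix_mult_def
  using summable_mult_square[OF row_square_summable[OF assms(1)] column_square_summable[OF assms(2)]]
  by (rule summable_sums)

text \<open>The form of a product is the inner product of the adjoint of \<open>a\<close> applied to
  \<open>u\<close> with \<open>b\<close> applied to \<open>v\<close>. The middle index is not
  truncated, which makes this a series.\<close>

lemma trunc_form_mult_sums: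
  assumes "form_bound a C" "form_bound b D"
  shows "(\<lambda>l. cnj (trunc_apply (matrix_adj a) n u l) * trunc_apply b n v l) sums trunc_form (matrix_mult a b) n u v"
proof -
  have "(\<lambda>l. \<Sum>i<n. \<Sum>j<n. cnj (u i) * (a i l * b l j) * v j) sums trunc_form (matrix_mult a b) n u v"
    unfolding trunc_form_def
    by (intro sums_sum sums_mult sums_mult2 matrix_mult_sums[OF assms])
  moreover have "(\<Sum>i<n. \<Sum>j<n. cnj (u i) * (a i l * b l j) * v j) =
      cnj (trunc_apply (matrix_adj a) n u l) * trunc_apply b n v l" for l
    by (simp add: trunc_apply_def matrix_adj_def sum_product) (simp add: mult_ac)
  ultimately show ?thesis by simp
qed

lemma form_bound_mult:
  assumes "form_bound a C" "form_bound b D"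
  shows "form_bound (matrix_mult a b) (C * D)"
proof -
  have "cmod (trunc_form (matrix_mult a b) n u v) \<le> C * D * trunc_norm n u * trunc_norm n v" for n u v
  proof (rule LIMSEQ_le_const2[OF tendsto_norm])
    show "(\<lambda>L. \<Sum>l<L. cnj (trunc_apply (matrix_adj a) n u l) * trunc_apply b n v l)
        \<longlonglongrightarrow> trunc_form (matrix_mult a b) n u v"
      using trunc_form_mult_sums[OF assms] by (simp add: sums_def)
    have "cmod (\<Sum>l<L. cnj (trunc_apply (matrix_adj a) n u l) * trunc_apply b n v l)
        \<le> C * D * trunc_norm n u * trunc_norm n v" for L
    proof -
      have "cmod (\<Sum>l<L. cnj (trunc_apply (matrix_adj a) n u l) * trunc_apply b n v l)
          \<le> trunc_norm L (trunc_apply (matrix_adj a) n u) * trunc_norm L (trunc_apply b n v)"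
        using sum_mult_le_trunc_norm[of "\<lambda>l. cnj (trunc_apply (matrix_adj a) n u l)"] by simp
      also have "\<dots> \<le> (C * trunc_norm n u) * (D * trunc_norm n v)"
        using form_bound_nonneg[OF assms(1)]
        by (intro mult_mono trunc_apply_bound form_bound_adj assms) auto
      finally show ?thesis by (simp add: mult_ac)
    qed
    then show "\<exists>N. \<forall>L\<ge>N. cmod (\<Sum>l<L. cnj (trunc_apply (matrix_adj a) n u l) * trunc_apply b n v l)
        \<le> C * D * trunc_norm n u * trunc_norm n v" by blast
  qed
  then show ?thesis
    using form_bound_nonneg[OF assms(1)] form_bound_nonneg[OF assms(2)] by (simp add: form_bound_def)
qed

text \<open>The squared norm of \<open>a v\<close> is the form of
  \<open>matrix_mult (matrix_adj a) a\<close> at \<open>v\<close>, hence at most \<open>C\<close>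
  times the squared norm of \<open>v\<close>. This is the nontrivial half of the C*-identity; the
  bound \<open>D\<close> makes the series converge.\<close>

lemma form_bound_sqrt:
  assumes a: "form_bound a D" and C: "form_bound (matrix_mult (matrix_adj a) a) C"
  shows "form_bound a (sqrt C)"
proof -
  have adj2: "matrix_adj (matrix_adj a) = a" by (simp add: matrix_adj_def fun_eq_iff)
  have C0: "0 \<le> C" using form_bound_nonneg[OF C] .
  have "cmod (trunc_form a n u v) \<le> sqrt C * trunc_norm n u * trunc_norm n v" for n u v
  proof -
    let ?w = "trunc_apply a n v"
    have sums: "(\<lambda>l. cnj (?w l) * ?w l) sums trunc_form (matrix_mult (matrix_adj a) a) n v v"
      using trunc_form_mult_sums[OF form_bound_adj[OF a] a, of n v v] by (simp add: adj2)
    then have "(\<lambda>l. (cmod (?w l))\<^sup>2) sums Re (trunc_form (matrix_mult (matrix_adj a) a) n v v)"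
      using sums_Re[OF sums] unfolding cmod_power2 by (simp add: power2_eq_square)
    then have "(trunc_norm n ?w)\<^sup>2 \<le> Re (trunc_form (matrix_mult (matrix_adj a) a) n v v)"
      unfolding trunc_norm_square by (metis sum_le_suminf sums_iff finite_lessThan zero_le_power2)
    also have "\<dots> \<le> C * trunc_norm n v * trunc_norm n v"
      using form_boundD[OF C, of n v v] complex_Re_le_cmod order_trans by blast
    also have "\<dots> = (sqrt C * trunc_norm n v)\<^sup>2"
      using C0 by (simp add: power2_eq_square)
    finally have w: "trunc_norm n ?w \<le> sqrt C * trunc_norm n v"
      by (rule power2_le_imp_le) (simp add: C0)
    have "trunc_form a n u v = (\<Sum>i<n. cnj (u i) * ?w i)"
      by (simp add: trunc_form_def trunc_apply_def sum_distrib_left mult_ac)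
    also have "cmod \<dots> \<le> trunc_norm n u * trunc_norm n ?w"
      using sum_mult_le_trunc_norm[of "\<lambda>i. cnj (u i)" ?w n] by simp
    also have "\<dots> \<le> trunc_norm n u * (sqrt C * trunc_norm n v)"
      using w by (simp add: mult_left_mono)
    finally show ?thesis by (simp add: mult_ac)
  qed
  then show ?thesis using C0 by (simp add: form_bound_def)
qed

text \<open>
  Only finitely many entries of \<open>p\<close> matter up to an error controlled by the tail of \<open>p\<close>, and for
  finitely many entries the two summations commute.
\<close>

lemma bilinear_sum_swap:
  assumes b: "form_bound b C" and p: "square_summable p" and q: "square_summable q"
  shows "(\<Sum>m. (\<Sum>l. p l * b l m) * q m) = (\<Sum>l. p l * (\<Sum>m. b l m * q m))"
proof -
  define r where "r m = (\<Sum>l. p l * b l m)" for m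
  define y where "y l = (\<Sum>m. b l m * q m)" for l
  define rL where "rL L m = (\<Sum>l<L. p l * b l m)" for L m
  define P Q where "P = sqrt (\<Sum>i. (cmod (p i))\<^sup>2)" and "Q = sqrt (\<Sum>i. (cmod (q i))\<^sup>2)"
  \<comment> \<open>The norm of the tail of \<open>p\<close> from index \<open>L\<close> on, which
    tends to 0.\<close>
  define T where "T L = sqrt (\<Sum>i. (cmod (p (i + L)))\<^sup>2)" for L
  have C0: "0 \<le> C" using form_bound_nonneg[OF b] .
  have psum: "summable (\<lambda>i. (cmod (p i))\<^sup>2)" using p by (simp add: square_summable_def)
  have psumL: "summable (\<lambda>i. (cmod (p (i + L)))\<^sup>2)" for L
    using psum by (rule summable_ignore_initial_segment)
  have r_lim: "(\<lambda>L. rL L m) \<longlonglongrightarrow> r m" for m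
    unfolding r_def rL_def using summable_mult_square[OF p column_square_summable[OF b]]
    by (rule summable_LIMSEQ)
  have y_sums: "(\<lambda>m. b l m * q m) sums y l" for l
    unfolding y_def using summable_mult_square[OF row_square_summable[OF b] q] by (rule summable_sums)
  have rL_apply: "rL L m = cnj (trunc_apply (matrix_adj b) L (\<lambda>l. cnj (p l)) m)" for L m
    by (simp add: rL_def trunc_apply_def matrix_adj_def mult.commute)
  have "trunc_norm M r \<le> C * P" for M
  proof (rule LIMSEQ_le_const2)
    show "(\<lambda>L. trunc_norm M (rL L)) \<longlonglongrightarrow> trunc_norm M r"
      unfolding L2_set_def by (intro tendsto_intros r_lim)
    have "trunc_norm M (rL L) \<le> C * trunc_norm L p" for L
      using trunc_apply_bound[OF form_bound_adj[OF b], of L "\<lambda>l. cnj (p l)" M] by (simp add: rL_apply)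
    also have "C * trunc_norm L p \<le> C * P" for L
      unfolding P_def using C0 trunc_norm_le_suminf[OF p] by (rule mult_left_mono[rotated])
    finally show "\<exists>N. \<forall>L\<ge>N. trunc_norm M (rL L) \<le> C * P" by blast
  qed
  then have rq: "(\<lambda>m. r m * q m) sums (\<Sum>m. r m * q m)"
    by (intro summable_sums summable_mult_square square_summableI q)
  have tail_part: "cmod (\<Sum>m<M. (rL L' m - rL L m) * q m) \<le> T L * (C * Q)" if "L \<le> L'" for L L' M
  proof -
    define v where "v l = (if L \<le> l then p l else 0)" for l
    have "rL L' m - rL L m = (\<Sum>l<L'. v l * b l m)" for m
    proof -
      have "rL L' m = rL L m + (\<Sum>l\<in>{L..<L'}. p l * b l m)"
        unfolding rL_def lessThan_atLeast0 using that by (simp add: sum.atLeastLessThan_concat)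
      also have "(\<Sum>l\<in>{L..<L'}. p l * b l m) = (\<Sum>l<L'. v l * b l m)"
        unfolding v_def by (rule sum.mono_neutral_cong_left) auto
      finally show ?thesis by simp
    qed
    then have "(\<Sum>m<M. (rL L' m - rL L m) * q m) = (\<Sum>l<L'. v l * trunc_apply b M q l)"
      unfolding trunc_apply_def
      by (simp add: sum_distrib_left sum_distrib_right mult.assoc sum.swap[of _ "{..<M}"])
    also have "cmod \<dots> \<le> trunc_norm L' v * trunc_norm L' (trunc_apply b M q)"
      by (rule sum_mult_le_trunc_norm)
    also have "\<dots> \<le> T L * (C * Q)"
    proof (rule mult_mono)
      have "(\<Sum>l<L'. (cmod (v l))\<^sup>2) = (\<Sum>l\<in>{L..<L'}. (cmod (p l))\<^sup>2)"
        unfolding v_def by (rule sum.mono_neutral_cong_right) auto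
      also have "\<dots> = (\<Sum>l<L' - L. (cmod (p (l + L)))\<^sup>2)"
        using sum.shift_bounds_nat_ivl[of "\<lambda>l. (cmod (p l))\<^sup>2" 0 L "L' - L"] that
        by (simp add: lessThan_atLeast0)
      also have "\<dots> \<le> (\<Sum>l. (cmod (p (l + L)))\<^sup>2)"
        by (intro sum_le_suminf psumL) auto
      finally show "trunc_norm L' v \<le> T L" by (simp add: L2_set_def T_def)
      show "trunc_norm L' (trunc_apply b M q) \<le> C * Q"
        using trunc_apply_bound[OF b, of M q L'] mult_left_mono[OF trunc_norm_le_suminf[OF q, of M] C0]
        by (simp add: Q_def)
    qed (simp_all add: T_def suminf_nonneg psumL)
    finally show ?thesis .
  qed
  \<comment> \<open>\<open>tail_part\<close> compares two finite stages. First \<open>L'\<close> and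
    then \<open>M\<close> go to infinity, and the bound persists because it depends only on
    \<open>L\<close>.\<close>
  have bound: "cmod ((\<Sum>m. r m * q m) - (\<Sum>l<L. p l * y l)) \<le> T L * (C * Q)" for L
  proof (rule LIMSEQ_le_const2[OF tendsto_norm])
    have "(\<lambda>m. \<Sum>l<L. p l * (b l m * q m)) sums (\<Sum>l<L. p l * y l)"
      by (intro sums_sum sums_mult y_sums)
    then have "(\<lambda>m. rL L m * q m) sums (\<Sum>l<L. p l * y l)"
      by (simp add: rL_def sum_distrib_right mult.assoc)
    from sums_diff[OF rq this]
    show "(\<lambda>M. \<Sum>m<M. (r m - rL L m) * q m) \<longlonglongrightarrow> (\<Sum>m. r m * q m) - (\<Sum>l<L. p l * y l)"
      by (simp add: sums_def left_diff_distrib)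
    have "cmod (\<Sum>m<M. (r m - rL L m) * q m) \<le> T L * (C * Q)" for M
    proof (rule LIMSEQ_le_const2[OF tendsto_norm])
      show "(\<lambda>L'. \<Sum>m<M. (rL L' m - rL L m) * q m) \<longlonglongrightarrow> (\<Sum>m<M. (r m - rL L m) * q m)"
        by (intro tendsto_intros r_lim)
      show "\<exists>N. \<forall>L'\<ge>N. cmod (\<Sum>m<M. (rL L' m - rL L m) * q m) \<le> T L * (C * Q)"
        using tail_part by blast
    qed
    then show "\<exists>N. \<forall>M\<ge>N. cmod (\<Sum>m<M. (r m - rL L m) * q m) \<le> T L * (C * Q)" by blast
  qed
  have "T \<longlonglongrightarrow> sqrt ((\<Sum>i. (cmod (p i))\<^sup>2) - (\<Sum>i. (cmod (p i))\<^sup>2))"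
    unfolding T_def[abs_def] suminf_minus_initial_segment[OF psum]
    by (intro tendsto_intros summable_LIMSEQ psum)
  then have "(\<lambda>L. T L * (C * Q)) \<longlonglongrightarrow> 0"
    using tendsto_mult_left_zero by auto
  then have "(\<lambda>L. (\<Sum>l<L. p l * y l) - (\<Sum>m. r m * q m)) \<longlonglongrightarrow> 0"
    by (rule Lim_null_comparison[rotated]) (use bound in \<open>simp add: norm_minus_commute\<close>)
  then have "(\<lambda>l. p l * y l) sums (\<Sum>m. r m * q m)"
    unfolding sums_def by (rule LIM_zero_cancel)
  then show ?thesis
    by (simp add: sums_iff r_def y_def)
qed

lemma matrix_mult_assoc:
  assumes "form_bound a C" "form_bound b D" "form_bound c E"
  shows "matrix_mult (matrix_mult a b) c = matrix_mult a (matrix_mult b c)"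
proof (intro ext)
  fix i j
  show "matrix_mult (matrix_mult a b) c i j = matrix_mult a (matrix_mult b c) i j"
    using bilinear_sum_swap[OF assms(2) row_square_summable[OF assms(1), of i]
        column_square_summable[OF assms(3), of j]]
    by (simp add: matrix_mult_def)
qed

lemma matrix_adj_mult:
  assumes "form_bound a C" "form_bound b D"
  shows "matrix_adj (matrix_mult a b) = matrix_mult (matrix_adj b) (matrix_adj a)"
proof (intro ext)
  fix i j
  have "(\<lambda>l. cnj (a j l * b l i)) sums cnj (matrix_mult a b j i)"
    unfolding sums_cnj by (rule matrix_mult_sums[OF assms])
  then show "matrix_adj (matrix_mult a b) i j = matrix_mult (matrix_adj b) (matrix_adj a) i j"
    by (simp add: matrix_adj_def matrix_mult_def sums_iff mult.commute)
qed

lemma matrix_mult_add_left: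
  assumes "form_bound a C" "form_bound b D" "form_bound c E"
  shows "matrix_mult (\<lambda>i j. a i j + b i j) c = (\<lambda>i j. matrix_mult a c i j + matrix_mult b c i j)"
proof (intro ext)
  fix i j
  show "matrix_mult (\<lambda>i j. a i j + b i j) c i j = matrix_mult a c i j + matrix_mult b c i j"
    using sums_add[OF matrix_mult_sums[OF assms(1,3)] matrix_mult_sums[OF assms(2,3)], of i j i j]
    by (simp add: matrix_mult_def sums_iff distrib_right)
qed

lemma matrix_mult_add_right:
  assumes "form_bound a C" "form_bound b D" "form_bound c E"
  shows "matrix_mult c (\<lambda>i j. a i j + b i j) = (\<lambda>i j. matrix_mult c a i j + matrix_mult c b i j)"
proof (intro ext)
  fix i j
  show "matrix_mult c (\<lambda>i j. a i j + b i j) i j = matrix_mult c a i j + matrix_mult c b i j"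
    using sums_add[OF matrix_mult_sums[OF assms(3,1)] matrix_mult_sums[OF assms(3,2)], of i j i j]
    by (simp add: matrix_mult_def sums_iff distrib_left)
qed

lemma matrix_mult_scale_left:
  assumes "form_bound a C" "form_bound b D"
  shows "matrix_mult (\<lambda>i j. z * a i j) b = (\<lambda>i j. z * matrix_mult a b i j)"
proof (intro ext)
  fix i j
  show "matrix_mult (\<lambda>i j. z * a i j) b i j = z * matrix_mult a b i j"
    using sums_mult[OF matrix_mult_sums[OF assms, of i j], of z]
    by (simp add: matrix_mult_def sums_iff mult.assoc)
qed

lemma matrix_mult_scale_right:
  assumes "form_bound a C" "form_bound b D"
  shows "matrix_mult a (\<lambda>i j. z * b i j) = (\<lambda>i j. z * matrix_mult a b i j)"
proof (intro ext)
  fix i j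
  show "matrix_mult a (\<lambda>i j. z * b i j) i j = z * matrix_mult a b i j"
    using sums_mult[OF matrix_mult_sums[OF assms, of i j], of z]
    by (simp add: matrix_mult_def sums_iff mult.left_commute)
qed

lemma matrix_norm_cstar:
  assumes "bounded_matrix a"
  shows "matrix_norm (matrix_mult (matrix_adj a) a) = (matrix_norm a)\<^sup>2"
proof (rule antisym)
  note a = form_bound_norm[OF assms]
  have aa: "form_bound (matrix_mult (matrix_adj a) a) (matrix_norm a * matrix_norm a)"
    by (intro form_bound_mult form_bound_adj a)
  then show "matrix_norm (matrix_mult (matrix_adj a) a) \<le> (matrix_norm a)\<^sup>2"
    by (simp add: matrix_norm_le power2_eq_square)
  have "bounded_matrix (matrix_mult (matrix_adj a) a)" using aa by (auto simp: bounded_matrix_def)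
  note b = form_bound_norm[OF this]
  have "matrix_norm a \<le> sqrt (matrix_norm (matrix_mult (matrix_adj a) a))"
    by (rule matrix_norm_le[OF form_bound_sqrt[OF a b]])
  then have "(matrix_norm a)\<^sup>2 \<le> (sqrt (matrix_norm (matrix_mult (matrix_adj a) a)))\<^sup>2"
    using form_bound_nonneg[OF a] by (rule power_mono)
  then show "(matrix_norm a)\<^sup>2 \<le> matrix_norm (matrix_mult (matrix_adj a) a)"
    using form_bound_nonneg[OF b] by simp
qed

text \<open>Each inequality of \<open>form_bound\<close> involves finitely many entries and so
  survives entrywise limits.\<close>

lemma form_bound_limit:
  assumes "\<And>l. l \<ge> n0 \<Longrightarrow> form_bound (f l) C" and "\<And>i j. (\<lambda>l. f l i j) \<longlonglongrightarrow> a i j"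
  shows "form_bound a C"
proof -
  have "cmod (trunc_form a n u v) \<le> C * trunc_norm n u * trunc_norm n v" for n u v
  proof (rule LIMSEQ_le_const2[OF tendsto_norm])
    show "(\<lambda>l. trunc_form (f l) n u v) \<longlonglongrightarrow> trunc_form a n u v"
      unfolding trunc_form_def by (intro tendsto_intros assms(2))
    show "\<exists>N. \<forall>l\<ge>N. cmod (trunc_form (f l) n u v) \<le> C * trunc_norm n u * trunc_norm n v"
      using assms(1) form_boundD by blast
  qed
  then show ?thesis using form_bound_nonneg[OF assms(1)[OF order_refl]] by (simp add: form_bound_def)
qed

text \<open>Entries are dominated by the norm, so they converge. Letting one index of the Cauchy
  condition go to infinity with \<open>form_bound_limit\<close> upgrades this to norm
  convergence.\<close>

lemma matrix_complete:
  assumes f: "\<And>n. bounded_matrix (f n)"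
    and Cauchy: "\<And>e. 0 < e \<Longrightarrow> \<exists>n0. \<forall>m\<ge>n0. \<forall>n\<ge>n0. matrix_norm (\<lambda>i j. f m i j - f n i j) < e"
  obtains a where "bounded_matrix a" "(\<lambda>n. matrix_norm (\<lambda>i j. f n i j - a i j)) \<longlonglongrightarrow> 0"
proof -
  have diff: "bounded_matrix (\<lambda>i j. f m i j - f n i j)" for m n
    using form_bound_add[OF form_bound_norm[OF f[of m]] form_bound_scale[OF form_bound_norm[OF f[of n]], of "-1"]]
    by (auto simp: bounded_matrix_def)
  have bound: "\<exists>n0. \<forall>m\<ge>n0. \<forall>n\<ge>n0. form_bound (\<lambda>i j. f m i j - f n i j) e" if "0 < e" for e
    using Cauchy[OF that] form_bound_mono[OF form_bound_norm[OF diff]] less_imp_le by meson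
  have "Cauchy (\<lambda>n. f n i j)" for i j
  proof (rule CauchyI)
    fix e :: real assume e: "0 < e"
    then obtain n0 where "\<And>m n. \<lbrakk>m \<ge> n0; n \<ge> n0\<rbrakk> \<Longrightarrow> form_bound (\<lambda>i j. f m i j - f n i j) (e / 2)"
      using bound[of "e / 2"] by auto
    then have "cmod (f m i j - f n i j) \<le> e / 2" if "m \<ge> n0" "n \<ge> n0" for m n
      using entry_bound[of "\<lambda>i j. f m i j - f n i j" "e / 2" i j] that by simp
    then show "\<exists>M. \<forall>m\<ge>M. \<forall>n\<ge>M. cmod (f m i j - f n i j) < e"
      using e by (intro exI[of _ n0]) (smt (verit) field_sum_of_halves)
  qed
  then obtain a where a: "(\<lambda>n. f n i j) \<longlonglongrightarrow> a i j" for i j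
    unfolding Cauchy_convergent_iff convergent_def by metis
  have close: "\<exists>n0. \<forall>m\<ge>n0. form_bound (\<lambda>i j. f m i j - a i j) e" if e: "0 < e" for e
  proof -
    obtain n0 where n0: "\<And>m n. \<lbrakk>m \<ge> n0; n \<ge> n0\<rbrakk> \<Longrightarrow> form_bound (\<lambda>i j. f m i j - f n i j) e"
      using bound[OF e] by blast
    have "form_bound (\<lambda>i j. f m i j - a i j) e" if "m \<ge> n0" for m
      by (rule form_bound_limit[of n0 "\<lambda>n i j. f m i j - f n i j"])
        (use n0 that in \<open>auto intro!: tendsto_intros a\<close>)
    then show ?thesis by blast
  qed
  show ?thesis
  proof (rule that)
    obtain n0 where "form_bound (\<lambda>i j. f n0 i j - a i j) 1" using close[of 1] by auto
    from form_bound_add[OF form_bound_norm[OF f[of n0]] form_bound_scale[OF this, of "-1"]]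
    show "bounded_matrix a" by (auto simp: bounded_matrix_def)
    show "(\<lambda>n. matrix_norm (\<lambda>i j. f n i j - a i j)) \<longlonglongrightarrow> 0"
    proof (rule LIMSEQ_I)
      fix e :: real assume "0 < e"
      then obtain n0 where n0: "\<And>m. m \<ge> n0 \<Longrightarrow> form_bound (\<lambda>i j. f m i j - a i j) (e / 2)"
        using close[of "e / 2"] by auto
      have "norm (matrix_norm (\<lambda>i j. f n i j - a i j) - 0) < e" if "n \<ge> n0" for n
      proof -
        have "0 \<le> matrix_norm (\<lambda>i j. f n i j - a i j)"
          using n0[OF that] by (intro form_bound_nonneg[OF form_bound_norm]) (auto simp: bounded_matrix_def)
        then show ?thesis using matrix_norm_le[OF n0[OF that]] \<open>0 < e\<close> by simp
      qed
      then show "\<exists>no. \<forall>n\<ge>no. norm (matrix_norm (\<lambda>i j. f n i j - a i j) - 0) < e" by blast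
    qed
  qed
qed

text \<open>
  The matrix entries are listed along the Cantor pairing because the universal property only
  provides homomorphisms into algebras of complex sequences.
\<close>

definition entry :: "(nat \<Rightarrow> complex) \<Rightarrow> nat \<Rightarrow> nat \<Rightarrow> complex" where
  "entry a i j = a (prod_encode (i, j))"

definition of_entries :: "(nat \<Rightarrow> nat \<Rightarrow> complex) \<Rightarrow> nat \<Rightarrow> complex" where
  "of_entries f n = (case prod_decode n of (i, j) \<Rightarrow> f i j)"

definition l2_algebra :: "(nat \<Rightarrow> complex) cstar" where
  "l2_algebra = \<lparr>carrier = {a. bounded_matrix (entry a)},
     monoid.mult = (\<lambda>a b. of_entries (matrix_mult (entry a) (entry b))),
     one = (\<lambda>_. 0), zero = (\<lambda>_. 0), add = (\<lambda>a b n. a n + b n),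
     cscale = (\<lambda>z a n. z * a n), cadj = (\<lambda>a. of_entries (matrix_adj (entry a))),
     cnorm = (\<lambda>a. matrix_norm (entry a))\<rparr>"

section \<open>The bounded matrices form a C*-algebra\<close>

lemma entry_of_entries [simp]: "entry (of_entries f) = f"
  by (simp add: entry_def of_entries_def fun_eq_iff)

lemma entry_zero [simp]: "entry (\<lambda>n. 0) = (\<lambda>i j. 0)"
  by (simp add: entry_def fun_eq_iff)

lemma entry_add [simp]: "entry (\<lambda>n. a n + b n) = (\<lambda>i j. entry a i j + entry b i j)"
  by (simp add: entry_def fun_eq_iff)

lemma entry_diff [simp]: "entry (\<lambda>n. a n - b n) = (\<lambda>i j. entry a i j - entry b i j)"
  by (simp add: entry_def fun_eq_iff)

lemma entry_uminus [simp]: "entry (\<lambda>n. - a n) = (\<lambda>i j. - entry a i j)"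
  by (simp add: entry_def fun_eq_iff)

lemma entry_scale [simp]: "entry (\<lambda>n. z * a n) = (\<lambda>i j. z * entry a i j)"
  by (simp add: entry_def fun_eq_iff)

lemma entry_eqI: "entry a = entry b \<Longrightarrow> a = b"
proof (rule ext)
  fix n assume "entry a = entry b"
  then have "entry a (fst (prod_decode n)) (snd (prod_decode n)) = entry b (fst (prod_decode n)) (snd (prod_decode n))"
    by simp
  then show "a n = b n" by (simp add: entry_def)
qed

lemma l2_simps:
  "a \<in> carrier l2_algebra \<longleftrightarrow> bounded_matrix (entry a)"
  "a \<otimes>\<^bsub>l2_algebra\<^esub> b = of_entries (matrix_mult (entry a) (entry b))"
  "\<zero>\<^bsub>l2_algebra\<^esub> = (\<lambda>_. 0)"
  "a \<oplus>\<^bsub>l2_algebra\<^esub> b = (\<lambda>n. a n + b n)"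
  "cscale l2_algebra z a = (\<lambda>n. z * a n)"
  "cadj l2_algebra a = of_entries (matrix_adj (entry a))"
  "cnorm l2_algebra a = matrix_norm (entry a)"
  by (simp_all add: l2_algebra_def)

lemma bounded_matrixE:
  assumes "bounded_matrix a"
  obtains C where "form_bound a C"
  using assms by (auto simp: bounded_matrix_def)

lemma bounded_matrix_closed:
  "bounded_matrix (\<lambda>i j. 0)"
  "\<lbrakk>bounded_matrix a; bounded_matrix b\<rbrakk> \<Longrightarrow> bounded_matrix (\<lambda>i j. a i j + b i j)"
  "bounded_matrix a \<Longrightarrow> bounded_matrix (\<lambda>i j. z * a i j)"
  "bounded_matrix a \<Longrightarrow> bounded_matrix (matrix_adj a)"
  "\<lbrakk>bounded_matrix a; bounded_matrix b\<rbrakk> \<Longrightarrow> bounded_matrix (matrix_mult a b)"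
  unfolding bounded_matrix_def
  using form_bound_zero form_bound_add form_bound_scale form_bound_adj form_bound_mult by blast+

lemma l2_abelian_group: "abelian_group l2_algebra"
proof (rule abelian_groupI)
  fix x assume "x \<in> carrier l2_algebra"
  then show "\<exists>y\<in>carrier l2_algebra. y \<oplus>\<^bsub>l2_algebra\<^esub> x = \<zero>\<^bsub>l2_algebra\<^esub>"
    using bounded_matrix_closed(3)[of "entry x" "-1"]
    by (intro bexI[of _ "\<lambda>n. -1 * x n"]) (simp_all add: l2_simps del: mult_minus1)
qed (auto simp: l2_simps bounded_matrix_closed algebra_simps)

lemma l2_minus:
  assumes "a \<in> carrier l2_algebra" "b \<in> carrier l2_algebra"
  shows "a \<ominus>\<^bsub>l2_algebra\<^esub> b = (\<lambda>n. a n - b n)"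
proof -
  interpret abelian_group l2_algebra by (rule l2_abelian_group)
  have "\<ominus>\<^bsub>l2_algebra\<^esub> b = (\<lambda>n. -1 * b n)"
    using assms(2) bounded_matrix_closed(3)[of "entry b" "-1"]
    by (intro minus_equality) (simp_all add: l2_simps del: mult_minus1)
  then show ?thesis by (simp add: minus_eq l2_simps)
qed

theorem l2_cstar_algebra: "cstar_algebra l2_algebra"
proof -
  interpret abelian_group l2_algebra by (rule l2_abelian_group)
  show ?thesis
  proof unfold_locales
    fix a b c :: "nat \<Rightarrow> complex"
    assume abc: "a \<in> carrier l2_algebra" "b \<in> carrier l2_algebra" "c \<in> carrier l2_algebra"
    obtain C D E where fb: "form_bound (entry a) C" "form_bound (entry b) D" "form_bound (entry c) E"
      using abc unfolding l2_simps by (metis bounded_matrixE)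
    show "a \<otimes>\<^bsub>l2_algebra\<^esub> b \<otimes>\<^bsub>l2_algebra\<^esub> c = a \<otimes>\<^bsub>l2_algebra\<^esub> (b \<otimes>\<^bsub>l2_algebra\<^esub> c)"
      using matrix_mult_assoc[OF fb] by (simp add: l2_simps)
    show "(a \<oplus>\<^bsub>l2_algebra\<^esub> b) \<otimes>\<^bsub>l2_algebra\<^esub> c = a \<otimes>\<^bsub>l2_algebra\<^esub> c \<oplus>\<^bsub>l2_algebra\<^esub> b \<otimes>\<^bsub>l2_algebra\<^esub> c"
      using matrix_mult_add_left[OF fb] by (intro entry_eqI) (simp add: l2_simps)
    show "a \<otimes>\<^bsub>l2_algebra\<^esub> (b \<oplus>\<^bsub>l2_algebra\<^esub> c) = a \<otimes>\<^bsub>l2_algebra\<^esub> b \<oplus>\<^bsub>l2_algebra\<^esub> a \<otimes>\<^bsub>l2_algebra\<^esub> c"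
      using matrix_mult_add_right[OF fb(2,3,1)] by (intro entry_eqI) (simp add: l2_simps)
  next
    fix a b :: "nat \<Rightarrow> complex" and z
    assume ab: "a \<in> carrier l2_algebra" "b \<in> carrier l2_algebra"
    then have na: "form_bound (entry a) (matrix_norm (entry a))" and nb: "form_bound (entry b) (matrix_norm (entry b))"
      by (auto simp: l2_simps form_bound_norm)
    show "a \<otimes>\<^bsub>l2_algebra\<^esub> b \<in> carrier l2_algebra"
      using ab by (simp add: l2_simps bounded_matrix_closed)
    show "cscale l2_algebra z a \<otimes>\<^bsub>l2_algebra\<^esub> b = cscale l2_algebra z (a \<otimes>\<^bsub>l2_algebra\<^esub> b)"
      using matrix_mult_scale_left[OF na nb] by (intro entry_eqI) (simp add: l2_simps)
    show "a \<otimes>\<^bsub>l2_algebra\<^esub> cscale l2_algebra z b = cscale l2_algebra z (a \<otimes>\<^bsub>l2_algebra\<^esub> b)"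
      using matrix_mult_scale_right[OF na nb] by (intro entry_eqI) (simp add: l2_simps)
    show "cscale l2_algebra z (a \<oplus>\<^bsub>l2_algebra\<^esub> b) = cscale l2_algebra z a \<oplus>\<^bsub>l2_algebra\<^esub> cscale l2_algebra z b"
      by (simp add: l2_simps algebra_simps)
    show "cadj l2_algebra (a \<oplus>\<^bsub>l2_algebra\<^esub> b) = cadj l2_algebra a \<oplus>\<^bsub>l2_algebra\<^esub> cadj l2_algebra b"
      by (intro entry_eqI) (simp add: l2_simps matrix_adj_def fun_eq_iff)
    show "cadj l2_algebra (a \<otimes>\<^bsub>l2_algebra\<^esub> b) = cadj l2_algebra b \<otimes>\<^bsub>l2_algebra\<^esub> cadj l2_algebra a"
      using matrix_adj_mult[OF na nb] by (simp add: l2_simps)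
    show "cnorm l2_algebra (a \<oplus>\<^bsub>l2_algebra\<^esub> b) \<le> cnorm l2_algebra a + cnorm l2_algebra b"
      using matrix_norm_le[OF form_bound_add[OF na nb]] by (simp add: l2_simps)
    show "cnorm l2_algebra (a \<otimes>\<^bsub>l2_algebra\<^esub> b) \<le> cnorm l2_algebra a * cnorm l2_algebra b"
      using matrix_norm_le[OF form_bound_mult[OF na nb]] by (simp add: l2_simps)
  next
    fix a :: "nat \<Rightarrow> complex" and z w
    assume a: "a \<in> carrier l2_algebra"
    then have ba: "bounded_matrix (entry a)" by (simp add: l2_simps)
    note na = form_bound_norm[OF ba]
    show "cscale l2_algebra z a \<in> carrier l2_algebra" "cadj l2_algebra a \<in> carrier l2_algebra"
      using ba by (auto simp: l2_simps bounded_matrix_closed)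
    show "cscale l2_algebra (z + w) a = cscale l2_algebra z a \<oplus>\<^bsub>l2_algebra\<^esub> cscale l2_algebra w a"
      "cscale l2_algebra (z * w) a = cscale l2_algebra z (cscale l2_algebra w a)"
      "cscale l2_algebra 1 a = a"
      by (simp_all add: l2_simps algebra_simps)
    show "cadj l2_algebra (cadj l2_algebra a) = a"
      "cadj l2_algebra (cscale l2_algebra z a) = cscale l2_algebra (cnj z) (cadj l2_algebra a)"
      by (intro entry_eqI; simp add: l2_simps matrix_adj_def fun_eq_iff)+
    show "0 \<le> cnorm l2_algebra a" using form_bound_nonneg[OF na] by (simp add: l2_simps)
    show "cnorm l2_algebra a = 0 \<longleftrightarrow> a = \<zero>\<^bsub>l2_algebra\<^esub>"
    proof
      assume "cnorm l2_algebra a = 0"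
      then have "entry a i j = 0" for i j
        using entry_bound[OF na, of i j] by (simp add: l2_simps)
      then show "a = \<zero>\<^bsub>l2_algebra\<^esub>"
        by (intro entry_eqI) (simp add: l2_simps fun_eq_iff)
    next
      assume "a = \<zero>\<^bsub>l2_algebra\<^esub>"
      then show "cnorm l2_algebra a = 0"
        using matrix_norm_le[OF form_bound_zero] form_bound_nonneg[OF na] by (simp add: l2_simps)
    qed
    show "cnorm l2_algebra (cadj l2_algebra a \<otimes>\<^bsub>l2_algebra\<^esub> a) = (cnorm l2_algebra a)\<^sup>2"
      using matrix_norm_cstar[OF ba] by (simp add: l2_simps)
    have le: "cnorm l2_algebra (cscale l2_algebra y b) \<le> cmod y * cnorm l2_algebra b"
      if "b \<in> carrier l2_algebra" for y b
      using matrix_norm_le[OF form_bound_scale[OF form_bound_norm, of "entry b" y]] that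
      by (simp add: l2_simps)
    show "cnorm l2_algebra (cscale l2_algebra z a) = cmod z * cnorm l2_algebra a"
    proof (cases "z = 0")
      case True
      then show ?thesis
        using le[OF a, of 0] form_bound_nonneg[OF form_bound_norm[OF bounded_matrix_closed(1)]]
        by (simp add: l2_simps)
    next
      case False
      \<comment> \<open>The reverse inequality is \<open>le\<close> applied to the scalar
        \<open>1 / z\<close>.\<close>
      have "cnorm l2_algebra (cscale l2_algebra (1 / z) (cscale l2_algebra z a))
          \<le> cmod (1 / z) * cnorm l2_algebra (cscale l2_algebra z a)"
        using ba by (intro le) (simp add: l2_simps bounded_matrix_closed)
      moreover have "cscale l2_algebra (1 / z) (cscale l2_algebra z a) = a"
        using False by (simp add: l2_simps)
      ultimately have "cmod z * cnorm l2_algebra a \<le> cnorm l2_algebra (cscale l2_algebra z a)"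
        using False by (simp add: norm_divide field_simps)
      then show ?thesis using le[OF a, of z] by simp
    qed
  next
    fix f :: "nat \<Rightarrow> nat \<Rightarrow> complex"
    assume f: "range f \<subseteq> carrier l2_algebra"
      and Cauchy: "\<And>e. 0 < e \<Longrightarrow> \<exists>n0. \<forall>m\<ge>n0. \<forall>n\<ge>n0. cnorm l2_algebra (f m \<ominus>\<^bsub>l2_algebra\<^esub> f n) < e"
    have fc: "f n \<in> carrier l2_algebra" for n using f by auto
    obtain a where a: "bounded_matrix a" "(\<lambda>n. matrix_norm (\<lambda>i j. entry (f n) i j - a i j)) \<longlonglongrightarrow> 0"
    proof (rule matrix_complete[of "\<lambda>n. entry (f n)"])
      show "\<exists>n0. \<forall>m\<ge>n0. \<forall>n\<ge>n0. matrix_norm (\<lambda>i j. entry (f m) i j - entry (f n) i j) < e"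
        if "0 < e" for e using Cauchy[OF that] by (simp add: l2_minus fc) (simp add: l2_simps)
    qed (use fc in \<open>auto simp: l2_simps\<close>)
    have "of_entries a \<in> carrier l2_algebra" using a(1) by (simp add: l2_simps)
    moreover from this have "(\<lambda>n. cnorm l2_algebra (f n \<ominus>\<^bsub>l2_algebra\<^esub> of_entries a)) \<longlonglongrightarrow> 0"
      using a(2) by (simp add: l2_minus fc) (simp add: l2_simps)
    ultimately show "\<exists>a\<in>carrier l2_algebra. (\<lambda>n. cnorm l2_algebra (f n \<ominus>\<^bsub>l2_algebra\<^esub> a)) \<longlonglongrightarrow> 0"
      by blast
  qed
qed

section \<open>The representation of an infinite path\<close>

text \<open>Generators will act by moving basis vectors along partial injections. Products, adjoints
  and disjoint sums of such matrices correspond to composition, converse and union, so the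
  Cuntz-Krieger relations become identities between relations.\<close>

definition relation_matrix :: "(nat \<times> nat) set \<Rightarrow> nat \<Rightarrow> nat \<Rightarrow> complex" where
  "relation_matrix R i j = (if (i, j) \<in> R then 1 else 0)"

definition partial_injection :: "(nat \<times> nat) set \<Rightarrow> bool" where
  "partial_injection R \<longleftrightarrow> single_valued R \<and> single_valued (R\<inverse>)"

lemma partial_injectionD:
  assumes "partial_injection R"
  shows "\<lbrakk>(i, j) \<in> R; (i, j') \<in> R\<rbrakk> \<Longrightarrow> j = j'" "\<lbrakk>(i, j) \<in> R; (i', j) \<in> R\<rbrakk> \<Longrightarrow> i = i'"
  using assms by (auto simp: partial_injection_def single_valued_def)

text \<open>A partial injection uses each row and each column at most once, so Cauchy-Schwarz over
  its pairs gives the bound 1.\<close>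

lemma relation_matrix_bound:
  assumes "partial_injection R"
  shows "form_bound (relation_matrix R) 1"
proof -
  have "cmod (trunc_form (relation_matrix R) n u v) \<le> trunc_norm n u * trunc_norm n v" for n u v
  proof -
    define Q where "Q = R \<inter> {..<n} \<times> {..<n}"
    have Q: "finite Q" "inj_on fst Q" "inj_on snd Q"
      using partial_injectionD[OF assms] by (auto simp: Q_def inj_on_def)
    have "trunc_form (relation_matrix R) n u v =
        (\<Sum>p\<in>{..<n} \<times> {..<n}. cnj (u (fst p)) * relation_matrix R (fst p) (snd p) * v (snd p))"
      by (simp add: trunc_form_def sum.cartesian_product case_prod_unfold)
    also have "\<dots> = (\<Sum>p\<in>Q. cnj (u (fst p)) * v (snd p))"
      unfolding Q_def by (rule sum.mono_neutral_cong_right) (auto simp: relation_matrix_def)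
    also have "cmod \<dots> \<le> (\<Sum>p\<in>Q. \<bar>cmod (u (fst p))\<bar> * \<bar>cmod (v (snd p))\<bar>)"
      by (rule order_trans[OF norm_sum]) (simp add: norm_mult)
    also have "\<dots> \<le> L2_set (\<lambda>p. cmod (u (fst p))) Q * L2_set (\<lambda>p. cmod (v (snd p))) Q"
      by (rule L2_set_mult_ineq)
    also have "\<dots> \<le> trunc_norm n u * trunc_norm n v"
    proof (rule mult_mono)
      have "(\<Sum>p\<in>Q. (cmod (u (fst p)))\<^sup>2) = (\<Sum>i\<in>fst ` Q. (cmod (u i))\<^sup>2)"
        using Q by (simp add: sum.reindex)
      also have "\<dots> \<le> (\<Sum>i<n. (cmod (u i))\<^sup>2)"
        by (rule sum_mono2) (auto simp: Q_def)
      finally show "L2_set (\<lambda>p. cmod (u (fst p))) Q \<le> trunc_norm n u" by (simp add: L2_set_def)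
      have "(\<Sum>p\<in>Q. (cmod (v (snd p)))\<^sup>2) = (\<Sum>i\<in>snd ` Q. (cmod (v i))\<^sup>2)"
        using Q by (simp add: sum.reindex)
      also have "\<dots> \<le> (\<Sum>i<n. (cmod (v i))\<^sup>2)"
        by (rule sum_mono2) (auto simp: Q_def)
      finally show "L2_set (\<lambda>p. cmod (v (snd p))) Q \<le> trunc_norm n v" by (simp add: L2_set_def)
    qed auto
    finally show ?thesis .
  qed
  then show ?thesis by (simp add: form_bound_def)
qed

text \<open>A row of the left matrix has at most one nonzero entry, so the series has at most one
  nonzero term.\<close>

lemma relation_matrix_mult:
  assumes "partial_injection R"
  shows "matrix_mult (relation_matrix R) (relation_matrix Q) = relation_matrix (R O Q)"
proof (intro ext)
  fix i j
  show "matrix_mult (relation_matrix R) (relation_matrix Q) i j = relation_matrix (R O Q) i j"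
  proof (cases "\<exists>l. (i, l) \<in> R")
    case True
    then obtain l where l: "(i, l) \<in> R" by blast
    have row: "(i, l') \<in> R \<longleftrightarrow> l' = l" for l' using l partial_injectionD(1)[OF assms l] by blast
    have "(\<lambda>l'. relation_matrix R i l' * relation_matrix Q l' j) =
        (\<lambda>l'. if l' = l then relation_matrix Q l j else 0)"
      by (rule ext) (simp add: relation_matrix_def row)
    then have "matrix_mult (relation_matrix R) (relation_matrix Q) i j = relation_matrix Q l j"
      by (simp only: matrix_mult_def sums_unique[OF sums_single, symmetric])
    also have "\<dots> = relation_matrix (R O Q) i j"
      by (simp add: relation_matrix_def relcomp_unfold row)
    finally show ?thesis .
  next
    case False
    then have "(i, j) \<notin> R O Q" by blast
    then show ?thesis using False by (simp add: matrix_mult_def relation_matrix_def)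
  qed
qed

lemma relation_matrix_adj: "matrix_adj (relation_matrix R) = relation_matrix (R\<inverse>)"
  by (simp add: matrix_adj_def relation_matrix_def fun_eq_iff)

abbreviation relation_op :: "(nat \<times> nat) set \<Rightarrow> nat \<Rightarrow> complex" where
  "relation_op R \<equiv> of_entries (relation_matrix R)"

lemma relation_op_closed: "partial_injection R \<Longrightarrow> relation_op R \<in> carrier l2_algebra"
  using relation_matrix_bound by (auto simp: l2_simps bounded_matrix_def)

lemma relation_op_mult:
  "partial_injection R \<Longrightarrow> relation_op R \<otimes>\<^bsub>l2_algebra\<^esub> relation_op Q = relation_op (R O Q)"
  by (simp add: l2_simps relation_matrix_mult)

lemma relation_op_adj: "cadj l2_algebra (relation_op R) = relation_op (R\<inverse>)"
  by (simp add: l2_simps relation_matrix_adj)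

lemma partial_injection_converse: "partial_injection R \<Longrightarrow> partial_injection (R\<inverse>)"
  by (simp add: partial_injection_def)

lemma partial_injection_comp: "\<lbrakk>partial_injection R; partial_injection Q\<rbrakk> \<Longrightarrow> partial_injection (R O Q)"
  unfolding partial_injection_def converse_relcomp by (blast intro: single_valued_relcomp)

lemma relation_op_finsum:
  assumes "finite I" "\<And>i. i \<in> I \<Longrightarrow> partial_injection (R i)" "disjoint_family_on R I"
  shows "finsum l2_algebra (\<lambda>i. relation_op (R i)) I = relation_op (\<Union>i\<in>I. R i)"
  using assms
proof (induction I rule: finite_induct)
  interpret cstar_algebra l2_algebra by (rule l2_cstar_algebra)
  case empty
  show ?case by (intro entry_eqI) (simp add: l2_simps relation_matrix_def fun_eq_iff)
next
  interpret cstar_algebra l2_algebra by (rule l2_cstar_algebra)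
  case (insert i I)
  have disj: "R i \<inter> (\<Union>i\<in>I. R i) = {}" "disjoint_family_on R I"
    using insert by (auto simp: disjoint_family_on_def)
  have "relation_op (R i) \<oplus>\<^bsub>l2_algebra\<^esub> relation_op (\<Union>i\<in>I. R i) = relation_op (\<Union>i\<in>insert i I. R i)"
    using disj by (intro entry_eqI) (auto simp: l2_simps relation_matrix_def fun_eq_iff)
  then show ?case
    using insert disj by (simp add: relation_op_closed)
qed

section \<open>The relations defined by an infinite path\<close>

locale infinite_path = kgraph k \<Lambda> for k and \<Lambda> :: "'g kgraph" +
  fixes y :: "'g ipath"
  assumes y: "y \<in> infinite_paths k \<Lambda>"
begin

lemma
  assumes "p \<in> Nk k" "q \<in> Nk k" "p \<le> q"
  shows y_mor [simp]: "y (p, q) \<in> mor \<Lambda>"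
    and y_rng [simp]: "rng \<Lambda> (y (p, q)) = y (p, p)"
    and y_src [simp]: "src \<Lambda> (y (p, q)) = y (q, q)"
    and y_deg [simp]: "deg \<Lambda> (y (p, q)) = q - p"
proof -
  have "kgraph_morphism (Omega k) \<Lambda> y" using y by (simp add: infinite_paths_def)
  moreover have "(p, q) \<in> mor (Omega k)" using assms by (simp add: Omega_def)
  ultimately have "y (p, q) \<in> mor \<Lambda> \<and> rng \<Lambda> (y (p, q)) = y (rng (Omega k) (p, q)) \<and>
      src \<Lambda> (y (p, q)) = y (src (Omega k) (p, q)) \<and> deg \<Lambda> (y (p, q)) = deg (Omega k) (p, q)"
    unfolding kgraph_morphism_def by blast
  then show "y (p, q) \<in> mor \<Lambda>" "rng \<Lambda> (y (p, q)) = y (p, p)" "src \<Lambda> (y (p, q)) = y (q, q)"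
    "deg \<Lambda> (y (p, q)) = q - p" by (simp_all add: Omega_def)
qed

lemma y_comp:
  assumes "p \<in> Nk k" "q \<in> Nk k" "r \<in> Nk k" "p \<le> q" "q \<le> r"
  shows "composite \<Lambda> (y (p, q)) (y (q, r)) = y (p, r)"
proof -
  have "kgraph_morphism (Omega k) \<Lambda> y" using y by (simp add: infinite_paths_def)
  moreover have "(p, q) \<in> mor (Omega k)" "(q, r) \<in> mor (Omega k)"
    "src (Omega k) (p, q) = rng (Omega k) (q, r)" "composite (Omega k) (p, q) (q, r) = (p, r)"
    using assms by (auto simp: Omega_def)
  ultimately show ?thesis unfolding kgraph_morphism_def by metis
qed

definition nodes :: "('g \<times> (nat \<Rightarrow> nat)) set" where
  "nodes = {(\<eta>, m). \<eta> \<in> mor \<Lambda> \<and> m \<in> Nk k \<and> src \<Lambda> \<eta> = y (m, m)}"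

text \<open>
  The pair \<open>(\<eta>, m)\<close> stands for the path \<open>\<eta>\<close> followed by the tail of \<open>y\<close> from \<open>m\<close>, together with
  the lag \<open>deg \<eta> - m\<close>.
\<close>

definition extend :: "'g \<times> (nat \<Rightarrow> nat) \<Rightarrow> (nat \<Rightarrow> nat) \<Rightarrow> 'g" where
  "extend x n = composite \<Lambda> (fst x) (y (snd x, n))"

text \<open>Two nodes are identified when prolonging them along \<open>y\<close> up to a common
  degree gives the same finite path. Comparing degrees shows that equivalent nodes have the same
  lag.\<close>

definition tail_equiv :: "(('g \<times> (nat \<Rightarrow> nat)) \<times> ('g \<times> (nat \<Rightarrow> nat))) set" where
  "tail_equiv = {(a, b). a \<in> nodes \<and> b \<in> nodes \<and>
     (\<exists>n \<in> Nk k. snd a \<le> n \<and> snd b \<le> n \<and> extend a n = extend b n)}"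

lemma nodesD:
  assumes "a \<in> nodes"
  shows "fst a \<in> mor \<Lambda>" "snd a \<in> Nk k" "src \<Lambda> (fst a) = y (snd a, snd a)"
  using assms by (auto simp: nodes_def)

lemma sup_Nk: "\<lbrakk>m \<in> Nk k; n \<in> Nk k\<rbrakk> \<Longrightarrow> sup m n \<in> Nk k"
  by (simp add: Nk_def)

lemma extend_mor:
  assumes "a \<in> nodes" "n \<in> Nk k" "snd a \<le> n"
  shows "extend a n \<in> mor \<Lambda>" "rng \<Lambda> (extend a n) = rng \<Lambda> (fst a)" "src \<Lambda> (extend a n) = y (n, n)"
  using nodesD[OF assms(1)] assms(2,3) by (simp_all add: extend_def)

lemma extend_extend:
  assumes "a \<in> nodes" "n \<in> Nk k" "N \<in> Nk k" "snd a \<le> n" "n \<le> N"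
  shows "extend a N = composite \<Lambda> (extend a n) (y (n, N))"
proof -
  have "snd a \<le> N" using assms order_trans by blast
  then have "extend a N = composite \<Lambda> (fst a) (composite \<Lambda> (y (snd a, n)) (y (n, N)))"
    using nodesD[OF assms(1)] assms(2-) by (simp add: extend_def y_comp)
  then show ?thesis
    using nodesD[OF assms(1)] assms(2-) by (simp add: extend_def comp_assoc)
qed

text \<open>Agreement at one degree persists at all larger ones, since both sides are prolonged by
  the same piece of \<open>y\<close>.\<close>

lemma tail_equivE:
  assumes "(a, b) \<in> tail_equiv"
  obtains n where "n \<in> Nk k" "snd a \<le> n" "snd b \<le> n"
    "\<forall>N \<in> Nk k. n \<le> N \<longrightarrow> extend a N = extend b N"
proof -
  obtain n where n: "n \<in> Nk k" "snd a \<le> n" "snd b \<le> n" "extend a n = extend b n"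
    and ab: "a \<in> nodes" "b \<in> nodes"
    using assms by (auto simp: tail_equiv_def)
  have "extend a N = extend b N" if "N \<in> Nk k" "n \<le> N" for N
    using extend_extend[OF ab(1) n(1) that(1) n(2) that(2)] extend_extend[OF ab(2) n(1) that(1) n(3) that(2)] n(4) by simp
  then show ?thesis using n that by blast
qed

lemma equiv_tail: "equiv nodes tail_equiv"
proof (rule equivI)
  show "tail_equiv \<subseteq> nodes \<times> nodes" by (auto simp: tail_equiv_def)
  show "refl_on nodes tail_equiv"
    by (rule refl_onI) (use nodesD(2) in \<open>auto simp: tail_equiv_def intro!: bexI\<close>)
  show "sym tail_equiv" by (rule symI) (auto simp: tail_equiv_def)
  show "trans tail_equiv"
  proof (rule transI)
    fix a b c assume ab: "(a, b) \<in> tail_equiv" and bc: "(b, c) \<in> tail_equiv"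
    obtain n where n: "n \<in> Nk k" "snd a \<le> n" "snd b \<le> n"
      "\<forall>N \<in> Nk k. n \<le> N \<longrightarrow> extend a N = extend b N" using tail_equivE[OF ab] .
    obtain n' where n': "n' \<in> Nk k" "snd b \<le> n'" "snd c \<le> n'"
      "\<forall>N \<in> Nk k. n' \<le> N \<longrightarrow> extend b N = extend c N" using tail_equivE[OF bc] .
    have "extend a (sup n n') = extend c (sup n n')"
      using n(4) n'(4) sup_Nk[OF n(1) n'(1)] by simp
    moreover have "snd a \<le> sup n n'" "snd c \<le> sup n n'"
      using n(2) n'(3) by (auto intro: le_supI1 le_supI2)
    ultimately show "(a, c) \<in> tail_equiv"
      using ab bc sup_Nk[OF n(1) n'(1)] by (auto simp: tail_equiv_def)
  qed
qed

text \<open>The classes of nodes index the basis vectors; numbers that belong to no class carry only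
  zero entries.\<close>

definition idx :: "'g \<times> (nat \<Rightarrow> nat) \<Rightarrow> nat" where
  "idx a = to_nat_on (nodes // tail_equiv) (tail_equiv `` {a})"

lemma countable_nodes: "countable nodes"
proof (rule countableI')
  \<comment> \<open>The second component \<open>m\<close> is encoded by the path
    \<open>y (0, m)\<close>, whose degree is \<open>m\<close>; thus both components live in the
    countable set of morphisms.\<close>
  let ?f = "\<lambda>(\<eta>, m). (to_nat_on (mor \<Lambda>) \<eta>, to_nat_on (mor \<Lambda>) (y (0, m)))"
  have inj: "inj_on (to_nat_on (mor \<Lambda>)) (mor \<Lambda>)" using countable_mor by (rule inj_on_to_nat_on)
  have deg_inj: "m = m'" if "m \<in> Nk k" "m' \<in> Nk k" "y (0, m) = y (0, m')" for m m'
    using y_deg[of 0 m] y_deg[of 0 m'] that by (simp add: le_fun_def fun_eq_iff)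
  show "inj_on ?f nodes"
  proof (rule inj_onI, rule prod_eqI)
    fix a b assume ab: "a \<in> nodes" "b \<in> nodes" "?f a = ?f b"
    note a = nodesD(1,2)[OF ab(1)] and b = nodesD(1,2)[OF ab(2)]
    show "fst a = fst b" using ab(3) a b by (intro inj_onD[OF inj]) (simp_all add: case_prod_unfold)
    have "y (0, snd a) = y (0, snd b)"
      using ab(3) a b by (intro inj_onD[OF inj]) (simp_all add: case_prod_unfold le_fun_def)
    then show "snd a = snd b" using a(2) b(2) by (rule deg_inj[rotated 2])
  qed
qed

lemma idx_eq_iff:
  assumes "a \<in> nodes" "b \<in> nodes"
  shows "idx a = idx b \<longleftrightarrow> (a, b) \<in> tail_equiv"
proof -
  have "countable (nodes // tail_equiv)"
    using countable_nodes by (auto simp: quotient_def)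
  then have inj: "inj_on (to_nat_on (nodes // tail_equiv)) (nodes // tail_equiv)" by (rule inj_on_to_nat_on)
  have "tail_equiv `` {a} \<in> nodes // tail_equiv" "tail_equiv `` {b} \<in> nodes // tail_equiv"
    unfolding quotient_def using assms by blast+
  then have "idx a = idx b \<longleftrightarrow> tail_equiv `` {a} = tail_equiv `` {b}"
    unfolding idx_def by (rule inj_on_eq_iff[OF inj])
  also have "\<dots> \<longleftrightarrow> (a, b) \<in> tail_equiv"
    using Equiv_Relations.eq_equiv_class_iff[OF equiv_tail assms] .
  finally show ?thesis .
qed

lemma comp_node:
  assumes "\<kappa> \<in> mor \<Lambda>" "a \<in> nodes" "src \<Lambda> \<kappa> = rng \<Lambda> (fst a)"
  shows "(composite \<Lambda> \<kappa> (fst a), snd a) \<in> nodes"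
    "\<lbrakk>n \<in> Nk k; snd a \<le> n\<rbrakk> \<Longrightarrow> extend (composite \<Lambda> \<kappa> (fst a), snd a) n = composite \<Lambda> \<kappa> (extend a n)"
  using assms nodesD[OF assms(2)] by (auto simp: nodes_def extend_def comp_assoc)

lemma idx_rng:
  assumes "a \<in> nodes" "b \<in> nodes" "idx a = idx b"
  shows "rng \<Lambda> (fst a) = rng \<Lambda> (fst b)"
proof -
  have "(a, b) \<in> tail_equiv" using assms by (simp add: idx_eq_iff)
  then obtain n where "n \<in> Nk k" "snd a \<le> n" "snd b \<le> n" "extend a n = extend b n"
    by (auto simp: tail_equiv_def)
  then show ?thesis using extend_mor(2)[OF assms(1)] extend_mor(2)[OF assms(2)] by metis
qed

text \<open>After prolongation this is unique factorization. It makes prefixing by \<kappa>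
  injective on classes and gives disjoint images to different prefixes of one degree.\<close>

lemma idx_comp_iff:
  assumes \<kappa>: "\<kappa> \<in> mor \<Lambda>" "\<kappa>' \<in> mor \<Lambda>" "deg \<Lambda> \<kappa> = deg \<Lambda> \<kappa>'"
    and a: "a \<in> nodes" "src \<Lambda> \<kappa> = rng \<Lambda> (fst a)" and b: "b \<in> nodes" "src \<Lambda> \<kappa>' = rng \<Lambda> (fst b)"
  shows "idx (composite \<Lambda> \<kappa> (fst a), snd a) = idx (composite \<Lambda> \<kappa>' (fst b), snd b) \<longleftrightarrow>
    \<kappa> = \<kappa>' \<and> idx a = idx b"
proof -
  have "extend (composite \<Lambda> \<kappa> (fst a), snd a) n = extend (composite \<Lambda> \<kappa>' (fst b), snd b) n \<longleftrightarrow>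
      \<kappa> = \<kappa>' \<and> extend a n = extend b n" if n: "n \<in> Nk k" "snd a \<le> n" "snd b \<le> n" for n
  proof -
    have "src \<Lambda> \<kappa> = rng \<Lambda> (extend a n)" "src \<Lambda> \<kappa>' = rng \<Lambda> (extend b n)"
      using extend_mor(2) n a b by auto
    then show ?thesis
      unfolding comp_node(2)[OF \<kappa>(1) a n(1,2)] comp_node(2)[OF \<kappa>(2) b n(1,3)]
      using factor_unique[of \<kappa> "extend a n" \<kappa>' "extend b n"] \<kappa> extend_mor(1)[OF a(1) n(1,2)]
        extend_mor(1)[OF b(1) n(1,3)] by metis
  qed
  moreover note comp_node(1)[OF \<kappa>(1) a] comp_node(1)[OF \<kappa>(2) b]
  ultimately show ?thesis
    using a(1) b(1) by (auto simp: idx_eq_iff tail_equiv_def)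
qed

text \<open>The column index is a node and the row index the same node prefixed by \<kappa>, so the
  matrix sends the first basis vector to the second.\<close>

definition step_rel :: "'g \<Rightarrow> (nat \<times> nat) set" where
  "step_rel \<kappa> = {(idx (composite \<Lambda> \<kappa> (fst a), snd a), idx a) | a. a \<in> nodes \<and> src \<Lambda> \<kappa> = rng \<Lambda> (fst a)}"

lemma step_relI:
  "\<lbrakk>a \<in> nodes; src \<Lambda> \<kappa> = rng \<Lambda> (fst a)\<rbrakk> \<Longrightarrow> (idx (composite \<Lambda> \<kappa> (fst a), snd a), idx a) \<in> step_rel \<kappa>"
  unfolding step_rel_def by blast

lemma step_relE:
  assumes "(i, j) \<in> step_rel \<kappa>"
  obtains a where "a \<in> nodes" "src \<Lambda> \<kappa> = rng \<Lambda> (fst a)"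
    "i = idx (composite \<Lambda> \<kappa> (fst a), snd a)" "j = idx a"
  using assms unfolding step_rel_def by blast

lemma step_rel_injection:
  assumes "\<kappa> \<in> mor \<Lambda>"
  shows "partial_injection (step_rel \<kappa>)"
  unfolding partial_injection_def single_valued_def
  using idx_comp_iff[OF assms assms refl] by (auto elim!: step_relE)

lemma step_rel_comp:
  assumes "\<kappa> \<in> mor \<Lambda>" "\<sigma> \<in> mor \<Lambda>" "src \<Lambda> \<kappa> = rng \<Lambda> \<sigma>"
  shows "step_rel \<kappa> O step_rel \<sigma> = step_rel (composite \<Lambda> \<kappa> \<sigma>)"
proof -
  have assoc: "composite \<Lambda> (composite \<Lambda> \<kappa> \<sigma>) (fst b) = composite \<Lambda> \<kappa> (composite \<Lambda> \<sigma> (fst b))"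
    if "b \<in> nodes" "src \<Lambda> \<sigma> = rng \<Lambda> (fst b)" for b
    using assms that nodesD[OF that(1)] by (simp add: comp_assoc)
  have node: "(composite \<Lambda> \<sigma> (fst b), snd b) \<in> nodes" "rng \<Lambda> (composite \<Lambda> \<sigma> (fst b)) = rng \<Lambda> \<sigma>"
    if "b \<in> nodes" "src \<Lambda> \<sigma> = rng \<Lambda> (fst b)" for b
    using comp_node(1)[OF assms(2) that] nodesD[OF that(1)] that assms(2) by auto
  show ?thesis
  proof (intro subset_antisym subrelI)
    fix i j assume "(i, j) \<in> step_rel \<kappa> O step_rel \<sigma>"
    then obtain l where "(i, l) \<in> step_rel \<kappa>" "(l, j) \<in> step_rel \<sigma>" by blast
    then obtain a b where a: "a \<in> nodes" "src \<Lambda> \<kappa> = rng \<Lambda> (fst a)"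
        "i = idx (composite \<Lambda> \<kappa> (fst a), snd a)" "l = idx a"
      and b: "b \<in> nodes" "src \<Lambda> \<sigma> = rng \<Lambda> (fst b)"
        "l = idx (composite \<Lambda> \<sigma> (fst b), snd b)" "j = idx b"
      by (meson step_relE)
    have "i = idx (composite \<Lambda> (composite \<Lambda> \<kappa> \<sigma>) (fst b), snd b)"
      using idx_comp_iff[OF assms(1,1) refl a(1,2) node(1)[OF b(1,2)]] assms(3) node(2)[OF b(1,2)]
        a(3,4) b(3) assoc[OF b(1,2)] by simp
    then show "(i, j) \<in> step_rel (composite \<Lambda> \<kappa> \<sigma>)"
      using step_relI[of b "composite \<Lambda> \<kappa> \<sigma>"] b assms by simp
  next
    fix i j assume "(i, j) \<in> step_rel (composite \<Lambda> \<kappa> \<sigma>)"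
    then obtain b where b: "b \<in> nodes" "src \<Lambda> \<sigma> = rng \<Lambda> (fst b)"
        "i = idx (composite \<Lambda> (composite \<Lambda> \<kappa> \<sigma>) (fst b), snd b)" "j = idx b"
      using assms by (auto elim: step_relE)
    show "(i, j) \<in> step_rel \<kappa> O step_rel \<sigma>"
      using step_relI[OF node(1)[OF b(1,2)], of \<kappa>] step_relI[OF b(1,2)] node(2)[OF b(1,2)] assms(3)
        assoc[OF b(1,2)] b(3,4) by auto
  qed
qed

lemma step_rel_vertex:
  assumes "v \<in> vertices \<Lambda>"
  shows "step_rel v = {(idx a, idx a) | a. a \<in> nodes \<and> rng \<Lambda> (fst a) = v}"
proof -
  have "composite \<Lambda> v (fst a) = fst a" if "a \<in> nodes" "rng \<Lambda> (fst a) = v" for a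
    using comp_id_left[OF nodesD(1)[OF that(1)]] that by simp
  then show ?thesis using assms unfolding step_rel_def by force
qed

lemma step_rel_source:
  assumes "\<kappa> \<in> mor \<Lambda>"
  shows "(step_rel \<kappa>)\<inverse> O step_rel \<kappa> = step_rel (src \<Lambda> \<kappa>)"
proof -
  have "(step_rel \<kappa>)\<inverse> O step_rel \<kappa> = {(idx a, idx a) | a. a \<in> nodes \<and> rng \<Lambda> (fst a) = src \<Lambda> \<kappa>}"
  proof (intro subset_antisym subrelI)
    fix i j assume "(i, j) \<in> (step_rel \<kappa>)\<inverse> O step_rel \<kappa>"
    then obtain l where ij: "(l, i) \<in> step_rel \<kappa>" "(l, j) \<in> step_rel \<kappa>" by blast
    have "i = j" using ij partial_injectionD(1)[OF step_rel_injection[OF assms]] by blast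
    moreover obtain a where "a \<in> nodes" "src \<Lambda> \<kappa> = rng \<Lambda> (fst a)" "i = idx a"
      using ij(1) by (rule step_relE)
    ultimately show "(i, j) \<in> {(idx a, idx a) | a. a \<in> nodes \<and> rng \<Lambda> (fst a) = src \<Lambda> \<kappa>}"
      by (intro CollectI exI[of _ a]) simp
  next
    fix i j assume "(i, j) \<in> {(idx a, idx a) | a. a \<in> nodes \<and> rng \<Lambda> (fst a) = src \<Lambda> \<kappa>}"
    then obtain a where "a \<in> nodes" "src \<Lambda> \<kappa> = rng \<Lambda> (fst a)" "i = idx a" "j = idx a" by auto
    then show "(i, j) \<in> (step_rel \<kappa>)\<inverse> O step_rel \<kappa>"
      using step_relI[of a \<kappa>] by auto
  qed
  then show ?thesis using assms by (simp add: step_rel_vertex)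
qed

lemma step_rel_range:
  assumes "\<kappa> \<in> mor \<Lambda>"
  shows "step_rel \<kappa> O (step_rel \<kappa>)\<inverse> = {(idx (composite \<Lambda> \<kappa> (fst a), snd a), idx (composite \<Lambda> \<kappa> (fst a), snd a))
    | a. a \<in> nodes \<and> src \<Lambda> \<kappa> = rng \<Lambda> (fst a)}"
proof (intro subset_antisym subrelI)
  fix i j assume "(i, j) \<in> step_rel \<kappa> O (step_rel \<kappa>)\<inverse>"
  then obtain l where ij: "(i, l) \<in> step_rel \<kappa>" "(j, l) \<in> step_rel \<kappa>" by blast
  have "i = j" using ij partial_injectionD(2)[OF step_rel_injection[OF assms]] by blast
  moreover obtain a where "a \<in> nodes" "src \<Lambda> \<kappa> = rng \<Lambda> (fst a)"
    "i = idx (composite \<Lambda> \<kappa> (fst a), snd a)"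
    using ij(1) by (rule step_relE)
  ultimately show "(i, j) \<in> {(idx (composite \<Lambda> \<kappa> (fst a), snd a), idx (composite \<Lambda> \<kappa> (fst a), snd a))
      | a. a \<in> nodes \<and> src \<Lambda> \<kappa> = rng \<Lambda> (fst a)}"
    by blast
next
  fix i j assume "(i, j) \<in> {(idx (composite \<Lambda> \<kappa> (fst a), snd a), idx (composite \<Lambda> \<kappa> (fst a), snd a))
      | a. a \<in> nodes \<and> src \<Lambda> \<kappa> = rng \<Lambda> (fst a)}"
  then obtain a where "a \<in> nodes" "src \<Lambda> \<kappa> = rng \<Lambda> (fst a)"
    "i = idx (composite \<Lambda> \<kappa> (fst a), snd a)" "j = idx (composite \<Lambda> \<kappa> (fst a), snd a)" by auto
  then show "(i, j) \<in> step_rel \<kappa> O (step_rel \<kappa>)\<inverse>"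
    using step_relI[of a \<kappa>] by auto
qed

text \<open>Every class has a representative that starts with a path of degree \<open>n\<close>:
  prolong the node along \<open>y\<close> by \<open>n\<close> and split off an initial part of that
  degree.\<close>

lemma step_rel_sum:
  assumes v: "v \<in> vertices \<Lambda>" and n: "n \<in> Nk k"
  shows "step_rel v = (\<Union>\<kappa>\<in>{\<kappa> \<in> paths_deg \<Lambda> n. rng \<Lambda> \<kappa> = v}. step_rel \<kappa> O (step_rel \<kappa>)\<inverse>)"
proof (intro subset_antisym subsetI)
  fix p assume "p \<in> step_rel v"
  then obtain a where a: "a \<in> nodes" "rng \<Lambda> (fst a) = v" "p = (idx a, idx a)"
    unfolding step_rel_vertex[OF v] by blast
  define m where "m = snd a"
  have m: "m \<in> Nk k" "m \<le> m + n" "m + n \<in> Nk k"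
    using nodesD[OF a(1)] n by (auto simp: m_def le_fun_def)
  have am: "fst a \<in> mor \<Lambda>" "src \<Lambda> (fst a) = y (m, m)" using nodesD[OF a(1)] by (auto simp: m_def)
  \<comment> \<open>Prolonging by \<open>n\<close> makes room for a first factor of degree
    \<open>n\<close>, whatever the degree of the node.\<close>
  have "deg \<Lambda> (extend a (m + n)) = n + deg \<Lambda> (fst a)"
    using am m by (simp add: extend_def m_def[symmetric] deg_comp add.commute)
  then obtain \<kappa> \<eta> where f: "\<kappa> \<in> mor \<Lambda>" "\<eta> \<in> mor \<Lambda>" "src \<Lambda> \<kappa> = rng \<Lambda> \<eta>"
    "composite \<Lambda> \<kappa> \<eta> = extend a (m + n)" "deg \<Lambda> \<kappa> = n"
    using factorE[of "extend a (m + n)" n "deg \<Lambda> (fst a)"] extend_mor(1)[OF a(1) m(3)] m(2) n deg_Nk am(1)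
    unfolding m_def by metis
  have rs: "rng \<Lambda> \<kappa> = v" "src \<Lambda> \<eta> = y (m + n, m + n)"
    using f rng_comp[OF f(1-3)] src_comp[OF f(1-3)] extend_mor(2,3)[OF a(1) m(3)] m(2) a(2)
    unfolding m_def by auto
  have b: "(\<eta>, m + n) \<in> nodes" using f rs m by (simp add: nodes_def)
  then have kb: "(composite \<Lambda> \<kappa> \<eta>, m + n) \<in> nodes" using comp_node(1)[OF f(1) b] f(3) by simp
  \<comment> \<open>The node with the larger second component represents the old class, since both
    prolong to the same path at \<open>m + n\<close>.\<close>
  have "extend (composite \<Lambda> \<kappa> \<eta>, m + n) (m + n) = extend a (m + n)"
    using f(1-3) rs(2) comp_id_right[OF comp_closed[OF f(1-3)]]
    by (simp add: f(4)[symmetric]) (simp add: extend_def)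
  then have "(a, (composite \<Lambda> \<kappa> \<eta>, m + n)) \<in> tail_equiv"
    using a(1) kb m by (auto simp: tail_equiv_def m_def)
  then have "idx a = idx (composite \<Lambda> \<kappa> \<eta>, m + n)" using a(1) kb by (simp add: idx_eq_iff)
  then have "p \<in> step_rel \<kappa> O (step_rel \<kappa>)\<inverse>"
    unfolding step_rel_range[OF f(1)] using a(3) b f(3) by force
  moreover have "\<kappa> \<in> {\<kappa> \<in> paths_deg \<Lambda> n. rng \<Lambda> \<kappa> = v}" using f rs by (simp add: paths_deg_def)
  ultimately show "p \<in> (\<Union>\<kappa>\<in>{\<kappa> \<in> paths_deg \<Lambda> n. rng \<Lambda> \<kappa> = v}. step_rel \<kappa> O (step_rel \<kappa>)\<inverse>)" by blast
next
  fix p assume "p \<in> (\<Union>\<kappa>\<in>{\<kappa> \<in> paths_deg \<Lambda> n. rng \<Lambda> \<kappa> = v}. step_rel \<kappa> O (step_rel \<kappa>)\<inverse>)"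
  then obtain \<kappa> a where \<kappa>: "\<kappa> \<in> mor \<Lambda>" "rng \<Lambda> \<kappa> = v" and a: "a \<in> nodes" "src \<Lambda> \<kappa> = rng \<Lambda> (fst a)"
    and p: "p = (idx (composite \<Lambda> \<kappa> (fst a), snd a), idx (composite \<Lambda> \<kappa> (fst a), snd a))"
    using step_rel_range by (auto simp: paths_deg_def)
  show "p \<in> step_rel v"
    unfolding step_rel_vertex[OF v]
    using p comp_node(1)[OF \<kappa>(1) a] \<kappa> a nodesD(1)[OF a(1)]
    by (intro CollectI exI[of _ "(composite \<Lambda> \<kappa> (fst a), snd a)"]) simp
qed

theorem path_family:
  assumes "finite_kgraph k \<Lambda>"
  shows "cuntz_krieger_family k \<Lambda> l2_algebra (\<lambda>\<kappa>. relation_op (step_rel \<kappa>))"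
proof -
  have R: "partial_injection (step_rel \<kappa>)" if "\<kappa> \<in> mor \<Lambda>" for \<kappa>
    using step_rel_injection that .
  have vertex_sym: "(step_rel v)\<inverse> = step_rel v" if "v \<in> vertices \<Lambda>" for v
    using step_rel_vertex[OF that] by auto
  have vertex_idem: "step_rel v O step_rel v = step_rel v" if "v \<in> vertices \<Lambda>" for v
    using step_rel_comp[of v v] comp_id_left[of v] that by simp
  have range_idem: "step_rel \<kappa> O (step_rel \<kappa>)\<inverse> O step_rel \<kappa> = step_rel \<kappa>" if "\<kappa> \<in> mor \<Lambda>" for \<kappa>
    unfolding step_rel_source[OF that] using step_rel_comp[of \<kappa> "src \<Lambda> \<kappa>"] comp_id_right[OF that] that by simp
  show ?thesis
    unfolding cuntz_krieger_family_def
  proof (intro conjI ballI impI)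
    fix \<kappa> assume \<kappa>: "\<kappa> \<in> mor \<Lambda>"
    show "is_partial_isometry l2_algebra (relation_op (step_rel \<kappa>))"
      using R[OF \<kappa>] range_idem[OF \<kappa>] unfolding is_partial_isometry_def
      by (simp add: relation_op_closed relation_op_adj relation_op_mult partial_injection_comp
          partial_injection_converse O_assoc)
    show "cadj l2_algebra (relation_op (step_rel \<kappa>)) \<otimes>\<^bsub>l2_algebra\<^esub> relation_op (step_rel \<kappa>) =
        relation_op (step_rel (src \<Lambda> \<kappa>))"
      using R[OF \<kappa>] step_rel_source[OF \<kappa>]
      by (simp add: relation_op_adj relation_op_mult partial_injection_converse)
  next
    fix v assume v: "v \<in> vertices \<Lambda>"
    show "is_projection l2_algebra (relation_op (step_rel v))"
      using R[of v] v unfolding is_projection_def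
      by (simp add: relation_op_closed relation_op_adj relation_op_mult vertex_sym vertex_idem)
    fix w assume w: "w \<in> vertices \<Lambda>" "v \<noteq> w"
    have "step_rel v O step_rel w = {}"
    proof (rule equals0I)
      fix p assume "p \<in> step_rel v O step_rel w"
      then obtain i l j where "(i, l) \<in> step_rel v" "(l, j) \<in> step_rel w" by blast
      then obtain a b where "a \<in> nodes" "rng \<Lambda> (fst a) = v" "l = idx a"
        "b \<in> nodes" "rng \<Lambda> (fst b) = w" "l = idx b"
        unfolding step_rel_vertex[OF v] step_rel_vertex[OF w(1)] by blast
      then show False using idx_rng[of a b] w(2) by simp
    qed
    then show "relation_op (step_rel v) \<otimes>\<^bsub>l2_algebra\<^esub> relation_op (step_rel w) = \<zero>\<^bsub>l2_algebra\<^esub>"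
      using R[of v] v by (intro entry_eqI) (simp add: relation_op_mult, simp add: l2_simps relation_matrix_def fun_eq_iff)
  next
    fix \<mu> \<kappa> assume "\<mu> \<in> mor \<Lambda>" "\<kappa> \<in> mor \<Lambda>" "src \<Lambda> \<mu> = rng \<Lambda> \<kappa>"
    then show "relation_op (step_rel \<mu>) \<otimes>\<^bsub>l2_algebra\<^esub> relation_op (step_rel \<kappa>) =
        relation_op (step_rel (composite \<Lambda> \<mu> \<kappa>))"
      by (simp add: relation_op_mult R step_rel_comp)
  next
    fix v n assume v: "v \<in> vertices \<Lambda>" and n: "n \<in> Nk k"
    define I where "I = {\<kappa> \<in> paths_deg \<Lambda> n. rng \<Lambda> \<kappa> = v}"
    have I: "\<kappa> \<in> mor \<Lambda>" "deg \<Lambda> \<kappa> = n" if "\<kappa> \<in> I" for \<kappa>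
      using that by (auto simp: I_def paths_deg_def)
    have fin: "finite I" using assms n by (auto simp: I_def finite_kgraph_def)
    interpret cstar_algebra l2_algebra by (rule l2_cstar_algebra)
    have "disjoint_family_on (\<lambda>\<kappa>. step_rel \<kappa> O (step_rel \<kappa>)\<inverse>) I"
      unfolding disjoint_family_on_def
    proof (intro ballI impI equals0I)
      fix \<kappa> \<kappa>' p assume \<kappa>: "\<kappa> \<in> I" "\<kappa>' \<in> I" "\<kappa> \<noteq> \<kappa>'"
        and "p \<in> step_rel \<kappa> O (step_rel \<kappa>)\<inverse> \<inter> step_rel \<kappa>' O (step_rel \<kappa>')\<inverse>"
      then obtain a b where "a \<in> nodes" "src \<Lambda> \<kappa> = rng \<Lambda> (fst a)" "b \<in> nodes" "src \<Lambda> \<kappa>' = rng \<Lambda> (fst b)"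
        "idx (composite \<Lambda> \<kappa> (fst a), snd a) = idx (composite \<Lambda> \<kappa>' (fst b), snd b)"
        using step_rel_range I by auto
      then show False using idx_comp_iff[of \<kappa> \<kappa>' a b] \<kappa> I by simp
    qed
    then have "finsum l2_algebra (\<lambda>\<kappa>. relation_op (step_rel \<kappa> O (step_rel \<kappa>)\<inverse>)) I =
        relation_op (\<Union>\<kappa>\<in>I. step_rel \<kappa> O (step_rel \<kappa>)\<inverse>)"
      using fin I R by (intro relation_op_finsum partial_injection_comp partial_injection_converse) auto
    also have "\<dots> = relation_op (step_rel v)" using step_rel_sum[OF v n] by (simp add: I_def)
    finally have "relation_op (step_rel v) =
        finsum l2_algebra (\<lambda>\<kappa>. relation_op (step_rel \<kappa> O (step_rel \<kappa>)\<inverse>)) I" by simp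
    also have "\<dots> = finsum l2_algebra (\<lambda>\<kappa>. relation_op (step_rel \<kappa>) \<otimes>\<^bsub>l2_algebra\<^esub>
        cadj l2_algebra (relation_op (step_rel \<kappa>))) I"
      using I R by (intro finsum_cong')
        (auto simp: relation_op_adj relation_op_mult relation_op_closed partial_injection_converse partial_injection_comp)
    finally show "relation_op (step_rel v) = (\<Oplus>\<^bsub>l2_algebra\<^esub>\<kappa>\<in>{\<kappa> \<in> paths_deg \<Lambda> n. rng \<Lambda> \<kappa> = v}.
        relation_op (step_rel \<kappa>) \<otimes>\<^bsub>l2_algebra\<^esub> cadj l2_algebra (relation_op (step_rel \<kappa>)))"
      by (simp add: I_def)
  qed
qed

definition base :: nat where "base = idx (y (0, 0), 0)"

lemma base_node: "(y (0, 0), 0) \<in> nodes"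
  by (simp add: nodes_def)

lemma extend_base: "n \<in> Nk k \<Longrightarrow> extend (y (0, 0), 0) n = y (0, n)"
  by (simp add: extend_def y_comp)

text \<open>This decides the diagonal entry of the monomial at the base point. A nonzero entry says
  that \<kappa> and \<nu>, followed by nodes of one class, both lie in the class of \<open>y\<close>
  itself.\<close>

lemma base_step:
  assumes "\<kappa> \<in> mor \<Lambda>" "\<nu> \<in> mor \<Lambda>"
  shows "(base, base) \<in> step_rel \<kappa> O (step_rel \<nu>)\<inverse> \<longleftrightarrow> \<kappa> = \<nu> \<and> y (0, deg \<Lambda> \<kappa>) = \<kappa>"
proof
  assume "(base, base) \<in> step_rel \<kappa> O (step_rel \<nu>)\<inverse>"
  then obtain l where "(base, l) \<in> step_rel \<kappa>" "(base, l) \<in> step_rel \<nu>" by blast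
  then obtain a b where a: "a \<in> nodes" "src \<Lambda> \<kappa> = rng \<Lambda> (fst a)"
      "base = idx (composite \<Lambda> \<kappa> (fst a), snd a)"
    and b: "b \<in> nodes" "src \<Lambda> \<nu> = rng \<Lambda> (fst b)" "base = idx (composite \<Lambda> \<nu> (fst b), snd b)"
    and ab: "idx a = idx b"
    by (metis step_relE)
  have "((y (0, 0), 0), (composite \<Lambda> \<kappa> (fst a), snd a)) \<in> tail_equiv"
    using a(3) idx_eq_iff[OF base_node comp_node(1)[OF assms(1) a(1,2)]] by (simp add: base_def)
  then obtain n1 where n1: "n1 \<in> Nk k" "snd a \<le> n1"
    "\<forall>N \<in> Nk k. n1 \<le> N \<longrightarrow> extend (y (0, 0), 0) N = extend (composite \<Lambda> \<kappa> (fst a), snd a) N"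
    by (rule tail_equivE) simp
  have "((y (0, 0), 0), (composite \<Lambda> \<nu> (fst b), snd b)) \<in> tail_equiv"
    using b(3) idx_eq_iff[OF base_node comp_node(1)[OF assms(2) b(1,2)]] by (simp add: base_def)
  then obtain n2 where n2: "n2 \<in> Nk k" "snd b \<le> n2"
    "\<forall>N \<in> Nk k. n2 \<le> N \<longrightarrow> extend (y (0, 0), 0) N = extend (composite \<Lambda> \<nu> (fst b), snd b) N"
    by (rule tail_equivE) simp
  have "(a, b) \<in> tail_equiv" using ab a b by (simp add: idx_eq_iff)
  then obtain n3 where n3: "n3 \<in> Nk k" "\<forall>N \<in> Nk k. n3 \<le> N \<longrightarrow> extend a N = extend b N"
    by (rule tail_equivE)
  \<comment> \<open>Large enough for all three equivalences to hold as equalities of finite paths,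
    and for \<kappa> to fit into \<open>y (0, N)\<close>.\<close>
  define N where "N = sup (sup n1 n2) (sup n3 (deg \<Lambda> \<kappa>))"
  have N: "N \<in> Nk k" "n1 \<le> N" "n2 \<le> N" "n3 \<le> N" "deg \<Lambda> \<kappa> \<le> N"
    using n1 n2 n3 deg_Nk[OF assms(1)] by (auto simp: N_def sup_Nk intro: le_supI1 le_supI2)
  then have aN: "snd a \<le> N" "snd b \<le> N" using n1(2) n2(2) order_trans by blast+
  have \<kappa>N: "y (0, N) = composite \<Lambda> \<kappa> (extend a N)"
    using n1(3) N(1,2) aN comp_node(2)[OF assms(1) a(1,2)] by (simp add: extend_base)
  have \<nu>N: "y (0, N) = composite \<Lambda> \<nu> (extend b N)"
    using n2(3) N(1,3) aN comp_node(2)[OF assms(2) b(1,2)] by (simp add: extend_base)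
  have eN: "extend a N \<in> mor \<Lambda>" "src \<Lambda> \<kappa> = rng \<Lambda> (extend a N)" "src \<Lambda> \<nu> = rng \<Lambda> (extend b N)" "extend a N = extend b N"
    using extend_mor(1,2)[OF a(1) N(1) aN(1)] extend_mor(1,2)[OF b(1) N(1) aN(2)] a(2) b(2) n3(2) N(1,4)
    by simp_all
  \<comment> \<open>Both paths factor \<open>y (0, N)\<close> with the same second factor, and a
    common second factor cancels.\<close>
  have "\<kappa> = \<nu>"
    using factor_unique(1)[of \<kappa> "extend a N" \<nu> "extend b N"] assms eN \<kappa>N \<nu>N by simp
  moreover have "y (0, deg \<Lambda> \<kappa>) = \<kappa>"
    using factor_unique(1)[of "y (0, deg \<Lambda> \<kappa>)" "y (deg \<Lambda> \<kappa>, N)" \<kappa> "extend a N"] assms eN \<kappa>N N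
      deg_Nk[OF assms(1)] by (simp add: y_comp)
  ultimately show "\<kappa> = \<nu> \<and> y (0, deg \<Lambda> \<kappa>) = \<kappa>" ..
next
  assume *: "\<kappa> = \<nu> \<and> y (0, deg \<Lambda> \<kappa>) = \<kappa>"
  define n where "n = deg \<Lambda> \<kappa>"
  have n: "n \<in> Nk k" "y (0, n) = \<kappa>" using * deg_Nk[OF assms(1)] by (auto simp: n_def)
  have src: "src \<Lambda> \<kappa> = y (n, n)" using y_src[of 0 n] n by simp
  have a: "(y (n, n), n) \<in> nodes" using n by (simp add: nodes_def)
  have \<kappa>: "composite \<Lambda> \<kappa> (y (n, n)) = \<kappa>" using comp_id_right[OF assms(1)] src by simp
  have kn: "(\<kappa>, n) \<in> nodes" using assms n src by (simp add: nodes_def)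
  have "extend (\<kappa>, n) n = extend (y (0, 0), 0) n" using n \<kappa> by (simp add: extend_base) (simp add: extend_def)
  then have "((y (0, 0), 0), (\<kappa>, n)) \<in> tail_equiv"
    using kn base_node n by (auto simp: tail_equiv_def)
  then have "base = idx (\<kappa>, n)" using kn base_node by (simp add: base_def idx_eq_iff)
  moreover have "(idx (\<kappa>, n), idx (y (n, n), n)) \<in> step_rel \<kappa>"
    using step_relI[OF a, of \<kappa>] src n \<kappa> by simp
  ultimately show "(base, base) \<in> step_rel \<kappa> O (step_rel \<nu>)\<inverse>" using * by auto
qed

end

lemma l2_diagonal_entry_positive:
  assumes "a \<in> carrier l2_algebra"
  shows "entry (cadj l2_algebra a \<otimes>\<^bsub>l2_algebra\<^esub> a) i i \<in> \<real>"
    "0 \<le> Re (entry (cadj l2_algebra a \<otimes>\<^bsub>l2_algebra\<^esub> a) i i)"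
proof -
  have "form_bound (entry a) (matrix_norm (entry a))" using assms by (simp add: l2_simps form_bound_norm)
  from matrix_mult_sums[OF form_bound_adj[OF this] this, of i i]
  have "(\<lambda>l. of_real ((cmod (entry a l i))\<^sup>2)) sums entry (cadj l2_algebra a \<otimes>\<^bsub>l2_algebra\<^esub> a) i i"
    unfolding complex_norm_square by (simp add: l2_simps matrix_adj_def mult.commute)
  then have *: "(\<lambda>l. (cmod (entry a l i))\<^sup>2) sums Re (entry (cadj l2_algebra a \<otimes>\<^bsub>l2_algebra\<^esub> a) i i)"
    and **: "(\<lambda>l. 0) sums Im (entry (cadj l2_algebra a \<otimes>\<^bsub>l2_algebra\<^esub> a) i i)"
    using sums_Re sums_Im by (force, force)
  show "0 \<le> Re (entry (cadj l2_algebra a \<otimes>\<^bsub>l2_algebra\<^esub> a) i i)"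
    by (rule sums_le[OF _ sums_zero *]) simp
  show "entry (cadj l2_algebra a \<otimes>\<^bsub>l2_algebra\<^esub> a) i i \<in> \<real>"
    using ** by (simp add: complex_is_Real_iff sums_iff)
qed

section \<open>The vector state of an infinite path\<close>

context cuntz_krieger_algebra
begin

lemma path_functional:
  assumes universal: "\<And>(B :: (nat \<Rightarrow> complex) cstar) t. \<lbrakk>cstar_algebra B; cuntz_krieger_family k \<Lambda> B t\<rbrakk> \<Longrightarrow>
      \<exists>\<pi>. star_hom A B \<pi> \<and> (\<forall>\<kappa> \<in> mor \<Lambda>. \<pi> (S \<kappa>) = t \<kappa>)"
    and y: "y \<in> infinite_paths k \<Lambda>"
  obtains \<psi> where "positive_functional \<psi>"
    "\<And>\<kappa> \<nu>. \<lbrakk>\<kappa> \<in> mor \<Lambda>; \<nu> \<in> mor \<Lambda>\<rbrakk> \<Longrightarrow>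
      \<psi> (S \<kappa> \<otimes> cadj A (S \<nu>)) = (if \<kappa> = \<nu> \<and> y (0, deg \<Lambda> \<kappa>) = \<kappa> then 1 else 0)"
proof -
  interpret infinite_path k \<Lambda> y by unfold_locales (rule y)
  obtain \<pi> where \<pi>: "star_hom A l2_algebra \<pi>" "\<And>\<kappa>. \<kappa> \<in> mor \<Lambda> \<Longrightarrow> \<pi> (S \<kappa>) = relation_op (step_rel \<kappa>)"
    using universal[OF l2_cstar_algebra path_family[OF finite_graph]] by blast
  have hom: "\<And>a. a \<in> carrier A \<Longrightarrow> \<pi> a \<in> carrier l2_algebra"
    "\<And>a. a \<in> carrier A \<Longrightarrow> \<pi> (cadj A a) = cadj l2_algebra (\<pi> a)"
    "\<And>a z. a \<in> carrier A \<Longrightarrow> \<pi> (cscale A z a) = cscale l2_algebra z (\<pi> a)"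
    "\<And>a b. \<lbrakk>a \<in> carrier A; b \<in> carrier A\<rbrakk> \<Longrightarrow> \<pi> (a \<oplus> b) = \<pi> a \<oplus>\<^bsub>l2_algebra\<^esub> \<pi> b"
    "\<And>a b. \<lbrakk>a \<in> carrier A; b \<in> carrier A\<rbrakk> \<Longrightarrow> \<pi> (a \<otimes> b) = \<pi> a \<otimes>\<^bsub>l2_algebra\<^esub> \<pi> b"
    using \<pi>(1) by (auto simp: star_hom_def)
  define \<psi> where "\<psi> a = entry (\<pi> a) base base" for a
  show ?thesis
  proof (rule that)
    have "\<psi> (a \<oplus> b) = \<psi> a + \<psi> b" if "a \<in> carrier A" "b \<in> carrier A" for a b
      using that by (simp add: \<psi>_def hom) (simp add: l2_simps)
    moreover have "\<psi> (cscale A z a) = z * \<psi> a" if "a \<in> carrier A" for a z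
      using that by (simp add: \<psi>_def hom) (simp add: l2_simps)
    moreover have "\<psi> (cadj A a \<otimes> a) \<in> \<real> \<and> 0 \<le> Re (\<psi> (cadj A a \<otimes> a))" if "a \<in> carrier A" for a
      using l2_diagonal_entry_positive[OF hom(1)[OF that], of base] that by (simp add: \<psi>_def hom)
    ultimately show "positive_functional \<psi>" by (simp add: positive_functional_def)
    fix \<kappa> \<nu> assume \<kappa>\<nu>: "\<kappa> \<in> mor \<Lambda>" "\<nu> \<in> mor \<Lambda>"
    have "\<pi> (S \<kappa> \<otimes> cadj A (S \<nu>)) = relation_op (step_rel \<kappa> O (step_rel \<nu>)\<inverse>)"
      using \<kappa>\<nu> by (simp add: hom \<pi>(2) relation_op_adj relation_op_mult step_rel_injection)
    then show "\<psi> (S \<kappa> \<otimes> cadj A (S \<nu>)) = (if \<kappa> = \<nu> \<and> y (0, deg \<Lambda> \<kappa>) = \<kappa> then 1 else 0)"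
      using base_step[OF \<kappa>\<nu>] by (simp add: \<psi>_def relation_matrix_def)
  qed
qed

end

section \<open>The functional of a measure on the path space\<close>

context kgraph
begin

text \<open>\<open>composite \<Lambda> (rng \<Lambda> \<kappa>) \<kappa>\<close> and
  \<open>composite \<Lambda> \<kappa> (src \<Lambda> \<kappa>)\<close> are two factorizations of
  \<kappa> into factors of degree 0, so they coincide.\<close>

lemma deg_zero_vertex:
  assumes "\<kappa> \<in> mor \<Lambda>" "deg \<Lambda> \<kappa> = 0"
  shows "\<kappa> \<in> vertices \<Lambda>"
proof -
  have "rng \<Lambda> \<kappa> = \<kappa>"
    using factor_unique(1)[of "rng \<Lambda> \<kappa>" \<kappa> \<kappa> "src \<Lambda> \<kappa>"] assms
    by (simp add: comp_id_left comp_id_right deg_id)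
  then show ?thesis using rng_vertex[OF assms(1)] by simp
qed

lemma cylinderD:
  assumes "z \<in> cylinder k \<Lambda> \<kappa>"
  shows "z \<in> infinite_paths k \<Lambda>" "z (0, deg \<Lambda> \<kappa>) = \<kappa>"
  using assms by (auto simp: cylinder_def)

lemma initial_segment:
  assumes x: "x \<in> infinite_paths k \<Lambda>" "x' \<in> infinite_paths k \<Lambda>"
    and mn: "m \<in> Nk k" "n \<in> Nk k" "m \<le> n" and eq: "x (0, n) = x' (0, n)"
  shows "x (0, m) = x' (0, m)"
proof -
  interpret x: infinite_path k \<Lambda> x by unfold_locales (rule x(1))
  interpret x': infinite_path k \<Lambda> x' by unfold_locales (rule x(2))
  show ?thesis
    using factor_unique(1)[of "x (0, m)" "x (m, n)" "x' (0, m)" "x' (m, n)"] mn eq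
    by (simp add: x.y_comp x'.y_comp le_fun_def)
qed

end

context cuntz_krieger_algebra
begin

text \<open>Convergence on the dense span extends to every element because the functionals are
  uniformly bounded by \<open>C\<close>.\<close>

lemma functional_limit:
  assumes \<phi>: "\<And>j. positive_functional (\<phi> j)" and C: "\<And>j. Re (\<phi> j unit) \<le> C"
    and conv: "\<And>\<kappa> \<nu>. \<lbrakk>\<kappa> \<in> mor \<Lambda>; \<nu> \<in> mor \<Lambda>\<rbrakk> \<Longrightarrow> convergent (\<lambda>j::nat. \<phi> j (S \<kappa> \<otimes> cadj A (S \<nu>)))"
  obtains \<psi> where "positive_functional \<psi>" "\<And>a. a \<in> carrier A \<Longrightarrow> (\<lambda>j. \<phi> j a) \<longlonglongrightarrow> \<psi> a"
proof -
  have span: "convergent (\<lambda>j. \<phi> j w)" if "w \<in> monomial_span" for w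
    using that
  proof (induction rule: monomial_span.induct)
    case zero
    then show ?case using functional_zero[OF \<phi>] by (simp add: convergent_const)
  next
    case (add \<kappa> \<nu> w z)
    then have "\<phi> j (cscale A z (S \<kappa> \<otimes> cadj A (S \<nu>)) \<oplus> w) = z * \<phi> j (S \<kappa> \<otimes> cadj A (S \<nu>)) + \<phi> j w" for j
      using span_carrier by (simp add: functional_add[OF \<phi>] functional_scale[OF \<phi>])
    moreover obtain l l' where "(\<lambda>j. \<phi> j (S \<kappa> \<otimes> cadj A (S \<nu>))) \<longlonglongrightarrow> l" "(\<lambda>j. \<phi> j w) \<longlonglongrightarrow> l'"
      using conv[OF add(1,2)] add.IH by (auto simp: convergent_def)
    then have "(\<lambda>j. z * \<phi> j (S \<kappa> \<otimes> cadj A (S \<nu>)) + \<phi> j w) \<longlonglongrightarrow> z * l + l'"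
      by (intro tendsto_intros)
    ultimately show ?case by (auto simp: convergent_def)
  qed
  have "convergent (\<lambda>j. \<phi> j a)" if a: "a \<in> carrier A" for a
  proof (rule Cauchy_convergent, rule CauchyI)
    fix e :: real assume e: "0 < e"
    \<comment> \<open>Chosen so that passing to \<open>w\<close> costs at most a quarter of
      \<open>e\<close>; the added 1 keeps the denominator positive.\<close>
    define d where "d = e / (4 * (\<bar>C\<bar> + 1))"
    have d: "0 < d" using e by (simp add: d_def)
    obtain f where f: "range f \<subseteq> monomial_span" "tends_to f a" using span_dense[OF a] .
    have "\<forall>\<^sub>F n in sequentially. cnorm A (f n \<ominus> a) < d"
      using f(2) d unfolding tends_to_def by (rule order_tendstoD)
    then obtain w where w: "w \<in> monomial_span" "cnorm A (w \<ominus> a) < d"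
      using f(1) by (auto simp: eventually_sequentially)
    have wc: "w \<in> carrier A" using w(1) by (rule span_carrier)
    have close: "cmod (\<phi> j w - \<phi> j a) \<le> e / 4" for j
    proof -
      have "cmod (\<phi> j w - \<phi> j a) \<le> Re (\<phi> j unit) * cnorm A (w \<ominus> a)"
        using functional_bound[OF \<phi>, of "w \<ominus> a" j] a wc by (simp add: functional_minus[OF \<phi>])
      also have "\<dots> \<le> (\<bar>C\<bar> + 1) * d"
        using C[of j] w(2) d norm_nonneg[of "w \<ominus> a"] a wc by (intro mult_mono) auto
      also have "\<dots> = e / 4" by (simp add: d_def field_simps add_nonneg_eq_0_iff)
      finally show ?thesis .
    qed
    obtain N where N: "\<And>m n. \<lbrakk>m \<ge> N; n \<ge> N\<rbrakk> \<Longrightarrow> cmod (\<phi> m w - \<phi> n w) < e / 4"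
      using CauchyD[OF convergent_Cauchy[OF span[OF w(1)]], of "e / 4"] e by auto
    have "cmod (\<phi> m a - \<phi> n a) < e" if mn: "m \<ge> N" "n \<ge> N" for m n
    proof -
      have "\<phi> m a - \<phi> n a = (\<phi> m w - \<phi> n w) - (\<phi> m w - \<phi> m a) + (\<phi> n w - \<phi> n a)" by simp
      also have "cmod \<dots> \<le> cmod (\<phi> m w - \<phi> n w) + cmod (\<phi> m w - \<phi> m a) + cmod (\<phi> n w - \<phi> n a)"
        by (rule order_trans[OF norm_triangle_ineq add_right_mono[OF norm_triangle_ineq4]])
      also have "\<dots> < e / 4 + e / 4 + e / 4"
        using N[OF mn] close[of m] close[of n] by simp
      finally show ?thesis using e by simp
    qed
    then show "\<exists>M. \<forall>m\<ge>M. \<forall>n\<ge>M. cmod (\<phi> m a - \<phi> n a) < e" by blast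
  qed
  then have lim: "(\<lambda>j. \<phi> j a) \<longlonglongrightarrow> lim (\<lambda>j. \<phi> j a)" if "a \<in> carrier A" for a
    using that by (simp add: convergent_LIMSEQ_iff)
  define \<psi> where "\<psi> a = lim (\<lambda>j. \<phi> j a)" for a
  note lim' = lim[folded \<psi>_def]
  show ?thesis
  proof (rule that[OF _ lim'])
    have "\<psi> (a \<oplus> b) = \<psi> a + \<psi> b" if "a \<in> carrier A" "b \<in> carrier A" for a b
      using that lim'[of "a \<oplus> b"] tendsto_add[OF lim'[of a] lim'[of b]]
      by (simp add: functional_add[OF \<phi>] LIMSEQ_unique)
    moreover have "\<psi> (cscale A z a) = z * \<psi> a" if "a \<in> carrier A" for a z
      using that lim'[of "cscale A z a"] tendsto_mult_left[OF lim'[of a], of z] LIMSEQ_unique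
      by (simp only: functional_scale[OF \<phi>] scale_closed) blast
    moreover have "\<psi> (cadj A a \<otimes> a) \<in> \<real> \<and> 0 \<le> Re (\<psi> (cadj A a \<otimes> a))" if "a \<in> carrier A" for a
    proof -
      have "(\<lambda>j. \<phi> j (cadj A a \<otimes> a)) \<longlonglongrightarrow> \<psi> (cadj A a \<otimes> a)" using that by (intro lim') auto
      from tendsto_Re[OF this] tendsto_Im[OF this]
      have "0 \<le> Re (\<psi> (cadj A a \<otimes> a))" and im: "(\<lambda>j. Im (\<phi> j (cadj A a \<otimes> a))) \<longlonglongrightarrow> Im (\<psi> (cadj A a \<otimes> a))"
        using functional_square_real(2)[OF \<phi> that] by (auto intro: LIMSEQ_le_const)
      moreover have "Im (\<phi> j (cadj A a \<otimes> a)) = 0" for j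
        using functional_square_real(1)[OF \<phi> that] by (metis Im_complex_of_real)
      then have "Im (\<psi> (cadj A a \<otimes> a)) = 0" using im by (simp add: LIMSEQ_const_iff)
      ultimately show ?thesis by (simp add: complex_is_Real_iff)
    qed
    ultimately show "positive_functional \<psi>" by (simp add: positive_functional_def)
  qed
qed

text \<open>All paths in the cylinder of \<kappa> share their initial segment of degree
  \<open>deg \<Lambda> \<sigma>\<close>, so one representative \<open>y \<kappa>\<close> decides
  whether that cylinder lies inside the cylinder of \<sigma>.\<close>

lemma cylinder_decomposition:
  assumes \<sigma>: "\<sigma> \<in> mor \<Lambda>" and n: "n \<in> Nk k" "deg \<Lambda> \<sigma> \<le> n"
    and y: "\<And>\<kappa>. \<kappa> \<in> mor \<Lambda> \<Longrightarrow> y \<kappa> \<in> cylinder k \<Lambda> \<kappa>"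
  shows "cylinder k \<Lambda> \<sigma> = (\<Union>\<kappa>\<in>{\<kappa> \<in> paths_deg \<Lambda> n. y \<kappa> (0, deg \<Lambda> \<sigma>) = \<sigma>}. cylinder k \<Lambda> \<kappa>)"
proof (intro subset_antisym subsetI)
  fix x assume "x \<in> cylinder k \<Lambda> \<sigma>"
  note x = cylinderD[OF this]
  interpret x: infinite_path k \<Lambda> x by unfold_locales (rule x(1))
  define \<kappa> where "\<kappa> = x (0, n)"
  have \<kappa>: "\<kappa> \<in> mor \<Lambda>" "deg \<Lambda> \<kappa> = n" using n by (auto simp: \<kappa>_def le_fun_def fun_eq_iff)
  have "y \<kappa> (0, deg \<Lambda> \<sigma>) = x (0, deg \<Lambda> \<sigma>)"
    by (rule initial_segment[OF cylinderD(1)[OF y[OF \<kappa>(1)]] x(1) deg_Nk[OF \<sigma>] n])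
      (use cylinderD(2)[OF y[OF \<kappa>(1)]] \<kappa> in \<open>simp add: \<kappa>_def\<close>)
  then show "x \<in> (\<Union>\<kappa>\<in>{\<kappa> \<in> paths_deg \<Lambda> n. y \<kappa> (0, deg \<Lambda> \<sigma>) = \<sigma>}. cylinder k \<Lambda> \<kappa>)"
    using x \<kappa> by (auto simp: paths_deg_def cylinder_def \<kappa>_def)
next
  fix x assume "x \<in> (\<Union>\<kappa>\<in>{\<kappa> \<in> paths_deg \<Lambda> n. y \<kappa> (0, deg \<Lambda> \<sigma>) = \<sigma>}. cylinder k \<Lambda> \<kappa>)"
  then obtain \<kappa> where \<kappa>: "\<kappa> \<in> mor \<Lambda>" "deg \<Lambda> \<kappa> = n" "y \<kappa> (0, deg \<Lambda> \<sigma>) = \<sigma>" "x \<in> cylinder k \<Lambda> \<kappa>"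
    by (auto simp: paths_deg_def)
  have "x (0, deg \<Lambda> \<sigma>) = y \<kappa> (0, deg \<Lambda> \<sigma>)"
    by (rule initial_segment[OF cylinderD(1)[OF \<kappa>(4)] cylinderD(1)[OF y[OF \<kappa>(1)]] deg_Nk[OF \<sigma>] n])
      (use cylinderD(2)[OF y[OF \<kappa>(1)]] cylinderD(2)[OF \<kappa>(4)] \<kappa> in simp)
  then show "x \<in> cylinder k \<Lambda> \<sigma>" using \<kappa> cylinderD(1)[OF \<kappa>(4)] by (simp add: cylinder_def)
qed

lemma measure_cylinder_sum:
  assumes M: "finite_measure M" "\<And>\<kappa>. \<kappa> \<in> mor \<Lambda> \<Longrightarrow> cylinder k \<Lambda> \<kappa> \<in> sets M"
    and I: "I \<subseteq> paths_deg \<Lambda> n" "n \<in> Nk k"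
  shows "measure M (\<Union>\<kappa>\<in>I. cylinder k \<Lambda> \<kappa>) = (\<Sum>\<kappa>\<in>I. measure M (cylinder k \<Lambda> \<kappa>))"
proof (rule finite_measure.finite_measure_finite_Union[OF M(1)])
  show "finite I" using I finite_subset finite_paths by blast
  show "(\<lambda>\<kappa>. cylinder k \<Lambda> \<kappa>) ` I \<subseteq> sets M" using M(2) I by (auto simp: paths_deg_def)
  have "deg \<Lambda> \<kappa> = n" if "\<kappa> \<in> I" for \<kappa> using that I(1) by (auto simp: paths_deg_def)
  then show "disjoint_family_on (\<lambda>\<kappa>. cylinder k \<Lambda> \<kappa>) I"
    unfolding disjoint_family_on_def using cylinderD(2) by (metis disjoint_iff)
qed

text \<open>
  The approximants are averages of the vector states of \<open>y \<kappa> \<in> Z(\<kappa>)\<close> with weights \<open>M(Z(\<kappa>))\<close> over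
  all \<open>\<kappa>\<close> of a fixed degree; they have the right value at \<open>S(\<sigma>) S(\<tau>)\<^sup>*\<close> once that degree dominates
  the degree of \<open>\<sigma>\<close>.
\<close>

theorem measure_functional:
  assumes universal: "\<And>(B :: (nat \<Rightarrow> complex) cstar) t. \<lbrakk>cstar_algebra B; cuntz_krieger_family k \<Lambda> B t\<rbrakk> \<Longrightarrow>
      \<exists>\<pi>. star_hom A B \<pi> \<and> (\<forall>\<kappa> \<in> mor \<Lambda>. \<pi> (S \<kappa>) = t \<kappa>)"
    and M: "prob_space M" "\<And>\<kappa>. \<kappa> \<in> mor \<Lambda> \<Longrightarrow> cylinder k \<Lambda> \<kappa> \<in> sets M" "space M = infinite_paths k \<Lambda>"
    and pos: "\<And>\<kappa>. \<kappa> \<in> mor \<Lambda> \<Longrightarrow> 0 < measure M (cylinder k \<Lambda> \<kappa>)"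
  obtains \<phi> where "positive_functional \<phi>" "\<phi> unit = 1"
    "\<forall>\<kappa> \<in> mor \<Lambda>. \<forall>\<nu> \<in> mor \<Lambda>.
      \<phi> (S \<kappa> \<otimes> cadj A (S \<nu>)) = (if \<kappa> = \<nu> then of_real (measure M (cylinder k \<Lambda> \<kappa>)) else 0)"
proof -
  interpret M: prob_space M by (rule M(1))
  define m where "m \<kappa> = measure M (cylinder k \<Lambda> \<kappa>)" for \<kappa>
  \<comment> \<open>A cylinder of positive measure is nonempty; this is where the representatives
    come from.\<close>
  have "\<exists>z. z \<in> cylinder k \<Lambda> \<kappa>" if "\<kappa> \<in> mor \<Lambda>" for \<kappa>
    using pos[OF that] by (metis equals0I less_irrefl measure_empty)
  then obtain y where y: "\<And>\<kappa>. \<kappa> \<in> mor \<Lambda> \<Longrightarrow> y \<kappa> \<in> cylinder k \<Lambda> \<kappa>" by metis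
  have "\<exists>\<psi>. positive_functional \<psi> \<and> (\<forall>\<sigma>\<in>mor \<Lambda>. \<forall>\<tau>\<in>mor \<Lambda>.
      \<psi> (S \<sigma> \<otimes> cadj A (S \<tau>)) = (if \<sigma> = \<tau> \<and> y \<kappa> (0, deg \<Lambda> \<sigma>) = \<sigma> then 1 else 0))"
    if "\<kappa> \<in> mor \<Lambda>" for \<kappa>
    using path_functional[OF universal cylinderD(1)[OF y[OF that]]] by metis
  then obtain \<psi> where \<psi>: "\<And>\<kappa>. \<kappa> \<in> mor \<Lambda> \<Longrightarrow> positive_functional (\<psi> \<kappa>)"
    "\<And>\<kappa> \<sigma> \<tau>. \<lbrakk>\<kappa> \<in> mor \<Lambda>; \<sigma> \<in> mor \<Lambda>; \<tau> \<in> mor \<Lambda>\<rbrakk> \<Longrightarrow>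
      \<psi> \<kappa> (S \<sigma> \<otimes> cadj A (S \<tau>)) = (if \<sigma> = \<tau> \<and> y \<kappa> (0, deg \<Lambda> \<sigma>) = \<sigma> then 1 else 0)"
    by metis
  \<comment> \<open>The diagonal degrees \<open>(j, ..., j)\<close> eventually dominate every
    degree.\<close>
  define N where "N j = (\<lambda>i. if i \<in> {1..k} then j else 0)" for j :: nat
  have N: "N j \<in> Nk k" for j by (simp add: N_def Nk_def)
  have Nlarge: "\<exists>j0. \<forall>j\<ge>j0. n \<le> N j" if "n \<in> Nk k" for n
  proof (intro exI allI impI)
    fix j assume j: "Max (n ` {1..k}) \<le> j"
    have "n i \<le> j" if "i \<in> {1..k}" for i
      using Max_ge[of "n ` {1..k}" "n i"] that j by simp
    then show "n \<le> N j" using that by (auto simp: N_def le_fun_def Nk_def)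
  qed
  define \<phi> where "\<phi> j a = (\<Sum>\<kappa>\<in>paths_deg \<Lambda> (N j). of_real (m \<kappa>) * \<psi> \<kappa> a)" for j a
  have mor: "\<kappa> \<in> mor \<Lambda>" if "\<kappa> \<in> paths_deg \<Lambda> n" for \<kappa> n using that by (simp add: paths_deg_def)
  have \<phi>: "positive_functional (\<phi> j)" for j
    unfolding positive_functional_def
  proof (intro conjI ballI allI)
    fix a b assume ab: "a \<in> carrier A" "b \<in> carrier A"
    show "\<phi> j (a \<oplus> b) = \<phi> j a + \<phi> j b"
      unfolding \<phi>_def sum.distrib[symmetric]
      by (rule sum.cong) (use ab in \<open>simp_all add: functional_add[OF \<psi>(1)] mor distrib_left\<close>)
  next
    fix a z assume a: "a \<in> carrier A"
    show "\<phi> j (cscale A z a) = z * \<phi> j a"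
      unfolding \<phi>_def sum_distrib_left
      by (rule sum.cong) (use a in \<open>simp_all add: functional_scale[OF \<psi>(1)] mor\<close>)
  next
    fix a assume a: "a \<in> carrier A"
    have summand: "of_real (m \<kappa>) * \<psi> \<kappa> (cadj A a \<otimes> a) = of_real (m \<kappa> * Re (\<psi> \<kappa> (cadj A a \<otimes> a)))"
      if "\<kappa> \<in> paths_deg \<Lambda> (N j)" for \<kappa>
      using functional_square_real(1)[OF \<psi>(1)[OF mor[OF that]] a] by simp
    have eq: "\<phi> j (cadj A a \<otimes> a) = of_real (\<Sum>\<kappa>\<in>paths_deg \<Lambda> (N j). m \<kappa> * Re (\<psi> \<kappa> (cadj A a \<otimes> a)))"
      unfolding \<phi>_def of_real_sum by (rule sum.cong) (simp_all only: summand)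
    show "\<phi> j (cadj A a \<otimes> a) \<in> \<real>" unfolding eq by simp
    show "0 \<le> Re (\<phi> j (cadj A a \<otimes> a))"
      unfolding eq Re_complex_of_real
      by (intro sum_nonneg mult_nonneg_nonneg functional_square_real(2)[OF \<psi>(1)[OF mor]] a)
        (simp_all add: m_def)
  qed
  have diag: "\<phi> j (S \<sigma> \<otimes> cadj A (S \<tau>)) = (if \<sigma> = \<tau> then of_real (m \<sigma>) else 0)"
    if "\<sigma> \<in> mor \<Lambda>" "\<tau> \<in> mor \<Lambda>" "deg \<Lambda> \<sigma> \<le> N j" for j \<sigma> \<tau>
  proof (cases "\<sigma> = \<tau>")
    case False
    then show ?thesis using that by (simp add: \<phi>_def \<psi>(2) mor)
  next
    case True
    define I where "I = {\<kappa> \<in> paths_deg \<Lambda> (N j). y \<kappa> (0, deg \<Lambda> \<sigma>) = \<sigma>}"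
    have "\<phi> j (S \<sigma> \<otimes> cadj A (S \<tau>)) = (\<Sum>\<kappa>\<in>paths_deg \<Lambda> (N j). if \<kappa> \<in> I then of_real (m \<kappa>) else 0)"
      unfolding \<phi>_def by (rule sum.cong) (use that True in \<open>auto simp: \<psi>(2) mor I_def\<close>)
    also have "\<dots> = (\<Sum>\<kappa>\<in>I. of_real (m \<kappa>))"
      using finite_paths[OF N] by (subst sum.inter_restrict[symmetric]) (auto simp: I_def intro: sum.cong)
    also have "\<dots> = of_real (measure M (\<Union>\<kappa>\<in>I. cylinder k \<Lambda> \<kappa>))"
      unfolding m_def of_real_sum[symmetric]
      by (subst measure_cylinder_sum[OF M.finite_measure_axioms M(2) _ N[of j]]) (auto simp: I_def)
    also have "(\<Union>\<kappa>\<in>I. cylinder k \<Lambda> \<kappa>) = cylinder k \<Lambda> \<sigma>"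
      unfolding I_def using cylinder_decomposition[OF that(1) N that(3) y] by simp
    finally show ?thesis using True by (simp add: m_def)
  qed
  have unit_value: "\<phi> j unit = 1" for j
  proof -
    have "\<phi> j unit = (\<Sum>v\<in>vertices \<Lambda>. \<phi> j (S v))"
      unfolding unit_def by (rule functional_finsum[OF \<phi>]) auto
    also have "\<dots> = (\<Sum>v\<in>vertices \<Lambda>. of_real (m v))"
    proof (rule sum.cong[OF refl])
      fix v assume v: "v \<in> vertices \<Lambda>"
      then have "S v = S v \<otimes> cadj A (S v)" by (simp add: S_vertex)
      then show "\<phi> j (S v) = of_real (m v)"
        using diag[of v v j] v by (simp add: deg_id le_fun_def)
    qed
    also have "\<dots> = of_real (measure M (\<Union>v\<in>vertices \<Lambda>. cylinder k \<Lambda> v))"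
      unfolding m_def of_real_sum[symmetric]
      by (subst measure_cylinder_sum[OF M.finite_measure_axioms M(2) vertices_subset_paths zero_Nk]) auto
    \<comment> \<open>Each infinite path starts at a vertex, so the vertex cylinders cover the space
      and the total weight is 1.\<close>
    also have "(\<Union>v\<in>vertices \<Lambda>. cylinder k \<Lambda> v) = space M"
    proof -
      have "x (0, 0) \<in> vertices \<Lambda>" if x: "x \<in> infinite_paths k \<Lambda>" for x
      proof -
        interpret x: infinite_path k \<Lambda> x by unfold_locales (rule x)
        show ?thesis by (rule deg_zero_vertex) simp_all
      qed
      then show ?thesis unfolding M(3) by (auto simp: cylinder_def deg_id)
    qed
    finally show ?thesis by (simp add: M.prob_space)
  qed
  have lim: "(\<lambda>j. \<phi> j (S \<sigma> \<otimes> cadj A (S \<tau>))) \<longlonglongrightarrow> (if \<sigma> = \<tau> then of_real (m \<sigma>) else 0)"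
    if st: "\<sigma> \<in> mor \<Lambda>" "\<tau> \<in> mor \<Lambda>" for \<sigma> \<tau>
  proof (rule tendsto_eventually)
    obtain j0 where "\<And>j. j \<ge> j0 \<Longrightarrow> deg \<Lambda> \<sigma> \<le> N j" using Nlarge[OF deg_Nk[OF st(1)]] by blast
    then show "\<forall>\<^sub>F j in sequentially. \<phi> j (S \<sigma> \<otimes> cadj A (S \<tau>)) = (if \<sigma> = \<tau> then of_real (m \<sigma>) else 0)"
      unfolding eventually_sequentially using diag[OF st] by blast
  qed
  obtain \<Phi> where \<Phi>: "positive_functional \<Phi>" "\<And>a. a \<in> carrier A \<Longrightarrow> (\<lambda>j. \<phi> j a) \<longlonglongrightarrow> \<Phi> a"
  proof (rule functional_limit[of \<phi> 1])
    show "convergent (\<lambda>j. \<phi> j (S \<sigma> \<otimes> cadj A (S \<tau>)))" if "\<sigma> \<in> mor \<Lambda>" "\<tau> \<in> mor \<Lambda>" for \<sigma> \<tau>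
      using lim[OF that] by (rule convergentI)
  qed (simp_all add: \<phi> unit_value)
  show ?thesis
  proof (rule that[OF \<Phi>(1)])
    show "\<Phi> unit = 1"
      using \<Phi>(2)[OF unit_carrier] by (simp add: unit_value LIMSEQ_const_iff)
    have "\<Phi> (S \<sigma> \<otimes> cadj A (S \<tau>)) = (if \<sigma> = \<tau> then of_real (m \<sigma>) else 0)"
      if "\<sigma> \<in> mor \<Lambda>" "\<tau> \<in> mor \<Lambda>" for \<sigma> \<tau>
      using LIMSEQ_unique[OF \<Phi>(2) lim[OF that]] that by simp
    then show "\<forall>\<kappa> \<in> mor \<Lambda>. \<forall>\<nu> \<in> mor \<Lambda>.
      \<Phi> (S \<kappa> \<otimes> cadj A (S \<nu>)) = (if \<kappa> = \<nu> then of_real (measure M (cylinder k \<Lambda> \<kappa>)) else 0)"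
      by (simp add: m_def)
  qed
qed

lemma state_positive: "is_state A \<phi> \<Longrightarrow> positive_functional \<phi>"
  by (simp add: is_state_def positive_functional_def)

text \<open>\<open>functional_bound\<close> gives norm at most 1, and the unit, of norm at most 1,
  attains the value 1.\<close>

lemma stateI:
  assumes \<phi>: "positive_functional \<phi>" and unit: "\<phi> unit = 1"
  shows "is_state A \<phi>"
proof -
  define N where "N = {cmod (\<phi> a) | a. a \<in> carrier A \<and> cnorm A a \<le> 1}"
  have le: "r \<le> 1" if "r \<in> N" for r
    using that functional_bound[OF \<phi>] unit by (force simp: N_def)
  have "cnorm A unit \<le> 1" by (rule norm_projection_le_one) simp_all
  then have one: "1 \<in> N" using unit by (force simp: N_def)
  have "bdd_above N" using le by (auto simp: bdd_above_def)
  moreover have "Sup N = 1" using le one by (intro cSup_eq_maximum) auto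
  ultimately show ?thesis
    using \<phi> by (simp add: is_state_def positive_functional_def N_def)
qed

end

section \<open>The map to the unit interval\<close>

text \<open>At the first difference \<open>d'\<close> gains at least one unit of position
  \<open>m\<close>. The later digits can compensate only if they do so maximally: all digits of
  \<open>d\<close> are largest and all digits of \<open>d'\<close> are 0.\<close>

lemma expansions_differ:
  fixes d d' :: "nat \<Rightarrow> nat" and N :: nat
  assumes d: "\<And>l. d l < N" "\<And>l. d' l < N"
    and eq: "(\<Sum>l. real (d l) / real N ^ Suc l) = (\<Sum>l. real (d' l) / real N ^ Suc l)"
    and less: "\<And>l. l < m \<Longrightarrow> d l = d' l" "d m < d' m"
  shows "\<forall>l>m. d l = N - 1 \<and> d' l = 0"
proof -
  have N: "2 \<le> N" using less(2) d(2)[of m] by simp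
  then have N1: "1 < real N" by simp
  have geo: "(\<lambda>l. (real N - 1) / real N ^ Suc l) sums 1"
  proof -
    have "(\<lambda>l. (1 / real N) ^ l) sums (1 / (1 - 1 / real N))"
      using N1 by (intro geometric_sums) simp
    from sums_mult[OF this, of "(real N - 1) / real N"] show ?thesis
      using N1 by (simp add: field_simps power_divide)
  qed
  have summ: "summable (\<lambda>l. real (c l) / real N ^ Suc l)" if "\<And>l. c l < N" for c :: "nat \<Rightarrow> nat"
  proof (rule summable_comparison_test'[OF sums_summable[OF geo]])
    show "norm (real (c l) / real N ^ Suc l) \<le> (real N - 1) / real N ^ Suc l" if "0 \<le> l" for l
    proof -
      have "Suc (c l) \<le> N" using \<open>\<And>l. c l < N\<close>[of l] by simp
      then have "real (c l) \<le> real N - 1" by linarith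
      then show ?thesis by (simp add: divide_right_mono)
    qed
  qed
  \<comment> \<open>These terms are nonnegative and add up to 1, as the two expansions cancel. The
    terms up to index \<open>m\<close> already reach 1, so all later ones vanish.\<close>
  define g where "g l = (real N - 1) / real N ^ Suc l - real (d l) / real N ^ Suc l + real (d' l) / real N ^ Suc l" for l
  have g_nonneg: "0 \<le> g l" for l
  proof -
    have "real (d l) \<le> real N - 1" using d(1)[of l] by linarith
    then have "0 \<le> (real N - 1 - real (d l) + real (d' l)) / real N ^ Suc l"
      by (intro divide_nonneg_nonneg) auto
    then show ?thesis by (simp add: g_def add_divide_distrib diff_divide_distrib)
  qed
  have "g sums (1 - (\<Sum>l. real (d l) / real N ^ Suc l) + (\<Sum>l. real (d' l) / real N ^ Suc l))"
    unfolding g_def by (intro sums_add sums_diff geo summable_sums summ d)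
  then have g: "g sums 1" using eq by simp
  have partial: "(\<Sum>l<m. g l) = 1 - 1 / real N ^ m"
  proof -
    have "(\<Sum>l<m. g l) = (\<Sum>l<m. (real N - 1) / real N ^ Suc l)"
      using less(1) by (intro sum.cong) (auto simp: g_def)
    also have "\<dots> = 1 - 1 / real N ^ m"
    proof (induction m)
      case (Suc m)
      have "1 - 1 / real N ^ m + (real N - 1) / real N ^ Suc m = 1 - 1 / real N ^ Suc m"
        using N1 by (simp add: field_simps)
      then show ?case using Suc by simp
    qed simp
    finally show ?thesis .
  qed
  have "g m = (real N - 1 + real (d' m) - real (d m)) / real N ^ Suc m"
    by (simp add: g_def add_divide_distrib diff_divide_distrib)
  moreover have "real N \<le> real N - 1 + real (d' m) - real (d m)" using less(2) by linarith
  ultimately have "real N / real N ^ Suc m \<le> g m" by (simp only: divide_right_mono zero_le_power of_nat_0_le_iff)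
  then have gm: "1 / real N ^ m \<le> g m" using N1 by simp
  have "g l = 0" if "m < l" for l
  proof -
    have "(\<Sum>l<m. g l) + g m + g l \<le> 1"
    proof -
      have "sum g (insert l {..<Suc m}) \<le> (\<Sum>l. g l)"
        using g g_nonneg by (intro sum_le_suminf) (auto simp: sums_iff)
      then show ?thesis using g that by (simp add: sums_iff)
    qed
    then show ?thesis using partial gm g_nonneg[of l] by simp
  qed
  then have "(real N - 1 - real (d l) + real (d' l)) / real N ^ Suc l = 0" if "m < l" for l
    using that by (simp add: g_def add_divide_distrib diff_divide_distrib)
  then have tail: "real N - 1 - real (d l) + real (d' l) = 0" if "m < l" for l using that N1 by simp
  have "d l = N - 1 \<and> d' l = 0" if "m < l" for l
    using tail[OF that] d(1)[of l] by linarith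
  then show ?thesis by blast
qed

lemma countable_eventually_constant:
  "countable {d :: nat \<Rightarrow> nat. \<exists>m c. \<forall>l>m. d l = c}"
proof -
  have "countable {d :: nat \<Rightarrow> nat. \<forall>l>m. d l = c}" for m c
  proof (rule countableI')
    show "inj_on (\<lambda>d. to_nat (map d [0..<Suc m])) {d :: nat \<Rightarrow> nat. \<forall>l>m. d l = c}"
    proof (rule inj_onI, rule ext)
      fix d d' :: "nat \<Rightarrow> nat" and l
      assume "d \<in> {d. \<forall>l>m. d l = c}" "d' \<in> {d. \<forall>l>m. d l = c}"
        "to_nat (map d [0..<Suc m]) = to_nat (map d' [0..<Suc m])"
      then show "d l = d' l" by (cases "l > m") (auto simp del: upt_Suc)
    qed
  qed
  moreover have "{d :: nat \<Rightarrow> nat. \<exists>m c. \<forall>l>m. d l = c} = (\<Union>m. \<Union>c. {d. \<forall>l>m. d l = c})" by auto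
  ultimately show ?thesis by simp
qed

section \<open>Hausdorff measure of points\<close>

lemma hausdorff_outer_singleton:
  fixes t :: "'a::metric_space"
  assumes "0 < s"
  shows "hausdorff_outer s {t} = 0"
proof -
  have "hausdorff_content s \<delta> {t} = 0" if "0 < \<delta>" for \<delta>
  proof -
    \<comment> \<open>The point itself covers the point, with diameter 0; the power is 0 since
      \<open>s\<close> is positive.\<close>
    have "hausdorff_content s \<delta> {t} \<le> (\<Sum>j. diam_pow s ((\<lambda>_::nat. {t}) j))"
      unfolding hausdorff_content_def using that by (intro INF_lower) auto
    also have "\<dots> = 0" using assms by (simp add: diam_pow_def)
    finally show ?thesis by simp
  qed
  then have "((\<lambda>\<delta>. hausdorff_content s \<delta> {t}) \<longlongrightarrow> 0) (at_right 0)"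
    by (intro tendsto_eventually) (auto simp: eventually_at_right_less intro: eventually_mono[OF eventually_at_right_less])
  then show ?thesis unfolding hausdorff_outer_def by (intro tendsto_Lim) auto
qed

lemma normalized_hausdorff_singleton:
  fixes t :: "'a::metric_space"
  assumes "0 < s" "X \<in> hausdorff_sets s" "t \<in> X"
  shows "emeasure (normalized_hausdorff s X) {t} = 0"
proof -
  have "emeasure (hausdorff_measure s) {t} = 0"
    \<comment> \<open>\<open>measure_of\<close> returns either the value of the outer measure or 0,
      and both are 0 here.\<close>
    unfolding hausdorff_measure_def emeasure_measure_of_conv
    by (simp add: hausdorff_outer_singleton assms(1))
  moreover have "X \<inter> space (hausdorff_measure s) \<in> sets (hausdorff_measure s)"
    using assms(2) by (simp add: hausdorff_measure_def sets_measure_of space_measure_of)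
  ultimately show ?thesis
    unfolding normalized_hausdorff_def using assms(3) by (simp add: emeasure_restrict_space)
qed

text \<open>
  The paper's edge $f_{ij}$ is the edge number \<open>m\<close>, counted from zero, with \<open>i = edge_axis k m\<close> and
  \<open>j = edge_round k m\<close>; it starts at degree \<open>prefix_deg k m\<close>.
\<close>

definition edge_axis :: "nat \<Rightarrow> nat \<Rightarrow> nat" where
  "edge_axis k m = m mod k + 1"

definition edge_round :: "nat \<Rightarrow> nat \<Rightarrow> nat" where
  "edge_round k m = m div k + 1"

definition prefix_deg :: "nat \<Rightarrow> nat \<Rightarrow> nat \<Rightarrow> nat" where
  "prefix_deg k m = edge_start k (edge_axis k m) (edge_round k m)"

section \<open>Prefixes of infinite paths and compactness\<close>

context kgraph
begin

lemma edge_axis_range: "edge_axis k m \<in> {1..k}"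
  using k_pos by (auto simp: edge_axis_def Suc_le_eq)

lemma unit_deg_Nk: "i \<in> {1..k} \<Longrightarrow> unit_deg i \<in> Nk k"
  by (auto simp: unit_deg_def Nk_def)

lemma prefix_deg_Nk [simp]: "prefix_deg k m \<in> Nk k"
  by (auto simp: prefix_deg_def edge_start_def Nk_def)

lemma prefix_deg_0: "prefix_deg k 0 = 0"
  by (auto simp: prefix_deg_def edge_start_def edge_axis_def edge_round_def fun_eq_iff)

lemma prefix_deg_Suc: "prefix_deg k (Suc m) = prefix_deg k m + unit_deg (edge_axis k m)"
proof (rule ext)
  fix l
  have "m mod k < k" using k_pos by simp
  then show "prefix_deg k (Suc m) l = (prefix_deg k m + unit_deg (edge_axis k m)) l"
    by (auto simp: prefix_deg_def edge_start_def edge_axis_def edge_round_def unit_deg_def mod_Suc div_Suc)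
qed

lemma prefix_deg_cofinal:
  assumes "n \<in> Nk k"
  shows "\<exists>m. n \<le> prefix_deg k m"
proof (intro exI le_funI)
  fix l
  \<comment> \<open>After \<open>k * j\<close> edges exactly \<open>j\<close> full rounds are
    completed, so the degree is \<open>j\<close> in every coordinate.\<close>
  show "n l \<le> prefix_deg k (k * Max (n ` {1..k})) l"
  proof (cases "l \<in> {1..k}")
    case True
    then have "n l \<le> Max (n ` {1..k})" by (intro Max_ge) auto
    then show ?thesis using True k_pos by (simp add: prefix_deg_def edge_start_def edge_axis_def edge_round_def)
  qed (use assms in \<open>simp add: Nk_def\<close>)
qed

lemma path_eq_from_prefix:
  assumes x: "x \<in> infinite_paths k \<Lambda>" "x' \<in> infinite_paths k \<Lambda>"
    and pq: "p \<in> Nk k" "q \<in> Nk k" "p \<le> q" "q \<le> prefix_deg k m"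
    and eq: "x (0, prefix_deg k m) = x' (0, prefix_deg k m)"
  shows "x (p, q) = x' (p, q)"
proof -
  interpret x: infinite_path k \<Lambda> x by unfold_locales (rule x(1))
  interpret x': infinite_path k \<Lambda> x' by unfold_locales (rule x(2))
  have "x (0, q) = x' (0, q)" "x (0, p) = x' (0, p)"
    using initial_segment[OF x _ prefix_deg_Nk _ eq] pq order_trans by blast+
  then have "composite \<Lambda> (x (0, p)) (x (p, q)) = composite \<Lambda> (x' (0, p)) (x' (p, q))"
    using x.y_comp[of 0 p q] x'.y_comp[of 0 p q] pq(1-3) by simp
  then show ?thesis
    by (rule factor_unique(2)[rotated 6]) (simp_all add: pq(1-3))
qed

lemma path_eqI:
  assumes x: "x \<in> infinite_paths k \<Lambda>" "x' \<in> infinite_paths k \<Lambda>"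
    and eq: "\<And>m. x (0, prefix_deg k m) = x' (0, prefix_deg k m)"
  shows "x = x'"
proof (rule extensionalityI)
  show "x \<in> extensional (mor (Omega k))" "x' \<in> extensional (mor (Omega k))"
    using x by (auto simp: infinite_paths_def)
  fix pq assume "pq \<in> mor (Omega k)"
  then obtain p q where pq: "pq = (p, q)" "p \<in> Nk k" "q \<in> Nk k" "p \<le> q" by (auto simp: Omega_def)
  obtain m where "q \<le> prefix_deg k m" using prefix_deg_cofinal[OF pq(3)] by blast
  then show "x pq = x' pq" using path_eq_from_prefix[OF x pq(2-4) _ eq] pq(1) by simp
qed

text \<open>Prefixes determine all segments, so every segment is eventually constant. Each morphism
  law involves finitely many segments and therefore passes to the limit.\<close>

lemma path_limit:
  assumes X: "\<And>n::nat. X n \<in> infinite_paths k \<Lambda>"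
    and conv: "\<And>m. \<exists>c. \<forall>\<^sub>F n in sequentially. X n (0, prefix_deg k m) = c"
  obtains x where "x \<in> infinite_paths k \<Lambda>"
    "\<And>pq. pq \<in> mor (Omega k) \<Longrightarrow> \<forall>\<^sub>F n in sequentially. X n pq = x pq"
proof -
  have "\<exists>c. \<forall>\<^sub>F n in sequentially. X n pq = c" if pq0: "pq \<in> mor (Omega k)" for pq
  proof -
    obtain p q where pq: "pq = (p, q)" "p \<in> Nk k" "q \<in> Nk k" "p \<le> q"
      using pq0 by (auto simp: Omega_def)
    obtain m where m: "q \<le> prefix_deg k m" using prefix_deg_cofinal[OF pq(3)] by blast
    obtain c n0 where c: "\<And>n. n \<ge> n0 \<Longrightarrow> X n (0, prefix_deg k m) = c"
      using conv[of m] by (auto simp: eventually_sequentially)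
    have "X n pq = X n0 pq" if "n \<ge> n0" for n
      unfolding pq(1) using path_eq_from_prefix[OF X X pq(2-4) m] c[OF that] c[of n0] by simp
    then show ?thesis unfolding eventually_sequentially by blast
  qed
  then obtain c where c: "\<And>pq. pq \<in> mor (Omega k) \<Longrightarrow> \<forall>\<^sub>F n in sequentially. X n pq = c pq"
    by metis
  define x where "x = restrict c (mor (Omega k))"
  have ev: "\<forall>\<^sub>F n in sequentially. X n pq = x pq" if "pq \<in> mor (Omega k)" for pq
    using c[OF that] that by (simp add: x_def)
  have hom: "kgraph_morphism (Omega k) \<Lambda> (X n)" for n using X[of n] by (simp add: infinite_paths_def)
  have "kgraph_morphism (Omega k) \<Lambda> x"
    unfolding kgraph_morphism_def
  proof (intro conjI ballI impI)
    fix \<mu> assume \<mu>: "\<mu> \<in> mor (Omega k)"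
    then have rs: "rng (Omega k) \<mu> \<in> mor (Omega k)" "src (Omega k) \<mu> \<in> mor (Omega k)"
      by (auto simp: Omega_def)
    have "\<forall>\<^sub>F n in sequentially. X n \<mu> = x \<mu> \<and> X n (rng (Omega k) \<mu>) = x (rng (Omega k) \<mu>) \<and>
        X n (src (Omega k) \<mu>) = x (src (Omega k) \<mu>)"
      using ev[OF \<mu>] ev[OF rs(1)] ev[OF rs(2)] by eventually_elim simp
    then obtain n where "X n \<mu> = x \<mu>" "X n (rng (Omega k) \<mu>) = x (rng (Omega k) \<mu>)"
      "X n (src (Omega k) \<mu>) = x (src (Omega k) \<mu>)"
      using eventually_happens'[OF sequentially_bot] by blast
    then show "x \<mu> \<in> mor \<Lambda>" "rng \<Lambda> (x \<mu>) = x (rng (Omega k) \<mu>)" "src \<Lambda> (x \<mu>) = x (src (Omega k) \<mu>)"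
      "deg \<Lambda> (x \<mu>) = deg (Omega k) \<mu>"
      using hom[of n] \<mu> unfolding kgraph_morphism_def by metis+
  next
    fix \<mu> \<nu> assume \<mu>\<nu>: "\<mu> \<in> mor (Omega k)" "\<nu> \<in> mor (Omega k)" "src (Omega k) \<mu> = rng (Omega k) \<nu>"
    then have "composite (Omega k) \<mu> \<nu> \<in> mor (Omega k)" by (auto simp: Omega_def intro: order_trans)
    then have "\<forall>\<^sub>F n in sequentially. X n \<mu> = x \<mu> \<and> X n \<nu> = x \<nu> \<and>
        X n (composite (Omega k) \<mu> \<nu>) = x (composite (Omega k) \<mu> \<nu>)"
      using ev[OF \<mu>\<nu>(1)] ev[OF \<mu>\<nu>(2)] ev by (intro eventually_conj) auto
    then obtain n where "X n \<mu> = x \<mu>" "X n \<nu> = x \<nu>"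
      "X n (composite (Omega k) \<mu> \<nu>) = x (composite (Omega k) \<mu> \<nu>)"
      using eventually_happens'[OF sequentially_bot] by blast
    then show "x (composite (Omega k) \<mu> \<nu>) = composite \<Lambda> (x \<mu>) (x \<nu>)"
      using hom[of n] \<mu>\<nu> unfolding kgraph_morphism_def by metis
  qed
  then have "x \<in> infinite_paths k \<Lambda>" by (simp add: infinite_paths_def x_def)
  then show ?thesis using ev that by blast
qed

text \<open>There are finitely many paths of each degree, so subsequences with a constant prefix
  exist and a diagonal sequence settles all prefixes.\<close>

lemma path_compactness:
  assumes fin: "finite_kgraph k \<Lambda>" and X: "\<And>n::nat. X n \<in> infinite_paths k \<Lambda>"
  obtains r x where "strict_mono (r :: nat \<Rightarrow> nat)" "x \<in> infinite_paths k \<Lambda>"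
    "\<forall>pq \<in> mor (Omega k). \<forall>\<^sub>F n in sequentially. X (r n) pq = x pq"
proof -
  \<comment> \<open>The property is inherited by further subsequences, as the diagonal argument
    requires.\<close>
  define P where "P m r \<longleftrightarrow> (\<exists>c. \<forall>n. X (r n) (0, prefix_deg k m) = c)" for m and r :: "nat \<Rightarrow> nat"
  interpret subseqs P
  proof
    fix m :: nat and r :: "nat \<Rightarrow> nat"
    let ?g = "\<lambda>n. X (r n) (0, prefix_deg k m)"
    have "?g n \<in> paths_deg \<Lambda> (prefix_deg k m)" for n
    proof -
      interpret infinite_path k \<Lambda> "X (r n)" by unfold_locales (rule X)
      show ?thesis by (simp add: paths_deg_def)
    qed
    then have "finite (range ?g)"
      using fin by (intro finite_subset[of "range ?g" "paths_deg \<Lambda> (prefix_deg k m)"]) (auto simp: finite_kgraph_def)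
    then obtain n0 where "infinite {n \<in> UNIV. ?g n = ?g n0}"
      using pigeonhole_infinite[of UNIV ?g] by auto
    then obtain r' :: "nat \<Rightarrow> nat" where "strict_mono r'" "\<forall>n. r' n \<in> {n \<in> UNIV. ?g n = ?g n0}"
      using infinite_enumerate by blast
    then show "\<exists>r'. strict_mono r' \<and> P m (r \<circ> r')" by (auto simp: P_def)
  qed
  have "\<exists>c. \<forall>\<^sub>F n in sequentially. X (diagseq n) (0, prefix_deg k m) = c" for m
  proof -
    have "P m (diagseq \<circ> (+) (Suc m))" by (rule diagseq_holds) (auto simp: P_def)
    then obtain c where c: "\<And>n. X (diagseq (Suc m + n)) (0, prefix_deg k m) = c"
      by (auto simp: P_def)
    have "X (diagseq n) (0, prefix_deg k m) = c" if "n \<ge> Suc m" for n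
      using c[of "n - Suc m"] that by simp
    then show ?thesis unfolding eventually_sequentially by blast
  qed
  then show ?thesis
    using path_limit[of "\<lambda>n. X (diagseq n)"] X subseq_diagseq that by metis
qed

end

section \<open>Digits of a path\<close>

locale labelled_kgraph = kgraph k \<Lambda> for k and \<Lambda> :: "'g kgraph" +
  fixes lab :: "'g \<Rightarrow> nat"
  assumes finite_graph: "finite_kgraph k \<Lambda>"
    and labelling: "vertex_labelling \<Lambda> lab"
    and zero_one: "\<And>i. i \<in> {1..k} \<Longrightarrow> zero_one_mat (vertex_mat \<Lambda> lab i)"
begin

definition base_card :: nat where "base_card = card (vertices \<Lambda>)"

definition digit :: "'g ipath \<Rightarrow> nat \<Rightarrow> nat" where
  "digit x m = lab (x (prefix_deg k m, prefix_deg k m))"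

lemma lab_less: "v \<in> vertices \<Lambda> \<Longrightarrow> lab v < base_card"
  using labelling by (auto simp: vertex_labelling_def base_card_def bij_betw_def)

lemma lab_inj: "\<lbrakk>v \<in> vertices \<Lambda>; w \<in> vertices \<Lambda>; lab v = lab w\<rbrakk> \<Longrightarrow> v = w"
  using labelling by (auto simp: vertex_labelling_def bij_betw_def inj_on_def)

text \<open>The entry of the vertex matrix at the labels of the two endpoints counts the edges
  between them, and it is at most 1.\<close>

lemma edge_unique:
  assumes i: "i \<in> {1..k}" and e: "e \<in> mor \<Lambda>" "deg \<Lambda> e = unit_deg i" and f: "f \<in> mor \<Lambda>" "deg \<Lambda> f = unit_deg i"
    and eq: "rng \<Lambda> e = rng \<Lambda> f" "src \<Lambda> e = src \<Lambda> f"
  shows "e = f"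
proof -
  define v w where "v = rng \<Lambda> e" and "w = src \<Lambda> e"
  have vw: "v \<in> vertices \<Lambda>" "w \<in> vertices \<Lambda>" using e by (auto simp: v_def w_def)
  have inj: "inj_on lab (vertices \<Lambda>)" using labelling by (simp add: vertex_labelling_def bij_betw_def)
  define E where "E = {\<kappa> \<in> paths_deg \<Lambda> (unit_deg i). rng \<Lambda> \<kappa> = v \<and> src \<Lambda> \<kappa> = w}"
  have "finite E"
    using finite_graph unit_deg_Nk[OF i] by (auto simp: E_def finite_kgraph_def)
  have "vertex_mat \<Lambda> lab i $$ (lab v, lab w) = card E"
    using lab_less[OF vw(1)] lab_less[OF vw(2)] vw inj
    by (simp add: vertex_mat_def base_card_def vertex_matrix_def the_inv_into_f_f E_def)
  moreover have "vertex_mat \<Lambda> lab i $$ (lab v, lab w) \<in> {0, 1}"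
    using zero_one[OF i] lab_less[OF vw(1)] lab_less[OF vw(2)]
    unfolding zero_one_mat_def by (simp add: vertex_mat_def base_card_def)
  ultimately have "card E \<le> Suc 0" by auto
  then have "\<forall>a\<in>E. \<forall>b\<in>E. a = b" using \<open>finite E\<close> by (simp add: card_le_Suc0_iff_eq)
  moreover have "e \<in> E" "f \<in> E" using e f eq by (auto simp: E_def paths_deg_def v_def w_def)
  ultimately show ?thesis by blast
qed

lemma path_vertex:
  assumes "x \<in> infinite_paths k \<Lambda>" "p \<in> Nk k"
  shows "x (p, p) \<in> vertices \<Lambda>"
proof -
  interpret infinite_path k \<Lambda> x by unfold_locales (rule assms(1))
  show ?thesis using assms(2) by (intro deg_zero_vertex) (simp_all add: fun_eq_iff)
qed

lemma digit_less: "x \<in> infinite_paths k \<Lambda> \<Longrightarrow> digit x m < base_card"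
  unfolding digit_def by (intro lab_less path_vertex) simp_all

text \<open>The digits name the vertices along the path. Two consecutive vertices and the known
  direction of the edge between them determine that edge.\<close>

lemma digits_determine_prefix:
  assumes x: "x \<in> infinite_paths k \<Lambda>" "x' \<in> infinite_paths k \<Lambda>"
    and eq: "\<And>l. l \<le> m \<Longrightarrow> digit x l = digit x' l"
  shows "x (0, prefix_deg k m) = x' (0, prefix_deg k m)"
proof -
  have vertex: "x (prefix_deg k l, prefix_deg k l) = x' (prefix_deg k l, prefix_deg k l)"
    if "digit x l = digit x' l" for l
    using that x by (auto simp: digit_def intro!: lab_inj path_vertex)
  show ?thesis
    using eq
  proof (induction m)
    case 0
    show ?case
      unfolding prefix_deg_0 by (rule vertex[of 0, unfolded prefix_deg_0]) (rule 0[OF order_refl])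
  next
    case (Suc m)
    interpret x: infinite_path k \<Lambda> x by unfold_locales (rule x(1))
    interpret x': infinite_path k \<Lambda> x' by unfold_locales (rule x(2))
    define p q where "p = prefix_deg k m" and "q = prefix_deg k (Suc m)"
    have pq: "p \<in> Nk k" "q \<in> Nk k" by (simp_all add: p_def q_def)
    have pq': "p \<le> q" "q - p = unit_deg (edge_axis k m)"
      by (simp_all add: p_def q_def prefix_deg_Suc le_fun_def fun_eq_iff)
    have ends: "x (p, p) = x' (p, p)" "x (q, q) = x' (q, q)"
      unfolding p_def q_def by (rule vertex, rule Suc.prems, simp)+
    have "x (p, q) = x' (p, q)"
      by (rule edge_unique[OF edge_axis_range[of m]]) (simp_all add: pq pq' ends)
    moreover have "x (0, p) = x' (0, p)" unfolding p_def by (rule Suc.IH, rule Suc.prems, simp)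
    ultimately have "x (0, q) = x' (0, q)"
      using x.y_comp[of 0 p q] x'.y_comp[of 0 p q] pq pq' by simp
    then show ?case unfolding q_def .
  qed
qed

lemma digit_inj: "\<lbrakk>x \<in> infinite_paths k \<Lambda>; x' \<in> infinite_paths k \<Lambda>; digit x = digit x'\<rbrakk> \<Longrightarrow> x = x'"
  by (intro path_eqI digits_determine_prefix) auto

lemma bij_edges: "bij_betw (\<lambda>m. (edge_axis k m, edge_round k m)) UNIV ({1..k} \<times> {1..})"
proof (rule bij_betwI[where g = "\<lambda>(i, j). (j - 1) * k + (i - 1)"])
  show "(\<lambda>(i, j). (j - 1) * k + (i - 1)) (edge_axis k m, edge_round k m) = m" if "m \<in> UNIV" for m
    by (simp add: edge_axis_def edge_round_def)
  fix p :: "nat \<times> nat" assume p: "p \<in> {1..k} \<times> {1..}"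
  then obtain i j where ij: "p = (Suc i, Suc j)" "i < k"
    by (metis SigmaE Suc_le_eq atLeastAtMost_iff atLeast_iff One_nat_def Suc_pred)
  then show "(edge_axis k ((\<lambda>(i, j). (j - 1) * k + (i - 1)) p), edge_round k ((\<lambda>(i, j). (j - 1) * k + (i - 1)) p)) = p"
    by (simp add: edge_axis_def edge_round_def)
qed (use edge_axis_range in \<open>auto simp: edge_round_def\<close>)

lemma Psi_digits:
  assumes "x \<in> infinite_paths k \<Lambda>"
  shows "(\<lambda>m. real (digit x m) / real base_card ^ Suc m) sums Psi k \<Lambda> lab x"
proof -
  interpret infinite_path k \<Lambda> x by unfold_locales (rule assms)
  let ?f = "\<lambda>(i, j). real (lab (rng \<Lambda> (path_edge k x i j))) / real base_card ^ (i + k * (j - 1))"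
  have f: "?f (edge_axis k m, edge_round k m) = real (digit x m) / real base_card ^ Suc m" for m
  proof -
    have "path_edge k x (edge_axis k m) (edge_round k m) = x (prefix_deg k m, prefix_deg k m + unit_deg (edge_axis k m))"
      by (simp add: path_edge_def prefix_deg_def)
    then have "rng \<Lambda> (path_edge k x (edge_axis k m) (edge_round k m)) = x (prefix_deg k m, prefix_deg k m)"
      using edge_axis_range[of m] by (simp add: unit_deg_Nk le_fun_def)
    \<comment> \<open>Edges are counted from zero, whereas the exponents of the expansion start at
      1.\<close>
    moreover have "edge_axis k m + k * (edge_round k m - 1) = Suc m" by (simp add: edge_axis_def edge_round_def)
    ultimately show ?thesis by (simp add: digit_def)
  qed
  have "Psi k \<Lambda> lab x = infsum ?f ({1..k} \<times> {1..})"
    by (simp add: Psi_def base_card_def)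
  also have "\<dots> = infsum (\<lambda>m. ?f (edge_axis k m, edge_round k m)) UNIV"
    by (rule infsum_reindex_bij_betw[OF bij_edges, symmetric])
  also have "\<dots> = infsum (\<lambda>m. real (digit x m) / real base_card ^ Suc m) UNIV"
    by (simp only: f)
  finally have Psi: "Psi k \<Lambda> lab x = infsum (\<lambda>m. real (digit x m) / real base_card ^ Suc m) UNIV" .
  have "summable (\<lambda>m. real (digit x m) / real base_card ^ Suc m)"
  proof (cases "base_card \<le> 1")
    \<comment> \<open>In base 1 the geometric comparison series diverges, but every digit is
      0.\<close>
    case True
    then have "digit x m = 0" for m using digit_less[OF assms, of m] by simp
    then show ?thesis by simp
  next
    case False
    show ?thesis
    proof (rule summable_comparison_test')
      show "summable (\<lambda>m. (1 / real base_card) ^ m)" using False by (intro summable_geometric) simp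
      show "norm (real (digit x m) / real base_card ^ Suc m) \<le> (1 / real base_card) ^ m" if "0 \<le> m" for m
      proof -
        have "real (digit x m) / real base_card ^ Suc m \<le> real base_card / real base_card ^ Suc m"
          using digit_less[OF assms, of m] by (intro divide_right_mono) auto
        then show ?thesis using False by (simp add: power_divide)
      qed
    qed
  qed
  then have sums: "(\<lambda>m. real (digit x m) / real base_card ^ Suc m) sums (\<Sum>m. real (digit x m) / real base_card ^ Suc m)"
    by (rule summable_sums)
  then have "((\<lambda>m. real (digit x m) / real base_card ^ Suc m) has_sum (\<Sum>m. real (digit x m) / real base_card ^ Suc m)) UNIV"
    by (rule sums_nonneg_imp_has_sum) simp
  then show ?thesis using sums Psi by (simp add: infsumI)
qed

text \<open>Distinct paths have a first differing digit, and equality of the values then forces both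
  expansions to be eventually constant.\<close>

lemma Psi_collision:
  assumes x: "x \<in> infinite_paths k \<Lambda>" "x' \<in> infinite_paths k \<Lambda>"
    and eq: "Psi k \<Lambda> lab x = Psi k \<Lambda> lab x'" and ne: "x \<noteq> x'"
  shows "\<exists>m c. \<forall>l>m. digit x l = c"
proof -
  have ex: "\<exists>m. digit x m \<noteq> digit x' m" using digit_inj[OF x] ne by blast
  define m where "m = (LEAST m. digit x m \<noteq> digit x' m)"
  have m: "digit x m \<noteq> digit x' m" unfolding m_def using ex by (rule LeastI_ex)
  have less: "digit x l = digit x' l" if "l < m" for l using not_less_Least[of l "\<lambda>m. digit x m \<noteq> digit x' m"] that
    by (auto simp: m_def)
  have sum_eq: "(\<Sum>m. real (digit x m) / real base_card ^ Suc m) = (\<Sum>m. real (digit x' m) / real base_card ^ Suc m)"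
    using Psi_digits[OF x(1)] Psi_digits[OF x(2)] eq by (simp add: sums_iff)
  show ?thesis
  proof (cases "digit x m < digit x' m")
    case True
    have "\<forall>l>m. digit x l = base_card - 1 \<and> digit x' l = 0"
      by (rule expansions_differ) (use digit_less x sum_eq less True in auto)
    then show ?thesis by blast
  next
    case False
    then have "digit x' m < digit x m" using m by simp
    have "\<forall>l>m. digit x' l = base_card - 1 \<and> digit x l = 0"
      by (rule expansions_differ) (use digit_less x sum_eq less \<open>digit x' m < digit x m\<close> in auto)
    then show ?thesis by blast
  qed
qed

lemma countable_collisions:
  "countable {x \<in> infinite_paths k \<Lambda>. \<exists>m c. \<forall>l>m. digit x l = c}"
proof (rule countable_image_inj_on)
  show "countable (digit ` {x \<in> infinite_paths k \<Lambda>. \<exists>m c. \<forall>l>m. digit x l = c})"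
    by (rule countable_subset[OF _ countable_eventually_constant]) blast
  show "inj_on digit {x \<in> infinite_paths k \<Lambda>. \<exists>m c. \<forall>l>m. digit x l = c}"
    by (rule inj_onI) (auto intro: digit_inj)
qed

text \<open>The ratio 1/2 serves every base from 2 on, and in base 1 all digits vanish; the estimate
  is thus independent of the base.\<close>

lemma Psi_close:
  assumes x: "x \<in> infinite_paths k \<Lambda>" "x' \<in> infinite_paths k \<Lambda>"
    and eq: "\<And>l. l < m \<Longrightarrow> digit x l = digit x' l"
  shows "\<bar>Psi k \<Lambda> lab x - Psi k \<Lambda> lab x'\<bar> \<le> 2 * (1 / 2) ^ m"
proof -
  define g where "g l = real (digit x l) / real base_card ^ Suc l - real (digit x' l) / real base_card ^ Suc l" for l
  have g: "g sums (Psi k \<Lambda> lab x - Psi k \<Lambda> lab x')"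
    unfolding g_def by (intro sums_diff Psi_digits x)
  have g_le: "\<bar>g l\<bar> \<le> (1 / 2) ^ l" for l
  proof (cases "base_card \<le> 1")
    case True
    then have "digit x l = 0" "digit x' l = 0" using digit_less[OF x(1), of l] digit_less[OF x(2), of l] by auto
    then show ?thesis by (simp add: g_def)
  next
    case False
    have "\<bar>real (digit x l) - real (digit x' l)\<bar> \<le> real base_card"
      using digit_less[OF x(1), of l] digit_less[OF x(2), of l] by simp
    then have "\<bar>real (digit x l) - real (digit x' l)\<bar> / real base_card ^ Suc l \<le> real base_card / real base_card ^ Suc l"
      by (intro divide_right_mono) auto
    then have "\<bar>g l\<bar> \<le> real base_card / real base_card ^ Suc l"
      unfolding g_def diff_divide_distrib[symmetric] abs_divide by simp
    also have "\<dots> = (1 / real base_card) ^ l" using False by (simp add: power_divide)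
    also have "\<dots> \<le> (1 / 2) ^ l" using False by (intro power_mono) (auto simp: field_simps)
    finally show ?thesis .
  qed
  have "(\<Sum>l<m. g l) = 0" using eq by (simp add: g_def)
  then have tail: "(\<lambda>l. g (l + m)) sums (Psi k \<Lambda> lab x - Psi k \<Lambda> lab x')"
    using sums_split_initial_segment[OF g, of m] by simp
  have geo: "(\<lambda>l. (1 / 2 :: real) ^ (l + m)) sums (2 * (1 / 2) ^ m)"
    using sums_mult2[OF geometric_sums[of "1 / 2 :: real"], of "(1 / 2) ^ m"] by (simp add: power_add)
  have "norm (\<Sum>l. g (l + m)) \<le> (\<Sum>l. (1 / 2) ^ (l + m))"
    by (rule norm_suminf_le) (use g_le sums_summable[OF geo] in simp_all)
  then show ?thesis using tail geo by (simp add: sums_iff)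
qed

text \<open>A sequential form of the fact that continuous images of compact sets are compact. It
  makes the image a Borel set, to which the push-forward formula applies.\<close>

lemma closed_Psi_cylinder:
  assumes \<kappa>: "\<kappa> \<in> mor \<Lambda>"
  shows "closed (Psi k \<Lambda> lab ` cylinder k \<Lambda> \<kappa>)"
  unfolding closed_sequential_limits
proof (intro allI impI; elim conjE)
  fix f t assume f: "\<forall>n. f n \<in> Psi k \<Lambda> lab ` cylinder k \<Lambda> \<kappa>" and t: "f \<longlonglongrightarrow> t"
  have "\<exists>z. z \<in> cylinder k \<Lambda> \<kappa> \<and> f n = Psi k \<Lambda> lab z" for n using f by blast
  then obtain X where X: "\<And>n. X n \<in> cylinder k \<Lambda> \<kappa>" "\<And>n. f n = Psi k \<Lambda> lab (X n)"
    by metis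
  have Xp: "X n \<in> infinite_paths k \<Lambda>" "X n (0, deg \<Lambda> \<kappa>) = \<kappa>" for n using cylinderD[OF X(1)] by auto
  obtain r x where r: "strict_mono r" and x: "x \<in> infinite_paths k \<Lambda>"
    and ev: "\<forall>pq \<in> mor (Omega k). \<forall>\<^sub>F n in sequentially. X (r n) pq = x pq"
    using path_compactness[OF finite_graph Xp(1)] .
  have "(0, deg \<Lambda> \<kappa>) \<in> mor (Omega k)" using deg_Nk[OF \<kappa>] by (simp add: Omega_def)
  from eventually_happens'[OF sequentially_bot ev[rule_format, OF this]] have "x \<in> cylinder k \<Lambda> \<kappa>"
    using Xp(2) x by (auto simp: cylinder_def)
  moreover have "(\<lambda>n. Psi k \<Lambda> lab (X (r n))) \<longlonglongrightarrow> Psi k \<Lambda> lab x"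
  proof (rule LIMSEQ_I)
    fix e :: real assume e: "0 < e"
    obtain m where m: "(1 / 2 :: real) ^ m < e / 2" using real_arch_pow_inv[of "e / 2" "1 / 2"] e by auto
    have "\<forall>\<^sub>F n in sequentially. \<forall>l\<in>{..<m}. X (r n) (prefix_deg k l, prefix_deg k l) = x (prefix_deg k l, prefix_deg k l)"
      by (intro eventually_ball_finite ballI ev[rule_format]) (auto simp: Omega_def)
    then have "\<forall>\<^sub>F n in sequentially. norm (Psi k \<Lambda> lab (X (r n)) - Psi k \<Lambda> lab x) < e"
    proof eventually_elim
      case (elim n)
      then have "\<bar>Psi k \<Lambda> lab (X (r n)) - Psi k \<Lambda> lab x\<bar> \<le> 2 * (1 / 2) ^ m"
        by (intro Psi_close Xp x) (auto simp: digit_def)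
      then show ?case using m by simp
    qed
    then show "\<exists>no. \<forall>n\<ge>no. norm (Psi k \<Lambda> lab (X (r n)) - Psi k \<Lambda> lab x) < e"
      by (simp add: eventually_sequentially)
  qed
  moreover have "(\<lambda>n. Psi k \<Lambda> lab (X (r n))) \<longlonglongrightarrow> t"
    using LIMSEQ_subseq_LIMSEQ[OF t r] by (simp add: o_def X(2))
  ultimately have "t = Psi k \<Lambda> lab x" using LIMSEQ_unique by blast
  then show "t \<in> Psi k \<Lambda> lab ` cylinder k \<Lambda> \<kappa>" using \<open>x \<in> cylinder k \<Lambda> \<kappa>\<close> by blast
qed

section \<open>Measure of the image of a cylinder\<close>

lemma cylinder_sets:
  assumes "sets M = sets (path_borel k \<Lambda>)" "\<kappa> \<in> mor \<Lambda>"
  shows "cylinder k \<Lambda> \<kappa> \<in> sets M"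
proof -
  have "{U. openin (path_topology k \<Lambda>) U} \<subseteq> Pow (infinite_paths k \<Lambda>)"
    using openin_subset by (fastforce simp: path_topology_def cylinder_def)
  moreover have "openin (path_topology k \<Lambda>) (cylinder k \<Lambda> \<kappa>)"
    unfolding path_topology_def using assms(2) by (intro topology_generated_by_Basis) blast
  ultimately show ?thesis unfolding assms(1) path_borel_def by (simp add: sets_measure_of)
qed

lemma space_path_measure:
  assumes "sets M = sets (path_borel k \<Lambda>)"
  shows "space M = infinite_paths k \<Lambda>"
  using sets_eq_imp_space_eq[OF assms] by (simp add: path_borel_def space_measure_of_conv)

lemma singleton_sets:
  assumes "sets M = sets (path_borel k \<Lambda>)" "x \<in> infinite_paths k \<Lambda>"
  shows "{x} \<in> sets M"
proof -
  interpret infinite_path k \<Lambda> x by unfold_locales (rule assms(2))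
  have deg: "deg \<Lambda> (x (0, prefix_deg k m)) = prefix_deg k m" for m by (simp add: fun_eq_iff)
  have "x' = x" if "x' \<in> (\<Inter>m. cylinder k \<Lambda> (x (0, prefix_deg k m)))" for x'
    by (rule path_eqI) (use that assms(2) deg in \<open>auto simp: cylinder_def\<close>)
  then have "{x} = (\<Inter>m. cylinder k \<Lambda> (x (0, prefix_deg k m)))"
    using assms(2) deg by (auto simp: cylinder_def)
  also have "\<dots> \<in> sets M"
    by (intro sets.countable_INT') (auto intro!: cylinder_sets[OF assms(1)])
  finally show ?thesis .
qed

lemma countable_path_sets:
  assumes "sets M = sets (path_borel k \<Lambda>)" "countable C" "C \<subseteq> infinite_paths k \<Lambda>"
  shows "C \<in> sets M"
proof -
  have "(\<Union>x\<in>C. {x}) \<in> sets M"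
    using assms(2,3) by (intro sets.countable_UN') (auto intro!: singleton_sets[OF assms(1)])
  then show ?thesis by simp
qed

text \<open>The preimage of the image of a cylinder exceeds the cylinder by countably many collision
  paths, each of which lies in a null fibre.\<close>

theorem measure_Psi_cylinder:
  assumes M: "sets M = sets (path_borel k \<Lambda>)"
    and push: "\<And>E. \<lbrakk>E \<in> sets borel; E \<subseteq> Psi k \<Lambda> lab ` infinite_paths k \<Lambda>\<rbrakk> \<Longrightarrow>
      emeasure \<mu> E = emeasure M (Psi k \<Lambda> lab -` E \<inter> infinite_paths k \<Lambda>)"
    and atoms: "\<And>t. t \<in> Psi k \<Lambda> lab ` infinite_paths k \<Lambda> \<Longrightarrow> emeasure \<mu> {t} = 0"
    and \<kappa>: "\<kappa> \<in> mor \<Lambda>"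
  shows "measure \<mu> (Psi k \<Lambda> lab ` cylinder k \<Lambda> \<kappa>) = measure M (cylinder k \<Lambda> \<kappa>)"
proof -
  define C where "C = {x \<in> infinite_paths k \<Lambda>. \<exists>m c. \<forall>l>m. digit x l = c}"
  have C: "countable C" "C \<subseteq> infinite_paths k \<Lambda>" using countable_collisions by (auto simp: C_def)
  have fibre: "Psi k \<Lambda> lab -` Psi k \<Lambda> lab ` Z \<inter> infinite_paths k \<Lambda> \<subseteq> Z \<union> C"
    if Z: "Z \<subseteq> infinite_paths k \<Lambda>" for Z
  proof
    fix x assume "x \<in> Psi k \<Lambda> lab -` Psi k \<Lambda> lab ` Z \<inter> infinite_paths k \<Lambda>"
    then obtain z where z: "z \<in> Z" "Psi k \<Lambda> lab x = Psi k \<Lambda> lab z" "x \<in> infinite_paths k \<Lambda>" by blast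
    show "x \<in> Z \<union> C"
    proof (cases "x = z")
      case False
      have "\<exists>m c. \<forall>l>m. digit x l = c" using Z z by (intro Psi_collision[OF z(3) _ z(2) False]) blast
      then show ?thesis using z(3) by (simp add: C_def)
    qed (use z in simp)
  qed
  have null: "{x} \<in> null_sets M" if x: "x \<in> infinite_paths k \<Lambda>" for x
  proof -
    define t where "t = Psi k \<Lambda> lab x"
    have t: "t \<in> Psi k \<Lambda> lab ` infinite_paths k \<Lambda>" using x by (simp add: t_def)
    define F where "F = Psi k \<Lambda> lab -` {t} \<inter> infinite_paths k \<Lambda>"
    \<comment> \<open>The fibre contains at most one path that is not eventually constant in its
      digits. It is therefore countable, hence measurable, and the push-forward formula computes its
      measure.\<close>
    have "F \<subseteq> {x} \<union> C" using fibre[of "{x}"] x by (simp add: F_def t_def)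
    then have "countable F" by (rule countable_subset) (use C(1) in simp)
    then have "F \<in> sets M" by (rule countable_path_sets[OF M]) (simp add: F_def)
    moreover have "emeasure M F = 0"
      using push[of "{t}"] atoms[OF t] t by (simp add: F_def)
    moreover have "{x} \<subseteq> F" using x by (simp add: F_def t_def)
    ultimately have "emeasure M {x} = 0" using emeasure_mono[of "{x}" F M] by simp
    then show ?thesis using singleton_sets[OF M x] by (simp add: null_setsI)
  qed
  define Z where "Z = cylinder k \<Lambda> \<kappa>"
  have Z: "Z \<subseteq> infinite_paths k \<Lambda>" "Z \<in> sets M"
    using cylinder_sets[OF M \<kappa>] by (auto simp: Z_def cylinder_def)
  define D where "D = Psi k \<Lambda> lab -` Psi k \<Lambda> lab ` Z \<inter> infinite_paths k \<Lambda> - Z"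
  have "countable D" using fibre[OF Z(1)] by (intro countable_subset[OF _ C(1)]) (auto simp: D_def)
  then have "(\<Union>x\<in>D. {x}) \<in> null_sets M"
    by (rule null_sets_UN') (auto simp: D_def intro: null)
  then have D: "D \<in> null_sets M" by simp
  have "emeasure \<mu> (Psi k \<Lambda> lab ` Z) = emeasure M (Psi k \<Lambda> lab -` Psi k \<Lambda> lab ` Z \<inter> infinite_paths k \<Lambda>)"
  proof (rule push)
    show "Psi k \<Lambda> lab ` Z \<in> sets borel"
      unfolding Z_def using closed_Psi_cylinder[OF \<kappa>] by (rule borel_closed)
    show "Psi k \<Lambda> lab ` Z \<subseteq> Psi k \<Lambda> lab ` infinite_paths k \<Lambda>" using Z(1) by blast
  qed
  also have "Psi k \<Lambda> lab -` Psi k \<Lambda> lab ` Z \<inter> infinite_paths k \<Lambda> = Z \<union> D"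
    using Z(1) by (auto simp: D_def)
  also have "emeasure M (Z \<union> D) = emeasure M Z" using Z(2) D by (rule emeasure_Un_null_set)
  finally show ?thesis by (simp add: measure_def Z_def)
qed

end

section \<open>The KMS state\<close>

context labelled_kgraph
begin

text \<open>The path \<open>y\<close> provides an edge in direction \<open>i\<close>. In the
  eigenvector equation at the range of this edge, the left side then has a positive term.\<close>

lemma rho_positive:
  assumes pf: "perron_frobenius_vector k \<Lambda> lab x" and y: "y \<in> infinite_paths k \<Lambda>" and i: "i \<in> {1..k}"
  shows "0 < rho \<Lambda> lab i"
proof -
  interpret infinite_path k \<Lambda> y by unfold_locales (rule y)
  define e where "e = y (0, unit_deg i)"
  have e: "e \<in> mor \<Lambda>" "deg \<Lambda> e = unit_deg i"
    using unit_deg_Nk[OF i] by (simp_all add: e_def le_fun_def fun_eq_iff)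
  define v w where "v = rng \<Lambda> e" and "w = src \<Lambda> e"
  have vw: "v \<in> vertices \<Lambda>" "w \<in> vertices \<Lambda>" using e by (auto simp: v_def w_def)
  have fin: "finite (paths_deg \<Lambda> n)" if "n \<in> Nk k" for n
    using finite_graph that by (simp add: finite_kgraph_def)
  have finv: "finite (vertices \<Lambda>)" using vertices_subset_paths fin[OF zero_Nk] by (rule finite_subset)
  have x: "\<And>v. v \<in> vertices \<Lambda> \<Longrightarrow> 0 < x v"
    "(\<Sum>w\<in>vertices \<Lambda>. real (vertex_matrix \<Lambda> i v w) * x w) = rho \<Lambda> lab i * x v"
    using pf i vw(1) by (auto simp: perron_frobenius_vector_def)
  have "finite {\<kappa> \<in> paths_deg \<Lambda> (unit_deg i). rng \<Lambda> \<kappa> = v \<and> src \<Lambda> \<kappa> = w}"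
    using fin[OF unit_deg_Nk[OF i]] by simp
  moreover have "e \<in> {\<kappa> \<in> paths_deg \<Lambda> (unit_deg i). rng \<Lambda> \<kappa> = v \<and> src \<Lambda> \<kappa> = w}"
    using e by (simp add: paths_deg_def v_def w_def)
  ultimately have "0 < vertex_matrix \<Lambda> i v w" unfolding vertex_matrix_def card_gt_0_iff by blast
  then have "0 < real (vertex_matrix \<Lambda> i v w) * x w" using x(1)[OF vw(2)] by simp
  also have "\<dots> \<le> (\<Sum>w\<in>vertices \<Lambda>. real (vertex_matrix \<Lambda> i v w) * x w)"
    using finv vw(2) x(1)[THEN less_imp_le] by (intro member_le_sum) (auto intro!: mult_nonneg_nonneg)
  finally show ?thesis using x(1)[OF vw(1)] x(2) by (simp add: zero_less_mult_iff)
qed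

text \<open>The additive form of the power of the spectral radii: the measure scales by
  \<open>exp (- weight \<kappa>)\<close>, and the dynamics rotates \<open>S \<kappa>\<close> by the
  angle \<open>t * weight \<kappa> / s\<close>.\<close>

definition weight :: "'g \<Rightarrow> real" where
  "weight \<kappa> = (\<Sum>i = 1..k. real (deg \<Lambda> \<kappa> i) * ln (rho \<Lambda> lab i))"

lemma exp_weight:
  assumes "\<And>i. i \<in> {1..k} \<Longrightarrow> 0 < rho \<Lambda> lab i"
  shows "inverse (\<Prod>i = 1..k. rho \<Lambda> lab i ^ deg \<Lambda> \<kappa> i) = exp (- weight \<kappa>)"
proof -
  have "exp (weight \<kappa>) = (\<Prod>i = 1..k. rho \<Lambda> lab i ^ deg \<Lambda> \<kappa> i)"
    unfolding weight_def by (simp add: exp_sum exp_of_nat_mult assms)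
  then show ?thesis by (simp add: exp_minus)
qed

lemma weight_comp:
  assumes "\<kappa> \<in> mor \<Lambda>" "\<sigma> \<in> mor \<Lambda>" "src \<Lambda> \<kappa> = rng \<Lambda> \<sigma>"
  shows "weight (composite \<Lambda> \<kappa> \<sigma>) = weight \<kappa> + weight \<sigma>"
  using deg_comp[OF assms] by (simp add: weight_def distrib_right sum.distrib)

lemma rho_dynamics_generator:
  assumes gauge: "is_gauge_action k \<Lambda> A S \<gamma>" and pos: "\<And>i. i \<in> {1..k} \<Longrightarrow> 0 < rho \<Lambda> lab i"
  shows "star_hom A A (rho_dynamics k \<Lambda> lab \<gamma> s t)"
    "\<kappa> \<in> mor \<Lambda> \<Longrightarrow> rho_dynamics k \<Lambda> lab \<gamma> s t (S \<kappa>) = cscale A (cis (t * weight \<kappa> / s)) (S \<kappa>)"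
proof -
  define z where "z = (\<lambda>i \<in> {1..k}. complex_of_real (rho \<Lambda> lab i) powr (\<i> * complex_of_real (t / s)))"
  \<comment> \<open>The base is a positive real, so the complex power uses the real logarithm and
    has modulus 1.\<close>
  have zi: "z i = cis (t / s * ln (rho \<Lambda> lab i))" if "i \<in> {1..k}" for i
    using that pos[OF that] by (simp add: z_def powr_def Ln_of_real cis_conv_exp mult_ac)
  have "z \<in> extensional {1..k}" unfolding z_def by (rule restrict_extensional)
  then have z: "z \<in> torus k" unfolding torus_def PiE_def by (auto simp: zi)
  then show "star_hom A A (rho_dynamics k \<Lambda> lab \<gamma> s t)"
    using gauge by (simp add: is_gauge_action_def rho_dynamics_def z_def)
  assume "\<kappa> \<in> mor \<Lambda>"
  then have "rho_dynamics k \<Lambda> lab \<gamma> s t (S \<kappa>) = cscale A (\<Prod>i = 1..k. z i ^ deg \<Lambda> \<kappa> i) (S \<kappa>)"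
    using gauge z unfolding is_gauge_action_def rho_dynamics_def z_def[symmetric] by blast
  also have "(\<Prod>i = 1..k. z i ^ deg \<Lambda> \<kappa> i) = (\<Prod>i = 1..k. cis (real (deg \<Lambda> \<kappa> i) * (t / s * ln (rho \<Lambda> lab i))))"
    by (rule prod.cong) (simp_all only: zi Complex.DeMoivre)
  also have "\<dots> = cis (\<Sum>i = 1..k. real (deg \<Lambda> \<kappa> i) * (t / s * ln (rho \<Lambda> lab i)))"
    by (simp add: cis_conv_exp exp_sum sum_distrib_left)
  also have "(\<Sum>i = 1..k. real (deg \<Lambda> \<kappa> i) * (t / s * ln (rho \<Lambda> lab i))) = t * weight \<kappa> / s"
    by (simp add: weight_def sum_distrib_left sum_divide_distrib mult_ac)
  finally show "rho_dynamics k \<Lambda> lab \<gamma> s t (S \<kappa>) = cscale A (cis (t * weight \<kappa> / s)) (S \<kappa>)" .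
qed

end

theorem corollary3p15:
  fixes k :: nat and \<Lambda> :: "'g kgraph" and lab :: "'g \<Rightarrow> nat"
    and A :: "'a cstar" and S :: "'g \<Rightarrow> 'a" and \<gamma> :: "(nat \<Rightarrow> complex) \<Rightarrow> 'a \<Rightarrow> 'a"
    and x :: "'g \<Rightarrow> real" and M :: "'g ipath measure"
    and X :: "real set" and s :: real and \<mu> :: "real measure"
  assumes kgraph: "kgraph k \<Lambda>"
    and finite: "finite_kgraph k \<Lambda>"
    and connected: "strongly_connected \<Lambda>"
    and labelling: "vertex_labelling \<Lambda> lab"
    and zero_one: "\<And>i. i \<in> {1..k} \<Longrightarrow> zero_one_mat (vertex_mat \<Lambda> lab i)"
    and zero_one_prod: "zero_one_mat (vertex_mat_prod k \<Lambda> lab)"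
    and algebra: "is_kgraph_cstar_algebra k \<Lambda> A S"
    and gauge: "is_gauge_action k \<Lambda> A S \<gamma>"
    and pf_vector: "perron_frobenius_vector k \<Lambda> lab x"
    and pf_measure: "perron_frobenius_measure k \<Lambda> lab x M"
    and X_def: "X = Psi k \<Lambda> lab ` infinite_paths k \<Lambda>"
    and dimension: "has_hausdorff_dimension X s"
    and s_pos: "0 < s"
    and mu_def: "\<mu> = normalized_hausdorff s X"
    and mu_push_forward: "\<And>E. \<lbrakk>E \<in> sets borel; E \<subseteq> X\<rbrakk> \<Longrightarrow>
      emeasure \<mu> E = emeasure M (Psi k \<Lambda> lab -` E \<inter> infinite_paths k \<Lambda>)"
  shows "\<exists>!\<phi>. \<phi> \<in> extensional (carrier A) \<and>
    is_KMS_state A (rho_dynamics k \<Lambda> lab \<gamma> s) s \<phi> \<and>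
    (\<forall>\<kappa> \<in> mor \<Lambda>. \<forall>\<nu> \<in> mor \<Lambda>. \<phi> (S \<kappa> \<otimes>\<^bsub>A\<^esub> cadj A (S \<nu>)) =
      (if \<kappa> = \<nu> then complex_of_real (measure \<mu> (Psi k \<Lambda> lab ` cylinder k \<Lambda> \<kappa>)) else 0))"
proof -
  interpret kgraph k \<Lambda> by (rule kgraph)
  interpret cuntz_krieger_algebra k \<Lambda> A S
    using algebra finite kgraph
    by (auto simp: is_kgraph_cstar_algebra_def cuntz_krieger_algebra_def cuntz_krieger_algebra_axioms_def)
  interpret labelled: labelled_kgraph k \<Lambda> lab
    by unfold_locales (use finite labelling zero_one in auto)
  have universal: "\<exists>\<pi>. star_hom A B \<pi> \<and> (\<forall>\<kappa> \<in> mor \<Lambda>. \<pi> (S \<kappa>) = t \<kappa>)"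
    if "cstar_algebra B" "cuntz_krieger_family k \<Lambda> B t" for B :: "(nat \<Rightarrow> complex) cstar" and t
    using algebra that by (simp add: is_kgraph_cstar_algebra_def)
  have M: "prob_space M" "sets M = sets (path_borel k \<Lambda>)"
    and M_cylinder: "\<And>\<kappa>. \<kappa> \<in> mor \<Lambda> \<Longrightarrow> measure M (cylinder k \<Lambda> \<kappa>) =
        inverse (\<Prod>i = 1..k. rho \<Lambda> lab i ^ deg \<Lambda> \<kappa> i) * x (src \<Lambda> \<kappa>)"
    using pf_measure by (auto simp: perron_frobenius_measure_def)
  have space: "space M = infinite_paths k \<Lambda>" by (rule labelled.space_path_measure[OF M(2)])
  \<comment> \<open>A probability space is nonempty; the path is needed for the positivity of the
    spectral radii.\<close>
  then obtain y where y: "y \<in> infinite_paths k \<Lambda>"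
    using prob_space.not_empty[OF M(1)] by blast
  have \<rho>: "\<And>i. i \<in> {1..k} \<Longrightarrow> 0 < rho \<Lambda> lab i"
    using labelled.rho_positive[OF pf_vector y] .
  have x: "\<And>v. v \<in> vertices \<Lambda> \<Longrightarrow> 0 < x v" using pf_vector by (simp add: perron_frobenius_vector_def)
  define m where "m \<kappa> = measure M (cylinder k \<Lambda> \<kappa>)" for \<kappa>
  have m: "m \<kappa> = exp (- labelled.weight \<kappa>) * x (src \<Lambda> \<kappa>)" if "\<kappa> \<in> mor \<Lambda>" for \<kappa>
    using M_cylinder[OF that] labelled.exp_weight[OF \<rho>] by (simp add: m_def)
  have m_pos: "0 < m \<kappa>" if "\<kappa> \<in> mor \<Lambda>" for \<kappa>
    using m[OF that] x[OF src_vertex[OF that]] by simp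
  \<comment> \<open>The source of a composite is that of its second factor, so the eigenvector entry
    stays and only the exponential factor changes.\<close>
  have m_comp: "m (composite \<Lambda> \<kappa> \<sigma>) = exp (- labelled.weight \<kappa>) * m \<sigma>"
    if "\<kappa> \<in> mor \<Lambda>" "\<sigma> \<in> mor \<Lambda>" "src \<Lambda> \<kappa> = rng \<Lambda> \<sigma>" for \<kappa> \<sigma>
    using that by (simp add: m labelled.weight_comp mult.assoc[symmetric] exp_add[symmetric])
  have \<mu>: "measure \<mu> (Psi k \<Lambda> lab ` cylinder k \<Lambda> \<kappa>) = m \<kappa>" if "\<kappa> \<in> mor \<Lambda>" for \<kappa>
    unfolding m_def
  proof (rule labelled.measure_Psi_cylinder[OF M(2) _ _ that])
    show "emeasure \<mu> E = emeasure M (Psi k \<Lambda> lab -` E \<inter> infinite_paths k \<Lambda>)"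
      if "E \<in> sets borel" "E \<subseteq> Psi k \<Lambda> lab ` infinite_paths k \<Lambda>" for E
      using mu_push_forward[of E] that by (simp add: X_def)
    have "X \<in> hausdorff_sets s" using dimension by (simp add: has_hausdorff_dimension_def)
    then show "emeasure \<mu> {t} = 0" if "t \<in> Psi k \<Lambda> lab ` infinite_paths k \<Lambda>" for t
      unfolding mu_def using that by (intro normalized_hausdorff_singleton s_pos) (simp_all add: X_def)
  qed
  obtain \<phi>0 where \<phi>0: "positive_functional \<phi>0" "\<phi>0 unit = 1"
    "\<forall>\<kappa> \<in> mor \<Lambda>. \<forall>\<nu> \<in> mor \<Lambda>.
      \<phi>0 (S \<kappa> \<otimes>\<^bsub>A\<^esub> cadj A (S \<nu>)) = (if \<kappa> = \<nu> then of_real (m \<kappa>) else 0)"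
    unfolding m_def
  proof (rule measure_functional[OF universal M(1) _ space])
    show "cylinder k \<Lambda> \<kappa> \<in> sets M" if "\<kappa> \<in> mor \<Lambda>" for \<kappa>
      using labelled.cylinder_sets[OF M(2) that] .
    show "0 < measure M (cylinder k \<Lambda> \<kappa>)" if "\<kappa> \<in> mor \<Lambda>" for \<kappa>
      using m_pos[OF that] by (simp add: m_def)
  qed
  \<comment> \<open>Uniqueness is claimed among functions fixed outside the carrier, hence the
    restriction.\<close>
  define \<phi> where "\<phi> = restrict \<phi>0 (carrier A)"
  have \<phi>: "positive_functional \<phi>" "\<phi> unit = 1"
    using \<phi>0(1,2) by (simp_all add: positive_functional_def \<phi>_def)
  have diag: "\<phi> (S \<kappa> \<otimes>\<^bsub>A\<^esub> cadj A (S \<nu>)) = (if \<kappa> = \<nu> then of_real (m \<kappa>) else 0)"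
    if "\<kappa> \<in> mor \<Lambda>" "\<nu> \<in> mor \<Lambda>" for \<kappa> \<nu>
    using \<phi>0(3) that by (simp add: \<phi>_def)
  have KMS: "is_KMS_state A (rho_dynamics k \<Lambda> lab \<gamma> s) s \<phi>"
    unfolding is_KMS_state_def
  proof (intro conjI ballI allI impI; (elim conjE)?)
    show "is_state A \<phi>" by (rule stateI[OF \<phi>])
    fix a b F
    assume ab: "a \<in> carrier A" "b \<in> carrier A" and F: "analytic_extension A (rho_dynamics k \<Lambda> lab \<gamma> s) a F"
    show "\<phi> (a \<otimes>\<^bsub>A\<^esub> b) = \<phi> (b \<otimes>\<^bsub>A\<^esub> F (\<i> * complex_of_real s))"
    \<comment> \<open>The inverse temperature \<open>s\<close> cancels the divisor \<open>s\<close>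
      in the exponent of the dynamics, which leaves exactly the scaling of the measure.\<close>
    proof (rule KMS_analytic[where m = m and L = labelled.weight and \<alpha> = "rho_dynamics k \<Lambda> lab \<gamma> s"])
      show "star_hom A A (rho_dynamics k \<Lambda> lab \<gamma> s t)" for t
        by (rule labelled.rho_dynamics_generator(1)[OF gauge \<rho>])
      show "rho_dynamics k \<Lambda> lab \<gamma> s t (S \<kappa>) = cscale A (cis (t * labelled.weight \<kappa> / s)) (S \<kappa>)"
        if "\<kappa> \<in> mor \<Lambda>" for t \<kappa>
        by (rule labelled.rho_dynamics_generator(2)[OF gauge \<rho> that])
    qed (use \<phi> diag m_comp s_pos ab F in auto)
  qed
  show ?thesis
  proof (rule ex1I[of _ \<phi>], intro conjI ballI)
    show "\<phi> \<in> extensional (carrier A)" by (simp add: \<phi>_def)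
    show "\<phi> (S \<kappa> \<otimes>\<^bsub>A\<^esub> cadj A (S \<nu>)) =
        (if \<kappa> = \<nu> then complex_of_real (measure \<mu> (Psi k \<Lambda> lab ` cylinder k \<Lambda> \<kappa>)) else 0)"
      if "\<kappa> \<in> mor \<Lambda>" "\<nu> \<in> mor \<Lambda>" for \<kappa> \<nu>
      unfolding \<mu>[OF that(1)] by (rule diag[OF that])
  next
    fix \<psi>
    assume \<psi>: "\<psi> \<in> extensional (carrier A) \<and> is_KMS_state A (rho_dynamics k \<Lambda> lab \<gamma> s) s \<psi> \<and>
      (\<forall>\<kappa>\<in>mor \<Lambda>. \<forall>\<nu>\<in>mor \<Lambda>. \<psi> (S \<kappa> \<otimes>\<^bsub>A\<^esub> cadj A (S \<nu>)) =
        (if \<kappa> = \<nu> then complex_of_real (measure \<mu> (Psi k \<Lambda> lab ` cylinder k \<Lambda> \<kappa>)) else 0))"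
    then have "positive_functional \<psi>" by (auto simp: is_KMS_state_def intro: state_positive)
    moreover have "\<psi> (S \<kappa> \<otimes>\<^bsub>A\<^esub> cadj A (S \<nu>)) = \<phi> (S \<kappa> \<otimes>\<^bsub>A\<^esub> cadj A (S \<nu>))"
      if "\<kappa> \<in> mor \<Lambda>" "\<nu> \<in> mor \<Lambda>" for \<kappa> \<nu>
      unfolding diag[OF that] \<mu>[OF that(1), symmetric] using \<psi> that by blast
    \<comment> \<open>Both functionals are positive and agree on monomials, hence on the closure of
      their span.\<close>
    ultimately have "\<psi> a = \<phi> a" if "a \<in> carrier A" for a
      using functional_eqI[of \<psi> \<phi> a] \<phi>(1) that by blast
    then show "\<psi> = \<phi>"
      using \<psi> by (intro extensionalityI[of \<psi> "carrier A" \<phi>]) (auto simp: \<phi>_def)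
  qed (rule KMS)
qed

end
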